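(* The $\sharp$-products between the generators $E^\epsilon_n$ of $\bigoplus_{k\ge0}H_*(\Sigma_k)$ are determined by the identity $$E^0(s)\mathbin{\sharp}E^0(t)=E^0(s+t)\,E^0(t)$$ when $p=2$, and by the following identities when $p$ is odd (with $\delta_{i,j}$ the Kronecker delta): $$\tilde{E}^0(s)\mathbin{\sharp}\tilde{E}^0(t)=\bigl([p^{p-2}-1]\circ\tilde{E}^0(s)\circ\tilde{E}^0(t)\bigr)\prod_{c=0}^{p-1}\tilde{E}^0(cs+t),$$ $$\begin{aligned}\tilde{E}^0(s)\mathbin{\sharp}\tilde{E}^1(t)={}&\bigl([p^{p-2}-1]\circ\tilde{E}^0(s)\circ\tilde{E}^1(t)\bigr)\prod_{c=0}^{p-1}\tilde{E}^0(cs+t)\\&+\bigl([p^{p-2}-1]\circ\tilde{E}^0(s)\circ\tilde{E}^0(t)\bigr)\sum_{k=0}^{p-1}\prod_{c=0}^{p-1}\tilde{E}^{\delta_{c,k}}(cs+t),\end{aligned}$$ $$\begin{aligned}\tilde{E}^1(s)\mathbin{\sharp}\tilde{E}^0(t)={}&\bigl([p^{p-2}-1]\circ\tilde{E}^1(s)\circ\tilde{E}^0(t)\bigr)\prod_{c=0}^{p-1}\tilde{E}^0(cs+t)\\&+\bigl([p^{p-2}-1]\circ\tilde{E}^0(s)\circ\tilde{E}^0(t)\bigr)\sum_{k=0}^{p-1}k\prod_{c=0}^{p-1}\tilde{E}^{\delta_{c,k}}(cs+t),\end{aligned}$$ $$\begin{aligned}\tilde{E}^1(s)\mathbin{\sharp}\tilde{E}^1(t)={}&\bigl([p^{p-2}-1]\circ\tilde{E}^1(s)\circ\tilde{E}^1(t)\bigr)\prod_{c=0}^{p-1}\tilde{E}^0(cs+t)\\&-\bigl([p^{p-2}-1]\circ\tilde{E}^0(s)\circ\tilde{E}^1(t)\bigr)\sum_{k=0}^{p-1}k\prod_{c=0}^{p-1}\tilde{E}^{\delta_{c,k}}(cs+t)\\&+\bigl([p^{p-2}-1]\circ\tilde{E}^1(s)\circ\tilde{E}^0(t)\bigr)\sum_{k=0}^{p-1}\prod_{c=0}^{p-1}\tilde{E}^{\delta_{c,k}}(cs+t)\\&-\bigl([p^{p-2}-1]\circ\tilde{E}^0(s)\circ\tilde{E}^0(t)\bigr)\sum_{0\le\ell<k\le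 p-1}(k-\ell)\prod_{c=0}^{p-1}\tilde{E}^{\delta_{c,k}+\delta_{c,\ell}}(cs+t).\end{aligned}$$
   Context: Fix a prime $p$; $H_*$ denotes homology with $\mathbb{F}_p$-coefficients. On $\bigoplus_{k\ge0}H_*(\Sigma_k)$ consider the following products, each induced by group homomorphisms that are well defined up to conjugacy: $\circ$, induced by $\Sigma_m\times\Sigma_n\to\Sigma_{mn}$ from the action on $\{1,\dots,m\}\times\{1,\dots,n\}$; $\cdot$ (written as juxtaposition and $\prod$, with factors in order of increasing index), induced by $\Sigma_m\times\Sigma_n\to\Sigma_{m+n}$ from the action on $\{1,\dots,m\}\sqcup\{1,\dots,n\}$; and $\sharp:H_*(\Sigma_m)\otimes H_*(\Sigma_n)\to H_*(\Sigma_{n^m})$, induced by $\Sigma_m\times\Sigma_n\to\Sigma_{n^m}$ from the evident action of $\Sigma_m\times\Sigma_n$ on the set of functions $\{1,\dots,n\}^{\{1,\dots,m\}}$. For $n\ge0$, $[n]$ is the canonical generator of $H_0(\Sigma_n)$. The classes $E^\epsilon_n\in H_*(\Sigma_p)$: let $\pi$ be cyclic of order $p$ with generator $t$, embedded in $\Sigma_p$ by $t\mapsto(12\ldots p)$, and let $e_n\in H_n(\pi)$ be the class of the generator of the standard resolution of $\mathbb{F}_p$ by free modules $\mathbb{F}_p[\pi]e_n$ with $d(e_{2i+1})=(t-1)e_{2i}$, $d(e_{2i+2})=(1+t+\dots+t^{p-1})e_{2i+1}$. For $p$ odd, $E^0_n$ ($n\ge0$) and $E^1_n$ ($n\ge1$)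 are the images of $e_{2(p-1)n}$ and $e_{2(p-1)n-1}$; for $p=2$, $E^0_n$ is the image of $e_n$. Set $E^\epsilon(s)=\sum_{n\ge\epsilon}E^\epsilon_ns^n$, $\tilde{E}^0(s)=E^0(s^{p-1})$ and, for $p$ odd, $\tilde{E}^1(s)=s^{-1}E^1(s^{p-1})$. The identities are identities of formal power series in the commuting variables $s,t$ with coefficients in $\bigoplus_kH_*(\Sigma_k)$, all products being extended linearly over the powers of $s$ and $t$. *)

theory Defs
  imports
    "HOL-Algebra.Sym_Groups"
    "HOL-Algebra.Elementary_Groups"
    "HOL-Library.Poly_Mapping"
    "HOL-Computational_Algebra.Formal_Power_Series"
    "Berlekamp_Zassenhaus.Finite_Field"
begin

section \<open>Free modules\<close>

text \<open>The free module over a ring \<open>'k\<close> with basis \<open>'b\<close> is the type \<open>'b \<Rightarrow>\<^sub>0 'k\<close>.\<close>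

abbreviation gen :: "'b \<Rightarrow> 'b \<Rightarrow>\<^sub>0 'k::comm_ring_1"
  where "gen b \<equiv> Poly_Mapping.single b 1"

definition chain_scale :: "'k \<Rightarrow> ('b \<Rightarrow>\<^sub>0 'k) \<Rightarrow> 'b \<Rightarrow>\<^sub>0 'k::comm_ring_1"
  where "chain_scale a c = Poly_Mapping.map ((*) a) c"

definition lin_ext :: "('a \<Rightarrow> 'b \<Rightarrow>\<^sub>0 'k) \<Rightarrow> ('a \<Rightarrow>\<^sub>0 'k) \<Rightarrow> 'b \<Rightarrow>\<^sub>0 'k::comm_ring_1"
  where "lin_ext f c = (\<Sum>b\<in>Poly_Mapping.keys c. chain_scale (Poly_Mapping.lookup c b) (f b))"

definition lin_map :: "('a \<Rightarrow> 'b) \<Rightarrow> ('a \<Rightarrow>\<^sub>0 'k) \<Rightarrow> 'b \<Rightarrow>\<^sub>0 'k::comm_ring_1"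
  where "lin_map f = lin_ext (\<lambda>b. gen (f b))"

lemma lookup_chain_scale [simp]:
  "Poly_Mapping.lookup (chain_scale a c) x = a * Poly_Mapping.lookup c x"
  unfolding chain_scale_def by (simp add: Poly_Mapping.map.rep_eq when_def)

lemma lin_ext_superset:
  assumes "finite A" "Poly_Mapping.keys c \<subseteq> A"
  shows "lin_ext f c = (\<Sum>b\<in>A. chain_scale (Poly_Mapping.lookup c b) (f b))"
  unfolding lin_ext_def
  by (rule sum.mono_neutral_left)
    (use assms in \<open>auto simp: Poly_Mapping.in_keys_iff intro!: poly_mapping_eqI\<close>)

lemma lin_ext_zero [simp]: "lin_ext f 0 = 0"
  by (simp add: lin_ext_def)

lemma lin_ext_add: "lin_ext f (c + d) = lin_ext f c + lin_ext f d"
proof -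
  let ?A = "Poly_Mapping.keys c \<union> Poly_Mapping.keys d"
  have "lin_ext f x = (\<Sum>b\<in>?A. chain_scale (Poly_Mapping.lookup x b) (f b))"
    if "x \<in> {c, d, c + d}" for x
    using that by (intro lin_ext_superset) (auto dest: subsetD[OF Poly_Mapping.keys_add])
  then show ?thesis
    by (simp add: sum.distrib[symmetric])
      (intro sum.cong poly_mapping_eqI, auto simp: lookup_add algebra_simps)
qed

lemma lin_ext_scale: "lin_ext f (chain_scale a c) = chain_scale a (lin_ext f c)"
proof -
  have "lin_ext f (chain_scale a c)
      = (\<Sum>b\<in>Poly_Mapping.keys c. chain_scale (a * Poly_Mapping.lookup c b) (f b))"
    by (subst lin_ext_superset[of "Poly_Mapping.keys c"]) (auto simp: Poly_Mapping.in_keys_iff)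
  also have "\<dots> = chain_scale a (lin_ext f c)"
    by (intro poly_mapping_eqI) (simp add: lin_ext_def lookup_sum sum_distrib_left mult.assoc)
  finally show ?thesis .
qed

lemma chain_scale_minus_one: "chain_scale (- 1) c = - c"
  by (intro poly_mapping_eqI) simp

lemma chain_scale_zero: "chain_scale a 0 = 0"
  by (intro poly_mapping_eqI) simp

lemma lin_ext_uminus: "lin_ext f (- c) = - lin_ext f c"
  using lin_ext_scale[of f "- 1" c] by (simp add: chain_scale_minus_one)


section \<open>Group homology via the bar resolution\<close>

text \<open>A basis element \<open>(g, [g\<^sub>1, \<dots>, g\<^sub>n])\<close> of the (unnormalised) bar resolution
  of \<open>G\<close> stands for \<open>g[g\<^sub>1|\<dots>|g\<^sub>n]\<close>; \<open>G\<close> acts by left multiplication on the first component.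
  All degrees are collected in one module, so the homology below is the total homology
  \<open>H\<^sub>*\<close>.\<close>

definition bar_res_bd ::
  "('g, 'm) monoid_scheme \<Rightarrow> 'g \<times> 'g list \<Rightarrow> ('g \<times> 'g list) \<Rightarrow>\<^sub>0 'k::comm_ring_1"
  where "bar_res_bd G = (\<lambda>(g, gs).
     if gs = [] then 0
     else gen (g \<otimes>\<^bsub>G\<^esub> hd gs, tl gs)
       + (\<Sum>i = 1..<length gs. chain_scale ((- 1) ^ i)
            (gen (g, take (i - 1) gs @ (gs ! (i - 1) \<otimes>\<^bsub>G\<^esub> gs ! i) # drop (i + 1) gs)))
       + chain_scale ((- 1) ^ length gs) (gen (g, butlast gs)))"

text \<open>The trivial module tensored over the group ring with the bar resolution.\<close>

definition bar_bd ::
  "('g, 'm) monoid_scheme \<Rightarrow> ('g list \<Rightarrow>\<^sub>0 'k) \<Rightarrow> 'g list \<Rightarrow>\<^sub>0 'k::comm_ring_1"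
  where "bar_bd G = lin_ext (\<lambda>gs. lin_map snd (bar_res_bd G (\<one>\<^bsub>G\<^esub>, gs)))"

definition bar_chains :: "('g, 'm) monoid_scheme \<Rightarrow> ('g list \<Rightarrow>\<^sub>0 'k::comm_ring_1) set"
  where "bar_chains G = {c. Poly_Mapping.keys c \<subseteq> lists (carrier G)}"

definition bar_cycles :: "('g, 'm) monoid_scheme \<Rightarrow> ('g list \<Rightarrow>\<^sub>0 'k::comm_ring_1) set"
  where "bar_cycles G = {c \<in> bar_chains G. bar_bd G c = 0}"

definition bar_boundaries :: "('g, 'm) monoid_scheme \<Rightarrow> ('g list \<Rightarrow>\<^sub>0 'k::comm_ring_1) set"
  where "bar_boundaries G = bar_bd G ` bar_chains G"

text \<open>The cross product: signed sum over all shuffles of \<open>[(g\<^sub>1, 1), \<dots>, (g\<^sub>m, 1)]\<close>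
  and \<open>[(1, h\<^sub>1), \<dots>, (1, h\<^sub>n)]\<close>. It is a chain map from the tensor product of the
  bar complexes of \<open>G\<close> and \<open>H\<close> to the bar complex of \<open>G \<times>\<times> H\<close>.\<close>

fun signed_shuffles :: "'a list \<Rightarrow> 'a list \<Rightarrow> 'a list \<Rightarrow>\<^sub>0 'k::comm_ring_1" where
  "signed_shuffles [] ys = gen ys"
| "signed_shuffles xs [] = gen xs"
| "signed_shuffles (x # xs) (y # ys) =
     lin_map ((#) x) (signed_shuffles xs (y # ys))
     + chain_scale ((- 1) ^ length (x # xs)) (lin_map ((#) y) (signed_shuffles (x # xs) ys))"

definition bar_cross ::
  "('g, 'm) monoid_scheme \<Rightarrow> ('h, 'n) monoid_scheme \<Rightarrow>
   ('g list \<Rightarrow>\<^sub>0 'k) \<Rightarrow> ('h list \<Rightarrow>\<^sub>0 'k) \<Rightarrow> ('g \<times> 'h) list \<Rightarrow>\<^sub>0 'k::comm_ring_1"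
  where "bar_cross G H a b =
     lin_ext (\<lambda>gs. lin_ext (\<lambda>hs.
       signed_shuffles (map (\<lambda>g. (g, \<one>\<^bsub>H\<^esub>)) gs) (map (\<lambda>h. (\<one>\<^bsub>G\<^esub>, h)) hs)) b) a"

lemma bar_bd_linear:
  "bar_bd G 0 = 0" "bar_bd G (c + d) = bar_bd G c + bar_bd G d"
  "bar_bd G (chain_scale a c) = chain_scale a (bar_bd G c)" "bar_bd G (- c) = - bar_bd G c"
  by (simp_all add: bar_bd_def lin_ext_add lin_ext_scale lin_ext_uminus)

lemma bar_chains_closed:
  "0 \<in> bar_chains G"
  "c \<in> bar_chains G \<Longrightarrow> d \<in> bar_chains G \<Longrightarrow> c + d \<in> bar_chains G"
  "c \<in> bar_chains G \<Longrightarrow> chain_scale a c \<in> bar_chains G"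
  "c \<in> bar_chains G \<Longrightarrow> - c \<in> bar_chains G"
proof -
  show "0 \<in> bar_chains G"
    by (simp add: bar_chains_def)
  show "c + d \<in> bar_chains G" if "c \<in> bar_chains G" "d \<in> bar_chains G"
    using that Poly_Mapping.keys_add[of c d] by (auto simp: bar_chains_def)
  have "Poly_Mapping.keys (chain_scale a c) \<subseteq> Poly_Mapping.keys c"
    by (auto simp: Poly_Mapping.in_keys_iff)
  then show "chain_scale a c \<in> bar_chains G" if "c \<in> bar_chains G"
    using that by (auto simp: bar_chains_def)
  show "- c \<in> bar_chains G" if "c \<in> bar_chains G"
    using that by (auto simp: bar_chains_def Poly_Mapping.in_keys_iff subset_iff)
qed

lemma bar_cycles_closed:
  "0 \<in> bar_cycles G"
  "c \<in> bar_cycles G \<Longrightarrow> d \<in> bar_cycles G \<Longrightarrow> c + d \<in> bar_cycles G"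
  "c \<in> bar_cycles G \<Longrightarrow> chain_scale a c \<in> bar_cycles G"
  "c \<in> bar_cycles G \<Longrightarrow> - c \<in> bar_cycles G"
  by (simp_all add: bar_cycles_def bar_bd_linear bar_chains_closed chain_scale_zero)

lemma bar_boundaries_closed:
  "0 \<in> bar_boundaries G"
  "c \<in> bar_boundaries G \<Longrightarrow> d \<in> bar_boundaries G \<Longrightarrow> c + d \<in> bar_boundaries G"
  "c \<in> bar_boundaries G \<Longrightarrow> chain_scale a c \<in> bar_boundaries G"
  "c \<in> bar_boundaries G \<Longrightarrow> - c \<in> bar_boundaries G"
proof -
  have *: "bar_bd G c \<in> bar_boundaries G" if "c \<in> bar_chains G" for c
    using that by (simp add: bar_boundaries_def)
  show "0 \<in> bar_boundaries G"
    using *[OF bar_chains_closed(1)] by (simp add: bar_bd_linear)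
  show "c + d \<in> bar_boundaries G" if "c \<in> bar_boundaries G" "d \<in> bar_boundaries G"
    using that *[OF bar_chains_closed(2)] by (auto simp: bar_boundaries_def bar_bd_linear(2)[symmetric])
  show "chain_scale a c \<in> bar_boundaries G" if "c \<in> bar_boundaries G"
    using that *[OF bar_chains_closed(3)] by (auto simp: bar_boundaries_def bar_bd_linear(3)[symmetric])
  show "- c \<in> bar_boundaries G" if "c \<in> bar_boundaries G"
    using that *[OF bar_chains_closed(4)] by (auto simp: bar_boundaries_def bar_bd_linear(4)[symmetric])
qed


section \<open>The direct sum of the homologies of the symmetric groups\<close>

text \<open>The \<open>k\<close>-th component of a chain is a bar chain of \<open>\<Sigma>\<^sub>k\<close>.\<close>

type_synonym 'k sym_chain = "nat \<Rightarrow>\<^sub>0 ((nat \<Rightarrow> nat) list \<Rightarrow>\<^sub>0 'k)"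

definition sym_homologous :: "'k::comm_ring_1 sym_chain \<Rightarrow> 'k sym_chain \<Rightarrow> bool"
  where "sym_homologous c d \<longleftrightarrow> (\<forall>k.
     Poly_Mapping.lookup c k \<in> bar_cycles (sym_group k) \<and>
     Poly_Mapping.lookup d k \<in> bar_cycles (sym_group k) \<and>
     Poly_Mapping.lookup c k - Poly_Mapping.lookup d k \<in> bar_boundaries (sym_group k))"

quotient_type (overloaded) 'k sym_homology = "('k::comm_ring_1) sym_chain" / partial: sym_homologous
proof (rule part_equivpI)
  show "\<exists>c::'k sym_chain. sym_homologous c c"
    by (rule exI[of _ 0]) (simp add: sym_homologous_def bar_cycles_closed bar_boundaries_closed)
  show "symp (sym_homologous :: 'k sym_chain \<Rightarrow> _)"
    unfolding symp_def
  proof (intro allI impI)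
    fix c d :: "'k sym_chain"
    assume *: "sym_homologous c d"
    have "Poly_Mapping.lookup d k - Poly_Mapping.lookup c k \<in> bar_boundaries (sym_group k)" for k
      using bar_boundaries_closed(4)[of "Poly_Mapping.lookup c k - Poly_Mapping.lookup d k" "sym_group k"] *
      by (simp add: sym_homologous_def)
    with * show "sym_homologous d c"
      by (simp add: sym_homologous_def)
  qed
  show "transp (sym_homologous :: 'k sym_chain \<Rightarrow> _)"
    unfolding transp_def
  proof (intro allI impI)
    fix c d e :: "'k sym_chain"
    assume *: "sym_homologous c d" "sym_homologous d e"
    have "Poly_Mapping.lookup c k - Poly_Mapping.lookup e k \<in> bar_boundaries (sym_group k)" for k
      using bar_boundaries_closed(2)[of "Poly_Mapping.lookup c k - Poly_Mapping.lookup d k" "sym_group k"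
          "Poly_Mapping.lookup d k - Poly_Mapping.lookup e k"] *
      by (simp add: sym_homologous_def)
    with * show "sym_homologous c e"
      by (simp add: sym_homologous_def)
  qed
qed

instantiation sym_homology :: (comm_ring_1) ab_group_add
begin

lift_definition zero_sym_homology :: "'a sym_homology" is 0
  by (simp add: sym_homologous_def bar_cycles_closed bar_boundaries_closed)

lift_definition plus_sym_homology :: "'a sym_homology \<Rightarrow> 'a sym_homology \<Rightarrow> 'a sym_homology"
  is "(+)"
  by (simp add: sym_homologous_def lookup_add bar_cycles_closed add_diff_add bar_boundaries_closed)

lift_definition uminus_sym_homology :: "'a sym_homology \<Rightarrow> 'a sym_homology" is uminus
proof -
  fix c d :: "'a sym_chain"
  assume *: "sym_homologous c d"
  have "- Poly_Mapping.lookup c k - - Poly_Mapping.lookup d k \<in> bar_boundaries (sym_group k)" for k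
    using bar_boundaries_closed(4)[of "Poly_Mapping.lookup c k - Poly_Mapping.lookup d k" "sym_group k"] *
    by (simp add: sym_homologous_def)
  with * show "sym_homologous (- c) (- d)"
    by (simp add: sym_homologous_def bar_cycles_closed)
qed

definition minus_sym_homology :: "'a sym_homology \<Rightarrow> 'a sym_homology \<Rightarrow> 'a sym_homology"
  where "minus_sym_homology x y = x + - y"

instance
proof
  fix a b c :: "'a sym_homology"
  show "a + b + c = a + (b + c)"
    by transfer (auto simp: sym_homologous_def lookup_add bar_cycles_closed bar_boundaries_closed add.assoc)
  show "a + b = b + a"
    by transfer (auto simp: sym_homologous_def lookup_add bar_cycles_closed bar_boundaries_closed add.commute)
  show "0 + a = a"
    by transfer simp
  show "- a + a = 0"
    by transfer (simp add: sym_homologous_def bar_cycles_closed bar_boundaries_closed)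
  show "a - b = a + - b"
    by (simp add: minus_sym_homology_def)
qed

end

lift_definition homology_scale :: "'k \<Rightarrow> 'k sym_homology \<Rightarrow> 'k::comm_ring_1 sym_homology"
  is "\<lambda>a. Poly_Mapping.map (chain_scale a)"
proof -
  fix a :: 'k and c d :: "'k sym_chain"
  assume *: "sym_homologous c d"
  have "Poly_Mapping.lookup (Poly_Mapping.map (chain_scale a) x) k
      = chain_scale a (Poly_Mapping.lookup x k)" for x :: "'k sym_chain" and k
    by (auto simp: Poly_Mapping.map.rep_eq when_def intro!: poly_mapping_eqI)
  moreover have "chain_scale a x - chain_scale a y = chain_scale a (x - y)"
    for x y :: "(nat \<Rightarrow> nat) list \<Rightarrow>\<^sub>0 'k"
    by (intro poly_mapping_eqI) (simp add: lookup_minus algebra_simps)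
  ultimately show "sym_homologous (Poly_Mapping.map (chain_scale a) c) (Poly_Mapping.map (chain_scale a) d)"
    using * by (simp add: sym_homologous_def bar_cycles_closed bar_boundaries_closed)
qed

definition sym_class :: "nat \<Rightarrow> ((nat \<Rightarrow> nat) list \<Rightarrow>\<^sub>0 'k) \<Rightarrow> 'k::comm_ring_1 sym_homology"
  where "sym_class k z = abs_sym_homology (Poly_Mapping.single k z)"

text \<open>The class \<open>[n]\<close>.\<close>

definition point_class :: "nat \<Rightarrow> 'k::comm_ring_1 sym_homology"
  where "point_class n = sym_class n (gen [])"


section \<open>The products\<close>

text \<open>A permutation of a finite set \<open>A\<close>, transported to \<open>{1..card A}\<close> along an arbitrary
  bijection. A different bijection changes the resulting homomorphisms by a conjugation,
  which does not affect homology.\<close>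

definition enumeration :: "'a set \<Rightarrow> 'a \<Rightarrow> nat"
  where "enumeration A = (SOME e. bij_betw e A {1..card A})"

definition to_sym :: "'a set \<Rightarrow> ('a \<Rightarrow> 'a) \<Rightarrow> nat \<Rightarrow> nat"
  where "to_sym A g i =
    (if i \<in> {1..card A} then enumeration A (g (inv_into A (enumeration A) i)) else i)"

definition times_hom :: "nat \<Rightarrow> nat \<Rightarrow> (nat \<Rightarrow> nat) \<times> (nat \<Rightarrow> nat) \<Rightarrow> nat \<Rightarrow> nat"
  where "times_hom m n = (\<lambda>(\<sigma>, \<tau>). to_sym ({1..m} \<times> {1..n}) (map_prod \<sigma> \<tau>))"

definition plus_hom :: "nat \<Rightarrow> nat \<Rightarrow> (nat \<Rightarrow> nat) \<times> (nat \<Rightarrow> nat) \<Rightarrow> nat \<Rightarrow> nat"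
  where "plus_hom m n = (\<lambda>(\<sigma>, \<tau>). to_sym ({1..m} <+> {1..n}) (map_sum \<sigma> \<tau>))"

definition power_hom :: "nat \<Rightarrow> nat \<Rightarrow> (nat \<Rightarrow> nat) \<times> (nat \<Rightarrow> nat) \<Rightarrow> nat \<Rightarrow> nat"
  where "power_hom m n = (\<lambda>(\<sigma>, \<tau>).
    to_sym ({1..m} \<rightarrow>\<^sub>E {1..n}) (\<lambda>f. \<lambda>j\<in>{1..m}. \<tau> (f (inv' \<sigma> j))))"

text \<open>The bilinear product induced by homomorphisms
  \<open>\<phi> m n : \<Sigma>\<^sub>m \<times> \<Sigma>\<^sub>n \<rightarrow> \<Sigma>\<^bsub>N m n\<^esub>\<close>. The choice of representing cycles is immaterial,
  since cross product and push-forward are chain maps.\<close>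

definition induced_prod ::
  "(nat \<Rightarrow> nat \<Rightarrow> nat) \<Rightarrow> (nat \<Rightarrow> nat \<Rightarrow> (nat \<Rightarrow> nat) \<times> (nat \<Rightarrow> nat) \<Rightarrow> nat \<Rightarrow> nat) \<Rightarrow>
   'k sym_homology \<Rightarrow> 'k sym_homology \<Rightarrow> 'k::comm_ring_1 sym_homology"
  where "induced_prod N \<phi> x y = (let a = rep_sym_homology x; b = rep_sym_homology y in
    \<Sum>m\<in>Poly_Mapping.keys a. \<Sum>n\<in>Poly_Mapping.keys b.
      sym_class (N m n) (lin_map (map (\<phi> m n))
        (bar_cross (sym_group m) (sym_group n) (Poly_Mapping.lookup a m) (Poly_Mapping.lookup b n))))"

definition circ_prod :: "'k sym_homology \<Rightarrow> 'k sym_homology \<Rightarrow> 'k::comm_ring_1 sym_homology"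
  where "circ_prod = induced_prod (\<lambda>m n. m * n) times_hom"

definition dot_prod :: "'k sym_homology \<Rightarrow> 'k sym_homology \<Rightarrow> 'k::comm_ring_1 sym_homology"
  where "dot_prod = induced_prod (\<lambda>m n. m + n) plus_hom"

definition sharp_prod :: "'k sym_homology \<Rightarrow> 'k sym_homology \<Rightarrow> 'k::comm_ring_1 sym_homology"
  where "sharp_prod = induced_prod (\<lambda>m n. n ^ m) power_hom"


section \<open>The generators\<close>

text \<open>The cyclic group of order \<open>p\<close> is \<open>integer_mod_group p\<close> (written additively, with
  generator \<open>t = 1\<close>). The chain \<open>std_res p n\<close> is the image of the generator \<open>e\<^sub>n\<close> of the
  standard resolution under the equivariant, augmentation-preserving chain map to the bar
  resolution obtained from the contraction \<open>g[g\<^sub>1|\<dots>|g\<^sub>n] \<mapsto> [g|g\<^sub>1|\<dots>|g\<^sub>n]\<close> of the latter: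
  it applies the contraction to the image of \<open>d e\<^sub>n\<close>.\<close>

definition cyc_act :: "nat \<Rightarrow> nat \<Rightarrow> ((int \<times> int list) \<Rightarrow>\<^sub>0 'k) \<Rightarrow> (int \<times> int list) \<Rightarrow>\<^sub>0 'k::comm_ring_1"
  where "cyc_act p k = lin_map (\<lambda>(g, gs). (int k \<otimes>\<^bsub>integer_mod_group p\<^esub> g, gs))"

fun std_res :: "nat \<Rightarrow> nat \<Rightarrow> (int \<times> int list) \<Rightarrow>\<^sub>0 'k::comm_ring_1" where
  "std_res p 0 = gen (0, [])"
| "std_res p (Suc n) = lin_map (\<lambda>(g, gs). (0, g # gs))
     (if even n then cyc_act p 1 (std_res p n) - std_res p n
      else \<Sum>k<p. cyc_act p k (std_res p n))"

text \<open>The image of \<open>e\<^sub>n\<close> under \<open>t \<mapsto> (1 2 \<dots> p)\<close>.\<close>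

definition cyc_class :: "nat \<Rightarrow> nat \<Rightarrow> 'k::comm_ring_1 sym_homology"
  where "cyc_class p n =
    sym_class p (lin_map (map (\<lambda>k. cycle_of_list [1..<Suc p] ^^ nat k)) (lin_map snd (std_res p n)))"

definition E_class :: "nat \<Rightarrow> nat \<Rightarrow> nat \<Rightarrow> 'k::comm_ring_1 sym_homology"
  where "E_class p \<epsilon> n = (if p = 2 then cyc_class p n else cyc_class p (2 * (p - 1) * n - \<epsilon>))"


section \<open>Power series\<close>

definition E_series :: "nat \<Rightarrow> nat \<Rightarrow> 'k::comm_ring_1 sym_homology fps"
  where "E_series p \<epsilon> = Abs_fps (\<lambda>n. if \<epsilon> \<le> n then E_class p \<epsilon> n else 0)"

text \<open>\<open>F(s) \<mapsto> F(s\<^sup>k)\<close>\<close>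

definition fps_stretch :: "nat \<Rightarrow> 'a::zero fps \<Rightarrow> 'a fps"
  where "fps_stretch k F = Abs_fps (\<lambda>n. if k dvd n then fps_nth F (n div k) else 0)"

text \<open>The series \<open>E\<close> with tilde; \<open>fps_shift 1\<close> is division by the variable.\<close>

definition Et_series :: "nat \<Rightarrow> nat \<Rightarrow> 'k::comm_ring_1 sym_homology fps"
  where "Et_series p \<epsilon> = fps_shift \<epsilon> (fps_stretch (p - 1) (E_series p \<epsilon>))"

text \<open>Series in two variables have type \<open>_ fps fps\<close>; the outer variable is \<open>t\<close>, the
  inner one is \<open>s\<close>.\<close>

type_synonym 'k hseries = "'k sym_homology fps fps"

definition var_s :: "'k::comm_ring_1 fps fps"
  where "var_s = fps_const fps_X"

definition var_t :: "'k::comm_ring_1 fps fps"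
  where "var_t = fps_X"

definition const_series :: "'k sym_homology \<Rightarrow> 'k::comm_ring_1 hseries"
  where "const_series x = fps_const (fps_const x)"

text \<open>\<open>F(u) = \<Sum>n. F\<^sub>n u\<^sup>n\<close> for a scalar series \<open>u\<close> without constant term: the terms with
  \<open>n > i + j\<close> do not contribute to the coefficient of \<open>s\<^sup>i t\<^sup>j\<close>.\<close>

definition series_subst :: "'k sym_homology fps \<Rightarrow> 'k fps fps \<Rightarrow> 'k::comm_ring_1 hseries"
  where "series_subst F u = Abs_fps (\<lambda>j. Abs_fps (\<lambda>i.
    \<Sum>n\<le>i + j. homology_scale (fps_nth (fps_nth (u ^ n) j) i) (fps_nth F n)))"

definition scale_series :: "'k \<Rightarrow> 'k hseries \<Rightarrow> 'k::comm_ring_1 hseries"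
  where "scale_series a F = Abs_fps (\<lambda>j. Abs_fps (\<lambda>i. homology_scale a (fps_nth (fps_nth F j) i)))"

definition fps_prod_ext :: "('a \<Rightarrow> 'b \<Rightarrow> 'c) \<Rightarrow> 'a fps \<Rightarrow> 'b fps \<Rightarrow> 'c::comm_monoid_add fps"
  where "fps_prod_ext f F G = Abs_fps (\<lambda>n. \<Sum>i\<le>n. f (fps_nth F i) (fps_nth G (n - i)))"

definition circ_series :: "'k hseries \<Rightarrow> 'k hseries \<Rightarrow> 'k::comm_ring_1 hseries"  (infixl \<open>\<circ>\<^sub>H\<close> 70)
  where "(\<circ>\<^sub>H) = fps_prod_ext (fps_prod_ext circ_prod)"

definition dot_series :: "'k hseries \<Rightarrow> 'k hseries \<Rightarrow> 'k::comm_ring_1 hseries"  (infixl \<open>\<cdot>\<^sub>H\<close> 70)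
  where "(\<cdot>\<^sub>H) = fps_prod_ext (fps_prod_ext dot_prod)"

definition sharp_series :: "'k hseries \<Rightarrow> 'k hseries \<Rightarrow> 'k::comm_ring_1 hseries"  (infixl \<open>\<sharp>\<^sub>H\<close> 70)
  where "(\<sharp>\<^sub>H) = fps_prod_ext (fps_prod_ext sharp_prod)"

text \<open>The product of \<open>F c\<close> for \<open>c = 0, \<dots>, p - 1\<close> in this order; \<open>[0]\<close> is the unit.\<close>

definition dot_prod_upto :: "nat \<Rightarrow> (nat \<Rightarrow> 'k hseries) \<Rightarrow> 'k::comm_ring_1 hseries"
  where "dot_prod_upto p F = foldr (\<lambda>c G. F c \<cdot>\<^sub>H G) [0..<p] (const_series (point_class 0))"

end

theory Submission
  imports Defs "HOL-Number_Theory.Residue_Primitive_Roots"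
begin

text \<open>Let \<open>\<pi>\<close> be cyclic of order \<open>p\<close>. Under the action
  \<open>f \<mapsto> (j \<mapsto> f (j - a) + b)\<close> of \<open>\<pi> \<times> \<pi>\<close>, the set of functions from the integers modulo \<open>p\<close> to
  themselves is the disjoint union of the \<open>p\<close> sets of affine functions of slope \<open>-c\<close>, on which
  \<open>(a, b)\<close> acts as translation by \<open>c a + b\<close>, and of \<open>p\<^bsup>p-2\<^esup> - 1\<close> free orbits. A disjoint union of
  actions corresponds to the diagonal of \<open>\<pi> \<times> \<pi>\<close> followed by juxtaposition, the free orbits give the
  product \<open>\<circ>\<close>, and the affine functions give the substitution of \<open>c s + t\<close>.

  All these classes are computed in bar resolutions: a family of chains \<open>c m n\<close> whose boundaries
  are those of the tensor square of the standard resolution, with respect to commuting group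
  elements \<open>t\<close> and \<open>s\<close>, is determined by \<open>t\<close> and \<open>s\<close> up to homotopy, and conjugating \<open>t\<close> and \<open>s\<close>
  does not change its homology classes; so it suffices to exhibit such families. The classes of
  \<open>\<pi>\<close> in degrees other than \<open>0\<close> and \<open>-1\<close> modulo \<open>2 (p - 1)\<close> vanish in the symmetric group because the
  normaliser of \<open>\<pi>\<close> acts on them through powers of a primitive root.\<close>

section \<open>Linear maps between free modules\<close>

text \<open>Keeping the tensor square of the standard resolution, with its two separate degrees,
  matters because these degrees become the exponents of s and t. Uniqueness up to homotopy also
  absorbs the arbitrary bijections in the definitions of the products. The vanishing result turns
  the coefficient of s^m in the tilde series into the standard class of degree 2m + \<epsilon> for
  every m. Thus the four identities for odd p are the four parity components of one equality between
  families indexed by all bidegrees. The two cases of the theorem part at a single coefficient. In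
  the diagonal of the standard resolution, the term with both degrees odd becomes 0 + 1 + ... + (p -
  1) on coinvariants; this is 0 modulo an odd p and 1 for p = 2. So for odd p an odd class splits
  with exactly one odd factor, whence the sums over k with Kronecker deltas. For p = 2 every
  coefficient is 1, and since p^(p-2) - 1 = 0 there are no free orbits and no factor with the circle
  product.\<close>

abbreviation chain_linear :: "(('a \<Rightarrow>\<^sub>0 'k) \<Rightarrow> 'b \<Rightarrow>\<^sub>0 'k::comm_ring_1) \<Rightarrow> bool"
  where "chain_linear \<equiv> module_hom chain_scale chain_scale"

lemma module_chain_scale: "Modules.module (chain_scale :: 'k::comm_ring_1 \<Rightarrow> ('b \<Rightarrow>\<^sub>0 'k) \<Rightarrow> _)"
  by unfold_locales (auto intro!: poly_mapping_eqI simp: lookup_add algebra_simps)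

lemmas chain_scale_simps [simp] =
  Modules.module.scale_zero_left[OF module_chain_scale]
  Modules.module.scale_zero_right[OF module_chain_scale]
  Modules.module.scale_one[OF module_chain_scale]
  Modules.module.scale_scale[OF module_chain_scale]
  Modules.module.scale_minus_left[OF module_chain_scale]
  Modules.module.scale_minus_right[OF module_chain_scale]

lemmas chain_scale_distribs =
  Modules.module.scale_right_distrib[OF module_chain_scale]
  Modules.module.scale_left_distrib[OF module_chain_scale]
  Modules.module.scale_right_diff_distrib[OF module_chain_scale]
  Modules.module.scale_left_diff_distrib[OF module_chain_scale]
  Modules.module.scale_sum_left[OF module_chain_scale]
  Modules.module.scale_sum_right[OF module_chain_scale]

lemma chain_linearI:
  assumes "\<And>x y. f (x + y) = f x + f y" "\<And>a x. f (chain_scale a x) = chain_scale a (f x)"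
  shows "chain_linear f"
  by (simp add: module_hom_iff module_chain_scale assms)

lemmas chain_linear_simps =
  module_hom.zero module_hom.add module_hom.neg module_hom.diff module_hom.sum module_hom.scale

lemma chain_linear_comp:
  assumes "chain_linear f" "chain_linear g" shows "chain_linear (\<lambda>x. f (g x))"
  by (rule chain_linearI)
    (simp_all add: chain_linear_simps[OF assms(1)] chain_linear_simps[OF assms(2)])

lemma chain_linear_id: "chain_linear (\<lambda>x. x)"
  by (rule chain_linearI) simp_all

lemma chain_linear_add:
  assumes "chain_linear f" "chain_linear g" shows "chain_linear (\<lambda>x. f x + g x)"
  by (rule chain_linearI)
    (simp_all add: chain_linear_simps[OF assms(1)] chain_linear_simps[OF assms(2)] chain_scale_distribs)

lemma chain_linear_uminus:
  assumes "chain_linear f" shows "chain_linear (\<lambda>x. - f x)"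
  by (rule chain_linearI) (simp_all add: chain_linear_simps[OF assms])

lemma chain_linear_diff:
  assumes "chain_linear f" "chain_linear g" shows "chain_linear (\<lambda>x. f x - g x)"
  using chain_linear_add[OF assms(1) chain_linear_uminus[OF assms(2)]] by simp

lemma chain_linear_scale:
  assumes "chain_linear f" shows "chain_linear (\<lambda>x. chain_scale a (f x))"
  by (rule chain_linearI)
    (simp_all add: chain_linear_simps[OF assms] chain_scale_distribs mult.commute)

lemma chain_linear_zero: "chain_linear (\<lambda>x. 0)"
  by (rule chain_linearI) simp_all

lemma chain_linear_sum:
  assumes "\<And>i. i \<in> A \<Longrightarrow> chain_linear (f i)" shows "chain_linear (\<lambda>x. \<Sum>i\<in>A. f i x)"
proof (rule chain_linearI)
  show "(\<Sum>i\<in>A. f i (x + y)) = (\<Sum>i\<in>A. f i x) + (\<Sum>i\<in>A. f i y)" for x y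
    using module_hom.add[OF assms] by (simp add: sum.distrib)
  show "(\<Sum>i\<in>A. f i (chain_scale a x)) = chain_scale a (\<Sum>i\<in>A. f i x)" for a x
    unfolding chain_scale_distribs
    by (intro sum.cong refl module_hom.scale[OF assms])
qed

lemma chain_linear_lin_ext: "chain_linear (lin_ext f)"
  by (rule chain_linearI) (simp_all add: lin_ext_add lin_ext_scale)

lemma chain_linear_lin_map: "chain_linear (lin_map f)"
  unfolding lin_map_def by (rule chain_linear_lin_ext)

lemmas chain_linear_intros =
  chain_linear_id chain_linear_add chain_linear_diff chain_linear_uminus chain_linear_scale
  chain_linear_zero chain_linear_sum chain_linear_lin_ext chain_linear_lin_map
  chain_linear_comp[OF chain_linear_lin_ext] chain_linear_comp[OF chain_linear_lin_map]

lemmas lin_ext_simps [simp] = chain_linear_simps[OF chain_linear_lin_ext]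
lemmas lin_map_simps [simp] = chain_linear_simps[OF chain_linear_lin_map]

lemma lin_ext_gen [simp]: "lin_ext f (gen b) = (f b :: _ \<Rightarrow>\<^sub>0 'k::comm_ring_1)"
  by (simp add: lin_ext_def)

lemma lin_map_gen [simp]: "lin_map f (gen b) = (gen (f b) :: _ \<Rightarrow>\<^sub>0 'k::comm_ring_1)"
  by (simp add: lin_map_def)

lemma lin_ext_gen_id: "lin_ext gen c = c"
proof (rule poly_mapping_eqI)
  fix x
  have "Poly_Mapping.lookup (lin_ext gen c) x
      = (\<Sum>b\<in>Poly_Mapping.keys c. if b = x then Poly_Mapping.lookup c b else 0)"
    by (simp add: lin_ext_def lookup_sum lookup_single when_def if_distrib[of "(*) _"] cong: if_cong)
  also have "\<dots> = Poly_Mapping.lookup c x"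
    by (simp add: Poly_Mapping.in_keys_iff)
  finally show "Poly_Mapping.lookup (lin_ext gen c) x = Poly_Mapping.lookup c x" .
qed

lemma chain_linear_eqI:
  assumes "chain_linear f" "chain_linear g"
    and "\<And>b. b \<in> Poly_Mapping.keys c \<Longrightarrow> f (gen b) = g (gen b)"
  shows "f c = g c"
proof -
  have c: "c = (\<Sum>b\<in>Poly_Mapping.keys c. chain_scale (Poly_Mapping.lookup c b) (gen b))"
    by (metis lin_ext_def lin_ext_gen_id)
  have "f (\<Sum>b\<in>Poly_Mapping.keys c. chain_scale (Poly_Mapping.lookup c b) (gen b))
      = g (\<Sum>b\<in>Poly_Mapping.keys c. chain_scale (Poly_Mapping.lookup c b) (gen b))"
    using assms by (simp add: chain_linear_simps[OF assms(1)] chain_linear_simps[OF assms(2)])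
  then show ?thesis
    using c by simp
qed

section \<open>Chains supported on a set of basis elements\<close>

definition chains_on :: "'b set \<Rightarrow> ('b \<Rightarrow>\<^sub>0 'k::comm_ring_1) set"
  where "chains_on B = {c. Poly_Mapping.keys c \<subseteq> B}"

lemma chains_on_iff: "c \<in> chains_on B \<longleftrightarrow> (\<forall>b. b \<notin> B \<longrightarrow> Poly_Mapping.lookup c b = 0)"
  by (auto simp: chains_on_def Poly_Mapping.in_keys_iff)

lemma chains_on_closed [simp]:
  "0 \<in> chains_on B"
  "c \<in> chains_on B \<Longrightarrow> d \<in> chains_on B \<Longrightarrow> c + d \<in> chains_on B"
  "c \<in> chains_on B \<Longrightarrow> d \<in> chains_on B \<Longrightarrow> c - d \<in> chains_on B"
  "c \<in> chains_on B \<Longrightarrow> - c \<in> chains_on B"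
  "c \<in> chains_on B \<Longrightarrow> chain_scale a c \<in> chains_on B"
  by (simp_all add: chains_on_iff lookup_add lookup_minus)

lemma chains_on_sum [simp]:
  "(\<And>i. i \<in> A \<Longrightarrow> f i \<in> chains_on B) \<Longrightarrow> (\<Sum>i\<in>A. f i) \<in> chains_on B"
  by (induction A rule: infinite_finite_induct) auto

lemma chains_on_gen [simp]: "b \<in> B \<Longrightarrow> gen b \<in> chains_on B"
  by (auto simp: chains_on_def)

lemma chain_linear_chains_on:
  assumes "chain_linear f" "c \<in> chains_on B" "\<And>b. b \<in> B \<Longrightarrow> f (gen b) \<in> chains_on C"
  shows "f c \<in> chains_on C"
proof -
  have c: "c = (\<Sum>b\<in>Poly_Mapping.keys c. chain_scale (Poly_Mapping.lookup c b) (gen b))"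
    by (metis lin_ext_def lin_ext_gen_id)
  have "f (\<Sum>b\<in>Poly_Mapping.keys c. chain_scale (Poly_Mapping.lookup c b) (gen b)) \<in> chains_on C"
    unfolding chain_linear_simps[OF assms(1)]
    using assms(2,3) by (intro chains_on_sum chains_on_closed(5)) (auto simp: chains_on_def[of B])
  with c show ?thesis by simp
qed

lemma chain_linear_eq_on:
  assumes "chain_linear f" "chain_linear g" "c \<in> chains_on B"
    and "\<And>b. b \<in> B \<Longrightarrow> f (gen b) = g (gen b)"
  shows "f c = g c"
  by (rule chain_linear_eqI[OF assms(1,2)]) (use assms(3,4) in \<open>auto simp: chains_on_def\<close>)

lemma chain_linear_eq_on2:
  assumes "\<And>b. chain_linear (\<lambda>a. f a b)" "\<And>a. chain_linear (f a)"
    "\<And>b. chain_linear (\<lambda>a. g a b)" "\<And>a. chain_linear (g a)"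
    and "a \<in> chains_on A" "b \<in> chains_on B"
    and "\<And>x y. x \<in> A \<Longrightarrow> y \<in> B \<Longrightarrow> f (gen x) (gen y) = g (gen x) (gen y)"
  shows "f a b = g a b"
  by (rule chain_linear_eq_on[of "\<lambda>a. f a b" "\<lambda>a. g a b", OF assms(1,3,5)])
    (rule chain_linear_eq_on[OF assms(2,4,6) assms(7)])

lemma lin_map_lin_map: "lin_map f (lin_map g c) = lin_map (\<lambda>x. f (g x)) c"
  by (rule chain_linear_eqI[where c = c]) (auto intro!: chain_linear_intros)

lemma lin_map_ident: "lin_map (\<lambda>x. x) c = c"
  unfolding lin_map_def by (rule lin_ext_gen_id)

text \<open>The sign (-1)^n on a bare abelian group, so that it also makes sense for the abstract
  operators below and for homology classes.\<close>

definition alt :: "nat \<Rightarrow> 'a::ab_group_add \<Rightarrow> 'a"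
  where "alt n x = (if even n then x else - x)"

lemma chain_scale_alt: "chain_scale ((- 1) ^ n) x = alt n x"
  by (auto simp: alt_def)

lemma chain_linear_alt: "chain_linear f \<Longrightarrow> chain_linear (\<lambda>x. alt n (f x))"
  by (cases "even n") (simp_all add: alt_def chain_linear_uminus)

lemma chains_on_alt [simp]: "c \<in> chains_on B \<Longrightarrow> alt n c \<in> chains_on B"
  by (simp add: alt_def)

section \<open>The bar resolution\<close>

text \<open>Chains of all degrees share one type, so the degree is recorded through the
  support.\<close>

definition cells :: "('g, 'm) monoid_scheme \<Rightarrow> nat \<Rightarrow> ('g \<times> 'g list) set"
  where "cells G n = {(g, gs). g \<in> carrier G \<and> set gs \<subseteq> carrier G \<and> length gs = n}"

abbreviation "res_chains G n \<equiv> chains_on (cells G n)"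

definition res_bd ::
  "('g, 'm) monoid_scheme \<Rightarrow> (('g \<times> 'g list) \<Rightarrow>\<^sub>0 'k) \<Rightarrow> ('g \<times> 'g list) \<Rightarrow>\<^sub>0 'k::comm_ring_1"
  where "res_bd G = lin_ext (bar_res_bd G)"

text \<open>Elements outside the carrier are fixed, so that this is an action of \<open>G\<close> on all chains.\<close>

definition res_act ::
  "('g, 'm) monoid_scheme \<Rightarrow> 'g \<Rightarrow> (('g \<times> 'g list) \<Rightarrow>\<^sub>0 'k) \<Rightarrow> ('g \<times> 'g list) \<Rightarrow>\<^sub>0 'k::comm_ring_1"
  where "res_act G g = lin_map (\<lambda>(h, hs). (if h \<in> carrier G then g \<otimes>\<^bsub>G\<^esub> h else h, hs))"

text \<open>For the unit \<open>g\<close> this is the standard contraction of the bar resolution.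
  Other \<open>g\<close> occur in the recursion for the boundary.\<close>

definition cone :: "'g \<Rightarrow> (('g \<times> 'g list) \<Rightarrow>\<^sub>0 'k) \<Rightarrow> ('g \<times> 'g list) \<Rightarrow>\<^sub>0 'k::comm_ring_1"
  where "cone g = lin_map (\<lambda>(h, hs). (g, h # hs))"

definition coinv :: "(('g \<times> 'g list) \<Rightarrow>\<^sub>0 'k) \<Rightarrow> 'g list \<Rightarrow>\<^sub>0 'k::comm_ring_1"
  where "coinv = lin_map snd"

definition push :: "('g \<Rightarrow> 'h) \<Rightarrow> (('g \<times> 'g list) \<Rightarrow>\<^sub>0 'k) \<Rightarrow> ('h \<times> 'h list) \<Rightarrow>\<^sub>0 'k::comm_ring_1"
  where "push \<phi> = lin_map (map_prod \<phi> (map \<phi>))"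

text \<open>The equivariant lift of \<open>bar_cross\<close> to the resolutions. Its Leibniz rule is
  accessible to induction because the resolutions, unlike their coinvariants, are
  contractible.\<close>

definition res_cross ::
  "('g, 'm) monoid_scheme \<Rightarrow> ('h, 'n) monoid_scheme \<Rightarrow> (('g \<times> 'g list) \<Rightarrow>\<^sub>0 'k) \<Rightarrow>
   (('h \<times> 'h list) \<Rightarrow>\<^sub>0 'k) \<Rightarrow> (('g \<times> 'h) \<times> ('g \<times> 'h) list) \<Rightarrow>\<^sub>0 'k::comm_ring_1"
  where "res_cross G H a b =
     lin_ext (\<lambda>(g, gs). lin_ext (\<lambda>(h, hs). lin_map (Pair (g, h))
       (signed_shuffles (map (\<lambda>g. (g, \<one>\<^bsub>H\<^esub>)) gs) (map (\<lambda>h. (\<one>\<^bsub>G\<^esub>, h)) hs))) b) a"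

lemma chain_linear_res:
  "chain_linear (res_bd G)" "chain_linear (res_act G g)" "chain_linear (cone g)"
  "chain_linear (coinv)" "chain_linear (push \<phi>)"
  unfolding res_bd_def res_act_def cone_def coinv_def push_def
  by (rule chain_linear_intros)+

lemma chain_linear_res_cross:
  "chain_linear (\<lambda>a. res_cross G H a b)" "chain_linear (res_cross G H a)"
proof -
  show "chain_linear (\<lambda>a. res_cross G H a b)"
    unfolding res_cross_def by (rule chain_linear_intros)
  show "chain_linear (res_cross G H a)"
    unfolding res_cross_def lin_ext_def[of _ a]
    by (intro chain_linear_intros) (auto simp: split_def intro!: chain_linear_intros)
qed

lemmas res_simps [simp] =
  chain_linear_simps[OF chain_linear_res(1)] chain_linear_simps[OF chain_linear_res(2)]
  chain_linear_simps[OF chain_linear_res(3)] chain_linear_simps[OF chain_linear_res(4)]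
  chain_linear_simps[OF chain_linear_res(5)]
  chain_linear_simps[OF chain_linear_res_cross(1)] chain_linear_simps[OF chain_linear_res_cross(2)]

lemma chain_linear_comp_res:
  assumes "chain_linear f"
  shows "chain_linear (\<lambda>x. res_bd G (f x))" "chain_linear (\<lambda>x. res_act G g (f x))"
    "chain_linear (\<lambda>x. cone g (f x))" "chain_linear (\<lambda>x. coinv (f x))"
    "chain_linear (\<lambda>x. push \<phi> (f x))"
  by (rule chain_linear_comp[OF _ assms], rule chain_linear_res)+

lemmas chain_linear_intros' =
  chain_linear_intros chain_linear_comp_res chain_linear_alt chain_linear_res
  chain_linear_res_cross chain_linear_comp[OF chain_linear_res_cross(1)]
  chain_linear_comp[OF chain_linear_res_cross(2)]

lemma res_gen [simp]:
  "res_bd G (gen x) = bar_res_bd G x"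
  "cone g (gen (h, hs)) = gen (g, h # hs)"
  "coinv (gen (h, hs)) = gen hs"
  "push \<phi> (gen (h, hs)) = gen (\<phi> h, map \<phi> hs)"
  "res_act G g (gen (h, hs)) = gen (if h \<in> carrier G then g \<otimes>\<^bsub>G\<^esub> h else h, hs)"
  by (simp_all add: res_bd_def cone_def coinv_def push_def res_act_def)

lemma res_cross_gen [simp]:
  "res_cross G H (gen (g, gs)) (gen (h, hs)) = lin_map (Pair (g, h))
     (signed_shuffles (map (\<lambda>g. (g, \<one>\<^bsub>H\<^esub>)) gs) (map (\<lambda>h. (\<one>\<^bsub>G\<^esub>, h)) hs))"
  by (simp add: res_cross_def)

lemma bar_res_bd_Nil [simp]: "bar_res_bd G (g, []) = 0"
  by (simp add: bar_res_bd_def)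

lemma bar_res_bd_single [simp]: "bar_res_bd G (g, [x]) = gen (g \<otimes>\<^bsub>G\<^esub> x, []) - gen (g, [])"
  by (simp add: bar_res_bd_def)

lemma sum_lessThan_Suc_Suc:
  fixes f :: "nat \<Rightarrow> 'a::comm_monoid_add"
  shows "(\<Sum>i = 1..<Suc (Suc n). f i) = f 1 + (\<Sum>i = 1..<Suc n. f (Suc i))"
  by (induction n) (simp_all add: add.assoc)

text \<open>All faces but the first keep the coefficient \<open>g\<close>; they are the faces of
  \<open>x[y|ys]\<close> shifted by one place, hence with the opposite sign. This recursion replaces
  the alternating sum in all later inductions.\<close>

lemma bar_res_bd_Cons [simp]:
  "bar_res_bd G (g, x # y # ys) = gen (g \<otimes>\<^bsub>G\<^esub> x, y # ys) - cone g (bar_res_bd G (x, y # ys))"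
proof -
  let ?T = "\<lambda>i. chain_scale ((- 1) ^ i)
    (gen (g, take (i - 1) (x # y # ys) @ ((x # y # ys) ! (i - 1) \<otimes>\<^bsub>G\<^esub> (x # y # ys) ! i) # drop
        (i + 1) (x # y # ys)))"
  let ?U = "\<lambda>i. chain_scale ((- 1) ^ i)
    (gen (x, take (i - 1) (y # ys) @ ((y # ys) ! (i - 1) \<otimes>\<^bsub>G\<^esub> (y # ys) ! i) # drop (i + 1) (y # ys)))"
  have *: "?T (Suc i) = - cone g (?U i)" if "i \<ge> 1" for i
    using that by (cases i) simp_all
  have "(\<Sum>i = 1..<length (x # y # ys). ?T i) = ?T 1 + (\<Sum>i = 1..<length (y # ys). ?T (Suc i))"
    using sum_lessThan_Suc_Suc[of ?T "length ys"] by (simp only: list.size add_0_right add_Suc_right)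
  also have "(\<Sum>i = 1..<length (y # ys). ?T (Suc i)) = (\<Sum>i = 1..<length (y # ys). - cone g (?U i))"
    by (intro sum.cong refl *) auto
  finally have "(\<Sum>i = 1..<length (x # y # ys). ?T i) = ?T 1 - cone g (\<Sum>i = 1..<length (y # ys). ?U i)"
    by (simp add: sum_negf del: sum.op_ivl_Suc)
  then show ?thesis
    unfolding bar_res_bd_def by (simp del: sum.op_ivl_Suc)
qed

lemma res_act_cone:
  assumes "h \<in> carrier G" shows "res_act G g (cone h c) = cone (g \<otimes>\<^bsub>G\<^esub> h) c"
  by (rule chain_linear_eqI[where c = c]) (use assms in \<open>auto intro!: chain_linear_intros'\<close>)

lemma coinv_act [simp]: "coinv (res_act G g c) = coinv c"
  by (rule chain_linear_eqI[where c = c]) (auto intro!: chain_linear_intros')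

lemma coinv_push: "coinv (push \<phi> c) = lin_map (map \<phi>) (coinv c)"
  by (rule chain_linear_eqI[where c = c]) (auto intro!: chain_linear_intros')

lemma push_cone: "push \<phi> (cone g c) = cone (\<phi> g) (push \<phi> c)"
  by (rule chain_linear_eqI[where c = c]) (auto intro!: chain_linear_intros')

context group begin

lemma cells_closed [simp]:
  "(g, gs) \<in> cells G n \<longleftrightarrow> g \<in> carrier G \<and> set gs \<subseteq> carrier G \<and> length gs = n"
  by (simp add: cells_def)

lemma res_act_chains [simp]:
  assumes "g \<in> carrier G" "c \<in> res_chains G n" shows "res_act G g c \<in> res_chains G n"
  by (rule chain_linear_chains_on[OF _ assms(2)]) (use assms in \<open>auto intro!: chain_linear_intros'\<close>)

lemma cone_chains [simp]:
  assumes "g \<in> carrier G" "c \<in> res_chains G n" shows "cone g c \<in> res_chains G (Suc n)"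
  by (rule chain_linear_chains_on[OF _ assms(2)]) (use assms in \<open>auto intro!: chain_linear_intros'\<close>)

lemma coinv_chains [simp]:
  assumes "c \<in> res_chains G n" shows "coinv c \<in> bar_chains G"
proof -
  have "coinv c \<in> chains_on (lists (carrier G))"
    by (rule chain_linear_chains_on[OF _ assms])
      (auto intro!: chain_linear_intros' chains_on_gen simp: in_lists_conv_set)
  then show ?thesis by (simp add: bar_chains_def chains_on_def)
qed

lemma bar_res_bd_chains:
  "g \<in> carrier G \<Longrightarrow> set gs \<subseteq> carrier G \<Longrightarrow> length gs = Suc n \<Longrightarrow> bar_res_bd G (g, gs) \<in> res_chains G n"
  by (induction gs arbitrary: g n rule: induct_list012) auto

lemma res_bd_chains [simp]:
  assumes "c \<in> res_chains G (Suc n)" shows "res_bd G c \<in> res_chains G n"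
  by (rule chain_linear_chains_on[OF _ assms])
    (auto intro!: chain_linear_intros' bar_res_bd_chains)

lemma res_bd_chains_0 [simp]:
  assumes "c \<in> res_chains G 0" shows "res_bd G c = 0"
  by (rule chain_linear_eq_on[OF _ _ assms]) (auto intro!: chain_linear_intros')

lemma res_act_mult:
  assumes "g \<in> carrier G" "h \<in> carrier G"
  shows "res_act G g (res_act G h c) = res_act G (g \<otimes> h) c"
  by (rule chain_linear_eqI[where c = c]) (use assms in \<open>auto intro!: chain_linear_intros' simp: m_assoc\<close>)

lemma res_act_one [simp]: "res_act G \<one> c = c"
  by (rule chain_linear_eqI[where c = c]) (auto intro!: chain_linear_intros')

lemma res_act_pow:
  assumes "g \<in> carrier G" shows "(res_act G g ^^ n) c = res_act G (g [^] n) c"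
  using assms
proof (induction n)
  case (Suc n)
  then have "g \<otimes> g [^] n = g [^] n \<otimes> g"
    by (metis nat_pow_Suc nat_pow_Suc2)
  with Suc show ?case by (simp add: res_act_mult)
qed simp

lemma res_bd_act:
  assumes "g \<in> carrier G" "c \<in> res_chains G n"
  shows "res_bd G (res_act G g c) = res_act G g (res_bd G c)"
proof (rule chain_linear_eq_on[OF _ _ assms(2)])
  fix b assume "b \<in> cells G n"
  then obtain h hs where b: "b = (h, hs)" "h \<in> carrier G" "set hs \<subseteq> carrier G"
    by (cases b) auto
  then show "res_bd G (res_act G g (gen b)) = res_act G g (res_bd G (gen b))"
    using assms(1)
    by (cases hs; cases "tl hs") (auto simp: m_assoc res_act_cone)
qed (auto intro!: chain_linear_intros')

lemma res_bd_cone: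
  assumes "c \<in> res_chains G (Suc n)"
  shows "res_bd G (cone \<one> c) = c - cone \<one> (res_bd G c)"
proof (rule chain_linear_eq_on[OF _ _ assms])
  fix b assume "b \<in> cells G (Suc n)"
  then obtain h x xs where b: "b = (h, x # xs)" "h \<in> carrier G"
    by (cases b; cases "snd b") auto
  then show "res_bd G (cone \<one> (gen b)) = gen b - cone \<one> (res_bd G (gen b))"
    by simp
qed (auto intro!: chain_linear_intros')

text \<open>In degree 0 the contraction identity contains the augmentation: a chain there is the
  boundary of its cone as soon as its coinvariants vanish.\<close>

lemma res_bd_cone_0:
  assumes "c \<in> res_chains G 0"
  shows "res_bd G (cone \<one> c) = c - lin_map (Pair \<one>) (coinv c)"
  by (rule chain_linear_eq_on[OF _ _ assms]) (auto intro!: chain_linear_intros')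

lemma coinv_bar_res_bd:
  assumes "g \<in> carrier G" "set gs \<subseteq> carrier G"
  shows "coinv (bar_res_bd G (g, gs)) = coinv (bar_res_bd G (\<one>, gs))"
proof -
  have "gen (\<one>, gs) \<in> res_chains G (length gs)"
    using assms by (intro chains_on_gen) simp
  from arg_cong[OF res_bd_act[OF assms(1) this], of coinv] show ?thesis
    using assms by simp
qed

lemma bar_bd_coinv:
  assumes "c \<in> res_chains G n"
  shows "bar_bd G (coinv c) = coinv (res_bd G c)"
proof (rule chain_linear_eq_on[OF _ _ assms])
  fix b assume "b \<in> cells G n"
  then obtain h hs where "b = (h, hs)" "h \<in> carrier G" "set hs \<subseteq> carrier G"
    by (cases b) auto
  then show "bar_bd G (coinv (gen b)) = coinv (res_bd G (gen b))"
    by (simp add: bar_bd_def coinv_bar_res_bd[of h hs] flip: coinv_def)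
qed (auto intro!: chain_linear_intros' simp: bar_bd_def)

end

lemma push_bar_res_bd:
  assumes "group G" "group H" "\<phi> \<in> hom G H" "g \<in> carrier G" "set gs \<subseteq> carrier G"
  shows "push \<phi> (bar_res_bd G (g, gs)) = bar_res_bd H (\<phi> g, map \<phi> gs)"
  using assms(4,5)
  by (induction gs arbitrary: g rule: induct_list012)
    (auto simp: push_cone hom_mult[OF assms(3)])

lemma push_res_bd:
  assumes "group G" "group H" "\<phi> \<in> hom G H" "c \<in> res_chains G n"
  shows "res_bd H (push \<phi> c) = push \<phi> (res_bd G c)"
  by (rule chain_linear_eq_on[OF _ _ assms(4)])
    (auto intro!: chain_linear_intros' simp: cells_def push_bar_res_bd[OF assms(1-3)])

lemma push_chains:
  assumes "\<phi> \<in> hom G H" "c \<in> res_chains G n"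
  shows "push \<phi> c \<in> res_chains H n"
  by (rule chain_linear_chains_on[OF _ assms(2)])
    (use hom_in_carrier[OF assms(1)] in \<open>auto intro!: chain_linear_intros' chains_on_gen simp: cells_def subset_eq\<close>)

lemma push_act:
  assumes "\<phi> \<in> hom G H" "g \<in> carrier G" "c \<in> res_chains G n"
  shows "push \<phi> (res_act G g c) = res_act H (\<phi> g) (push \<phi> c)"
  by (rule chain_linear_eq_on[OF _ _ assms(3)])
    (use assms in \<open>auto intro!: chain_linear_intros' simp: cells_def hom_def\<close>)

section \<open>Shuffles and the Leibniz rule for the cross product\<close>

lemma signed_shuffles_Nil2 [simp]: "signed_shuffles xs [] = gen xs"
  by (cases xs) simp_all

lemma signed_shuffles_chains:
  "set xs \<subseteq> A \<Longrightarrow> set ys \<subseteq> A \<Longrightarrow>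
    signed_shuffles xs ys \<in> chains_on {zs. set zs \<subseteq> A \<and> length zs = length xs + length ys}"
proof (induction xs ys rule: signed_shuffles.induct)
  case (3 x xs y ys)
  have "lin_map ((#) z) c \<in> chains_on {zs. set zs \<subseteq> A \<and> length zs = Suc n}"
    if "c \<in> chains_on {zs. set zs \<subseteq> A \<and> length zs = n}" "z \<in> A" for z n and c :: "_ \<Rightarrow>\<^sub>0 'b"
    by (rule chain_linear_chains_on[OF _ that(1)]) (use that(2) in \<open>auto intro!: chain_linear_intros'\<close>)
  note * = this[OF "3.IH"(1), of x] this[OF "3.IH"(2), of y]
  show ?case
    using * "3.prems" by auto
qed (auto intro!: chains_on_gen)

lemma bar_cross_gen:
  "bar_cross G H (gen gs) (gen hs) =
    signed_shuffles (map (\<lambda>g. (g, \<one>\<^bsub>H\<^esub>)) gs) (map (\<lambda>h. (\<one>\<^bsub>G\<^esub>, h)) hs)"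
  by (simp add: bar_cross_def)

lemma coinv_cross: "coinv (res_cross G H a b) = bar_cross G H (coinv a) (coinv b)"
proof -
  have *: "chain_linear (\<lambda>a. bar_cross G H a b)" "chain_linear (bar_cross G H a)" for a b
    proof -
    show "chain_linear (\<lambda>a. bar_cross G H a b)"
      unfolding bar_cross_def by (rule chain_linear_intros)
    show "chain_linear (bar_cross G H a)"
      unfolding bar_cross_def lin_ext_def[where c = a] by (intro chain_linear_intros)
  qed
  have **: "coinv (lin_map (Pair x) c) = c" for x :: 'z and c :: "'z list \<Rightarrow>\<^sub>0 'x::comm_ring_1"
    by (simp add: coinv_def lin_map_lin_map lin_map_ident)
  show ?thesis
    by (rule chain_linear_eq_on2[where f = "\<lambda>a b. coinv (res_cross G H a b)" and A = UNIV and B = UNIV])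
      (auto intro!: chain_linear_intros' chain_linear_comp[OF *(1)] chain_linear_comp[OF *(2)]
        simp: chains_on_def bar_cross_gen **)
qed

locale group_pair = G: group G + H: group H for G :: "('g, 'm) monoid_scheme" and H ::
    "('h, 'n) monoid_scheme"
begin

abbreviation GH :: "('g \<times> 'h) monoid"
  where "GH \<equiv> G \<times>\<times> H"

lemma cross_act:
  assumes "g \<in> carrier G" "h \<in> carrier H" "a \<in> res_chains G m" "b \<in> res_chains H n"
  shows "res_cross G H (res_act G g a) (res_act H h b) = res_act GH (g, h) (res_cross G H a b)"
proof (rule chain_linear_eq_on2[OF _ _ _ _ assms(3,4)])
  fix x y assume "x \<in> cells G m" "y \<in> cells H n"
  then obtain u us v vs where "x = (u, us)" "y = (v, vs)" "u \<in> carrier G" "v \<in> carrier H"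
    by (cases x; cases y) auto
  then show "res_cross G H (res_act G g (gen x)) (res_act H h (gen y)) =
      res_act GH (g, h) (res_cross G H (gen x) (gen y))"
    by (simp add: res_act_def[of GH] lin_map_lin_map)
qed (auto intro!: chain_linear_intros')

lemma cross_chains [simp]:
  fixes a :: "_ \<Rightarrow>\<^sub>0 'k::comm_ring_1"
  assumes "a \<in> res_chains G m" "b \<in> res_chains H n"
  shows "res_cross G H a b \<in> res_chains GH (m + n)"
proof -
  have *: "res_cross G H (gen x) (gen y :: _ \<Rightarrow>\<^sub>0 'k) \<in> res_chains GH (m + n)"
    if xy: "x \<in> cells G m" "y \<in> cells H n" for x y
  proof -
    obtain u us v vs where [simp]: "x = (u, us)" "y = (v, vs)"
      by (cases x; cases y) auto
    define sh :: "_ \<Rightarrow>\<^sub>0 'k" where "sh = signed_shuffles (map (\<lambda>g. (g, \<one>\<^bsub>H\<^esub>)) us)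
        (map (\<lambda>h. (\<one>\<^bsub>G\<^esub>, h)) vs)"
    have sh: "sh \<in> chains_on {zs. set zs \<subseteq> carrier G \<times> carrier H \<and> length zs = m + n}"
      using signed_shuffles_chains[of "map (\<lambda>g. (g, \<one>\<^bsub>H\<^esub>)) us" "carrier G \<times> carrier H"
          "map (\<lambda>h. (\<one>\<^bsub>G\<^esub>, h)) vs"] xy by (auto simp: sh_def)
    have "lin_map (Pair (u, v)) sh \<in> res_chains GH (m + n)"
      by (rule chain_linear_chains_on[OF chain_linear_lin_map sh])
        (use xy in \<open>auto simp: cells_def\<close>)
    then show ?thesis by (simp add: sh_def)
  qed
  have **: "res_cross G H (gen x) b \<in> res_chains GH (m + n)" if "x \<in> cells G m" for x
    by (rule chain_linear_chains_on[OF _ assms(2)]) (auto intro!: chain_linear_intros' *[OF that])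
  show ?thesis
    by (rule chain_linear_chains_on[OF _ assms(1), of "\<lambda>a. res_cross G H a b"])
      (auto intro!: chain_linear_intros' **)
qed

text \<open>A shuffle of two nonempty words starts with the first letter of one of them, and a cone
  displays exactly that letter. Moving the second word's letter past the m + 1 letters of the first
  gives the sign.\<close>

lemma cross_cone_cone:
  assumes "a \<in> res_chains G m" "b \<in> res_chains H n"
  shows "res_cross G H (cone \<one>\<^bsub>G\<^esub> a) (cone \<one>\<^bsub>H\<^esub> b) =
    cone \<one>\<^bsub>GH\<^esub> (res_cross G H a (cone \<one>\<^bsub>H\<^esub> b))
    - alt m (cone \<one>\<^bsub>GH\<^esub> (res_cross G H (cone \<one>\<^bsub>G\<^esub> a) b))"
proof (rule chain_linear_eq_on2[OF _ _ _ _ assms])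
  fix x y assume xy: "x \<in> cells G m" "y \<in> cells H n"
  then obtain u us v vs where [simp]: "x = (u, us)" "y = (v, vs)" "length us = m"
    by (cases x; cases y) auto
  show "res_cross G H (cone \<one>\<^bsub>G\<^esub> (gen x)) (cone \<one>\<^bsub>H\<^esub> (gen y)) =
    cone \<one>\<^bsub>GH\<^esub> (res_cross G H (gen x) (cone \<one>\<^bsub>H\<^esub> (gen y)))
    - alt m (cone \<one>\<^bsub>GH\<^esub> (res_cross G H (cone \<one>\<^bsub>G\<^esub> (gen x)) (gen y)))"
    by (simp add: cone_def[of "(_, _)"] lin_map_lin_map chain_scale_alt flip: power_Suc)
      (simp add: alt_def lin_map_lin_map)
qed (auto intro!: chain_linear_intros')

lemma cross_cone_left:
  assumes "b \<in> res_chains H n"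
  shows "res_cross G H (gen (\<one>\<^bsub>G\<^esub>, [])) (cone \<one>\<^bsub>H\<^esub> b) =
    cone \<one>\<^bsub>GH\<^esub> (res_cross G H (gen (\<one>\<^bsub>G\<^esub>, [])) b)"
  by (rule chain_linear_eq_on[OF _ _ assms]) (auto intro!: chain_linear_intros')

lemma cross_cone_right:
  assumes "a \<in> res_chains G m"
  shows "res_cross G H (cone \<one>\<^bsub>G\<^esub> a) (gen (\<one>\<^bsub>H\<^esub>, [])) =
    cone \<one>\<^bsub>GH\<^esub> (res_cross G H a (gen (\<one>\<^bsub>H\<^esub>, [])))"
  by (rule chain_linear_eq_on[OF _ _ assms]) (auto intro!: chain_linear_intros')

lemma group_prod: "group GH"
  by (rule DirProd_group[OF G.group_axioms H.group_axioms])

text \<open>By the previous lemmas, the shuffle product of two cones is a sum of cones of shuffle products;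
  hence the Leibniz rule for two cones reduces to pairs of lower total degree.\<close>

lemma cross_bd_cone:
  fixes a :: "_ \<Rightarrow>\<^sub>0 'k::comm_ring_1"
  assumes a: "a \<in> res_chains G m" and b: "b \<in> res_chains H n"
    and IH1: "res_bd GH (res_cross G H a (cone \<one>\<^bsub>H\<^esub> b)) =
      res_cross G H (res_bd G a) (cone \<one>\<^bsub>H\<^esub> b) + alt m (res_cross G H a (res_bd H (cone \<one>\<^bsub>H\<^esub> b)))"
    and IH2: "res_bd GH (res_cross G H (cone \<one>\<^bsub>G\<^esub> a) b) =
      res_cross G H (res_bd G (cone \<one>\<^bsub>G\<^esub> a)) b - alt m (res_cross G H (cone \<one>\<^bsub>G\<^esub> a) (res_bd H b))"
    and a0: "m = 0 \<Longrightarrow> coinv a = gen []" and b0: "n = 0 \<Longrightarrow> coinv b = gen []"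
  shows "res_bd GH (res_cross G H (cone \<one>\<^bsub>G\<^esub> a) (cone \<one>\<^bsub>H\<^esub> b)) =
      res_cross G H (res_bd G (cone \<one>\<^bsub>G\<^esub> a)) (cone \<one>\<^bsub>H\<^esub> b)
      - alt m (res_cross G H (cone \<one>\<^bsub>G\<^esub> a) (res_bd H (cone \<one>\<^bsub>H\<^esub> b)))"
proof -
  interpret GH: group GH by (rule group_prod)
  \<comment> \<open>The augmentation terms of the contraction identity, extended by zero to positive
    degrees, so that one formula for the boundary of a cone serves in every degree.\<close>
  define ea :: "('g \<times> 'g list) \<Rightarrow>\<^sub>0 'k" where "ea = (if m = 0 then gen (\<one>\<^bsub>G\<^esub>, []) else 0)"
  define eb :: "('h \<times> 'h list) \<Rightarrow>\<^sub>0 'k" where "eb = (if n = 0 then gen (\<one>\<^bsub>H\<^esub>, []) else 0)"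
  have da: "res_bd G (cone \<one>\<^bsub>G\<^esub> a) = a - cone \<one>\<^bsub>G\<^esub> (res_bd G a) - ea"
    using a a0 by (cases m) (simp_all add: ea_def G.res_bd_cone G.res_bd_cone_0)
  have db: "res_bd H (cone \<one>\<^bsub>H\<^esub> b) = b - cone \<one>\<^bsub>H\<^esub> (res_bd H b) - eb"
    using b b0 by (cases n) (simp_all add: eb_def H.res_bd_cone H.res_bd_cone_0)
  have cone_one: "res_bd GH (cone (\<one>\<^bsub>G\<^esub>, \<one>\<^bsub>H\<^esub>) c) = c - cone (\<one>\<^bsub>G\<^esub>, \<one>\<^bsub>H\<^esub>) (res_bd GH c)"
    if "c \<in> res_chains GH (Suc k)" for c :: "_ \<Rightarrow>\<^sub>0 'k" and k
    using GH.res_bd_cone[OF that] by simp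
  have "res_cross G H a (cone \<one>\<^bsub>H\<^esub> b) \<in> res_chains GH (m + Suc n)"
    and "res_cross G H (cone \<one>\<^bsub>G\<^esub> a) b \<in> res_chains GH (Suc m + n)"
    using a b by (intro cross_chains; simp)+
  then have 1: "res_bd GH (cone (\<one>\<^bsub>G\<^esub>, \<one>\<^bsub>H\<^esub>) (res_cross G H a (cone \<one>\<^bsub>H\<^esub> b))) =
      res_cross G H a (cone \<one>\<^bsub>H\<^esub> b)
      - cone (\<one>\<^bsub>G\<^esub>, \<one>\<^bsub>H\<^esub>) (res_bd GH (res_cross G H a (cone \<one>\<^bsub>H\<^esub> b)))"
    and 2: "res_bd GH (cone (\<one>\<^bsub>G\<^esub>, \<one>\<^bsub>H\<^esub>) (res_cross G H (cone \<one>\<^bsub>G\<^esub> a) b)) =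
      res_cross G H (cone \<one>\<^bsub>G\<^esub> a) b
      - cone (\<one>\<^bsub>G\<^esub>, \<one>\<^bsub>H\<^esub>) (res_bd GH (res_cross G H (cone \<one>\<^bsub>G\<^esub> a) b))"
    by (intro cone_one; simp)+
  have F: "res_cross G H (cone \<one>\<^bsub>G\<^esub> a) (cone \<one>\<^bsub>H\<^esub> b) =
      cone (\<one>\<^bsub>G\<^esub>, \<one>\<^bsub>H\<^esub>) (res_cross G H a (cone \<one>\<^bsub>H\<^esub> b))
      - alt m (cone (\<one>\<^bsub>G\<^esub>, \<one>\<^bsub>H\<^esub>) (res_cross G H (cone \<one>\<^bsub>G\<^esub> a) b))"
    using cross_cone_cone[OF a b] by simp
  have F1: "res_cross G H (cone \<one>\<^bsub>G\<^esub> (res_bd G a)) (cone \<one>\<^bsub>H\<^esub> b) =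
      cone (\<one>\<^bsub>G\<^esub>, \<one>\<^bsub>H\<^esub>) (res_cross G H (res_bd G a) (cone \<one>\<^bsub>H\<^esub> b))
      + alt m (cone (\<one>\<^bsub>G\<^esub>, \<one>\<^bsub>H\<^esub>) (res_cross G H (cone \<one>\<^bsub>G\<^esub> (res_bd G a)) b))"
  proof (cases m)
    case (Suc k)
    then show ?thesis
      using cross_cone_cone[of "res_bd G a" k b n] a b by (simp add: alt_def)
  qed (use a in \<open>simp add: alt_def\<close>)
  have F2: "res_cross G H (cone \<one>\<^bsub>G\<^esub> a) (cone \<one>\<^bsub>H\<^esub> (res_bd H b)) =
      cone (\<one>\<^bsub>G\<^esub>, \<one>\<^bsub>H\<^esub>) (res_cross G H a (cone \<one>\<^bsub>H\<^esub> (res_bd H b)))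
      - alt m (cone (\<one>\<^bsub>G\<^esub>, \<one>\<^bsub>H\<^esub>) (res_cross G H (cone \<one>\<^bsub>G\<^esub> a) (res_bd H b)))"
  proof (cases n)
    case (Suc k)
    then show ?thesis
      using cross_cone_cone[of a m "res_bd H b" k] a b by simp
  qed (use b in \<open>simp add: alt_def\<close>)
  have F3: "res_cross G H ea (cone \<one>\<^bsub>H\<^esub> b) = cone (\<one>\<^bsub>G\<^esub>, \<one>\<^bsub>H\<^esub>) (res_cross G H ea b)"
    using cross_cone_left[OF b] by (simp add: ea_def)
  have F4: "res_cross G H (cone \<one>\<^bsub>G\<^esub> a) eb = cone (\<one>\<^bsub>G\<^esub>, \<one>\<^bsub>H\<^esub>) (res_cross G H a eb)"
    using cross_cone_right[OF a] by (simp add: eb_def)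
  have m0: "odd m \<Longrightarrow> ea = 0"
    by (auto simp: ea_def)
  show ?thesis
    unfolding F
    by (cases "even m") (simp_all add: alt_def 1 2 IH1 IH2 da db F F1 F2 F3 F4 m0 algebra_simps)
qed

lemma cross_bd_act:
  assumes a: "a \<in> res_chains G m" and b: "b \<in> res_chains H n"
    and g: "g \<in> carrier G" and h: "h \<in> carrier H"
    and eq: "res_bd GH (res_cross G H a b) =
      res_cross G H (res_bd G a) b + alt m (res_cross G H a (res_bd H b))"
  shows "res_bd GH (res_cross G H (res_act G g a) (res_act H h b)) =
      res_cross G H (res_bd G (res_act G g a)) (res_act H h b)
      + alt m (res_cross G H (res_act G g a) (res_bd H (res_act H h b)))"
proof -
  interpret GH: group GH by (rule group_prod)
  have 1: "res_cross G H (res_act G g (res_bd G a)) (res_act H h b) =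
      res_act GH (g, h) (res_cross G H (res_bd G a) b)"
    by (cases m) (use a in \<open>auto intro!: cross_act[OF g h _ b] G.res_bd_chains\<close>)
  have 2: "res_cross G H (res_act G g a) (res_act H h (res_bd H b)) =
      res_act GH (g, h) (res_cross G H a (res_bd H b))"
    by (cases n) (use b in \<open>auto intro!: cross_act[OF g h a] H.res_bd_chains\<close>)
  have "(g, h) \<in> carrier GH" using g h by simp
  from GH.res_bd_act[OF this cross_chains[OF a b]] show ?thesis
    by (simp add: cross_act[OF g h a b] G.res_bd_act[OF g a] H.res_bd_act[OF h b] 1 2 eq alt_def)
qed

text \<open>Induction on the total degree. By equivariance both coefficients may be taken to be the
  unit. Then both cells are cones and \<open>cross_bd_cone\<close> applies, unless a word is empty;
  in that case the cross product is induced by the inclusion of the other factor.\<close>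

lemma cross_bd_gen:
  assumes "g \<in> carrier G" "set gs \<subseteq> carrier G" "h \<in> carrier H" "set hs \<subseteq> carrier H"
  shows "res_bd GH (res_cross G H (gen (g, gs)) (gen (h, hs))) =
    res_cross G H (res_bd G (gen (g, gs))) (gen (h, hs) :: _ \<Rightarrow>\<^sub>0 'k::comm_ring_1)
    + alt (length gs) (res_cross G H (gen (g, gs)) (res_bd H (gen (h, hs))))"
  using assms
proof (induction "length gs + length hs" arbitrary: g gs h hs rule: less_induct)
  case less
  let ?a = "gen (\<one>\<^bsub>G\<^esub>, gs) :: _ \<Rightarrow>\<^sub>0 'k" and ?b = "gen (\<one>\<^bsub>H\<^esub>, hs) :: _ \<Rightarrow>\<^sub>0 'k"
  have a: "?a \<in> res_chains G (length gs)" and b: "?b \<in> res_chains H (length hs)"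
    using less.prems by (auto intro!: chains_on_gen)
  have "res_bd GH (res_cross G H ?a ?b) =
      res_cross G H (res_bd G ?a) ?b + alt (length gs) (res_cross G H ?a (res_bd H ?b))"
  proof (cases gs)
    case Nil
    have "res_cross G H (gen (\<one>\<^bsub>G\<^esub>, [])) c = push (Pair \<one>\<^bsub>G\<^esub>) c"
      if "c \<in> res_chains H k" for c :: "_ \<Rightarrow>\<^sub>0 'k" and k
      by (rule chain_linear_eq_on[OF _ _ that]) (auto intro!: chain_linear_intros')
    note * = this[OF b] this[OF H.res_bd_chains[of ?b "length hs - 1"]]
    have "Pair \<one>\<^bsub>G\<^esub> \<in> hom H GH" by (auto simp: hom_def)
    from push_res_bd[OF H.group_axioms group_prod this b] show ?thesis
      using Nil b * by (cases "length hs") (simp_all add: alt_def)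
  next
    case (Cons x xs)
    note gs = this
    show ?thesis
    proof (cases hs)
      case Nil
      have "res_cross G H c (gen (\<one>\<^bsub>H\<^esub>, [])) = push (\<lambda>g. (g, \<one>\<^bsub>H\<^esub>)) c"
        if "c \<in> res_chains G k" for c :: "_ \<Rightarrow>\<^sub>0 'k" and k
        by (rule chain_linear_eq_on[OF _ _ that]) (auto intro!: chain_linear_intros')
      note * = this[OF a] this[OF G.res_bd_chains[of ?a "length xs"]]
      have "(\<lambda>g. (g, \<one>\<^bsub>H\<^esub>)) \<in> hom G GH" by (auto simp: hom_def)
      from push_res_bd[OF G.group_axioms group_prod this a] show ?thesis
        using Nil gs a * by (simp add: alt_def)
    next
      case (Cons y ys)
      have "res_bd GH (res_cross G H (cone \<one>\<^bsub>G\<^esub> (gen (x, xs))) (cone \<one>\<^bsub>H\<^esub> (gen (y, ys)))) =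
          res_cross G H (res_bd G (cone \<one>\<^bsub>G\<^esub> (gen (x, xs))))
              (cone \<one>\<^bsub>H\<^esub> (gen (y, ys :: _ list) :: _ \<Rightarrow>\<^sub>0 'k))
          - alt (length xs) (res_cross G H (cone \<one>\<^bsub>G\<^esub> (gen (x, xs)))
              (res_bd H (cone \<one>\<^bsub>H\<^esub> (gen (y, ys)))))"
        by (rule cross_bd_cone[where n = "length ys"])
          (use less.hyps[of xs "y # ys" x "\<one>\<^bsub>H\<^esub>"] less.hyps[of "x # xs" ys "\<one>\<^bsub>G\<^esub>" y] less.prems gs Cons
            in \<open>auto intro!: chains_on_gen simp: alt_def simp del: bar_res_bd_Cons bar_res_bd_single\<close>)
      then show ?thesis
        using gs Cons by (simp add: alt_def del: bar_res_bd_Cons bar_res_bd_single)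
    qed
  qed
  from cross_bd_act[OF a b less.prems(1,3) this] show ?case
    using less.prems by simp
qed

lemma cross_bd:
  assumes a: "a \<in> res_chains G m" and b: "b \<in> res_chains H n"
  shows "res_bd GH (res_cross G H a b) =
    res_cross G H (res_bd G a) b + alt m (res_cross G H a (res_bd H b))"
proof (rule chain_linear_eq_on2[OF _ _ _ _ a b])
  fix x y assume "x \<in> cells G m" "y \<in> cells H n"
  then obtain g gs h hs where "x = (g, gs)" "g \<in> carrier G" "set gs \<subseteq> carrier G" "length gs = m"
    "y = (h, hs)" "h \<in> carrier H" "set hs \<subseteq> carrier H"
    by (cases x; cases y) auto
  then show "res_bd GH (res_cross G H (gen x) (gen y)) =
    res_cross G H (res_bd G (gen x)) (gen y) + alt m (res_cross G H (gen x) (res_bd H (gen y)))"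
    by (simp add: cross_bd_gen del: res_gen res_cross_gen)
qed (auto intro!: chain_linear_intros')

end

section \<open>Cyclic operators\<close>

text \<open>The differentials of the standard resolution, extended by zero to degree 0.\<close>

definition cyc_bd :: "nat \<Rightarrow> ('a \<Rightarrow> 'a) \<Rightarrow> nat \<Rightarrow> 'a \<Rightarrow> 'a::ab_group_add"
  where "cyc_bd p T n x = (if n = 0 then 0 else if odd n then T x - x else \<Sum>k<p. (T ^^ k) x)"

lemma alt_simps [simp]:
  "alt 0 x = x" "alt (Suc n) x = - alt n x" "alt n 0 = 0" "alt n (- x) = - alt n x"
  by (simp_all add: alt_def)

lemma alt_diff: "alt n (x - y) = alt n x - alt n y"
  by (simp add: alt_def)

lemma alt_sum: "alt n (sum f A) = (\<Sum>i\<in>A. alt n (f i))"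
  by (simp add: alt_def sum_negf)

lemma additive_alt: "additive T \<Longrightarrow> T (alt n x) = alt n (T x)"
  by (simp add: alt_def additive.minus)

lemma additive_funpow:
  fixes T :: "'a::ab_group_add \<Rightarrow> 'a"
  shows "additive T \<Longrightarrow> additive (T ^^ k)"
  by (induction k) (auto simp: additive_def)

lemma additive_cyc_bd:
  assumes "additive T" shows "additive (cyc_bd p T n)"
  using additive_funpow[OF assms] assms
  by (auto simp: additive_def cyc_bd_def sum.distrib)

lemma funpow_commute:
  fixes T :: "'a \<Rightarrow> 'a"
  assumes "\<And>x. R (T x) = T (R x)" shows "R ((T ^^ k) x) = (T ^^ k) (R x)"
  by (induction k) (simp_all add: assms)

lemma cyc_bd_commute:
  assumes "additive R" "\<And>x. R (T x) = T (R x)"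
  shows "R (cyc_bd p T n x) = cyc_bd p T n (R x)"
  using assms(2) funpow_commute[of R T, OF assms(2)]
  by (simp add: cyc_bd_def additive.zero[OF assms(1)] additive.diff[OF assms(1)]
      additive.sum[OF assms(1)])

lemma cyc_bd_0 [simp]: "cyc_bd p T 0 x = 0"
  by (simp add: cyc_bd_def)

text \<open>The differentials of the standard resolution will act on bar chains through several
  commuting group elements, so their formal properties are proved for any additive operator of order
  dividing p.\<close>

locale cyclic_operator = T: additive T for T :: "'a::ab_group_add \<Rightarrow> 'a" +
  fixes p :: nat
  assumes period: "(T ^^ p) x = x"
begin

lemma shift_sum: "(\<Sum>k<p. T ((T ^^ k) x)) = (\<Sum>k<p. (T ^^ k) x)"
proof -
  have "(\<Sum>k<p. T ((T ^^ k) x)) - (\<Sum>k<p. (T ^^ k) x) = (\<Sum>k<p. (T ^^ Suc k) x - (T ^^ k) x)"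
    by (simp add: sum_subtractf)
  also have "\<dots> = 0"
    by (subst sum_lessThan_telescope) (simp add: period)
  finally show ?thesis by simp
qed

lemma cyc_bd_square [simp]: "cyc_bd p T n (cyc_bd p T (n - 1) x) = 0"
proof -
  have "(T ^^ k) (T x - x) = T ((T ^^ k) x) - (T ^^ k) x" for k
    by (simp add: additive.diff[OF additive_funpow[OF T.additive_axioms]] funpow_swap1)
  then show ?thesis
    by (auto simp: cyc_bd_def additive.zero[OF additive_funpow[OF T.additive_axioms]] T.sum
        shift_sum T.zero sum_subtractf)
qed

end

section \<open>The diagonal of the standard resolution\<close>

locale cyclic_operators = cyclic_operator T p + S: cyclic_operator S p
  for T S :: "'a::ab_group_add \<Rightarrow> 'a" and p +
  assumes commute: "T (S x) = S (T x)"
begin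

text \<open>The coefficients of the classical diagonal of the standard resolution.\<close>

definition diag_coeff :: "nat \<Rightarrow> nat \<Rightarrow> 'a \<Rightarrow> 'a"
  where "diag_coeff i j x =
    (if even i then x else if even j then S x else \<Sum>b<p. \<Sum>a<b. (T ^^ a) ((S ^^ b) x))"

text \<open>The image of the degree n generator under the diagonal, with \<open>c i j\<close> in the
  place of the tensor product of the generators of degrees i and j.\<close>

definition diag_op :: "nat \<Rightarrow> (nat \<Rightarrow> nat \<Rightarrow> 'a) \<Rightarrow> 'a"
  where "diag_op n c = (\<Sum>i\<le>n. diag_coeff i (n - i) (c i (n - i)))"

lemma additive_pow: "additive (T ^^ k)" "additive (S ^^ k)"
  by (rule additive_funpow, rule T.additive_axioms S.T.additive_axioms)+

lemma pow_commute: "(T ^^ a) ((S ^^ b) x) = (S ^^ b) ((T ^^ a) x)"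
  by (rule funpow_commute) (rule funpow_commute[symmetric], rule commute[symmetric])

lemma pow_comp: "((T \<circ> S) ^^ k) x = (T ^^ k) ((S ^^ k) x)"
proof (induction k)
  case (Suc k)
  have *: "S ((T ^^ k) y) = (T ^^ k) (S y)" for y
    using pow_commute[of k 1 y] by simp
  have "((T \<circ> S) ^^ Suc k) x = T (S (((T \<circ> S) ^^ k) x))"
    by simp
  also have "\<dots> = T (S ((T ^^ k) ((S ^^ k) x)))"
    by (simp only: Suc)
  also have "\<dots> = (T ^^ Suc k) ((S ^^ Suc k) x)"
    by (simp add: *)
  finally show ?case .
qed simp

lemma additive_diag_coeff: "additive (diag_coeff i j)"
proof -
  have "(T ^^ a) ((S ^^ b) (x + y)) = (T ^^ a) ((S ^^ b) x) + (T ^^ a) ((S ^^ b) y)" for a b x y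
    by (simp add: additive.add[OF additive_pow(1)] additive.add[OF additive_pow(2)])
  then show ?thesis
    by (auto simp: additive_def diag_coeff_def S.T.add sum.distrib)
qed

text \<open>The set \<open>M\<close> is there for the boundary, which commutes with the action on
  chains over the carrier of the group.\<close>

lemma diag_coeff_commute:
  assumes R: "additive R" and M: "\<And>x. x \<in> M \<Longrightarrow> T x \<in> M" "\<And>x. x \<in> M \<Longrightarrow> S x \<in> M"
    and RT: "\<And>x. x \<in> M \<Longrightarrow> R (T x) = T (R x)" and RS: "\<And>x. x \<in> M \<Longrightarrow> R (S x) = S (R x)"
    and x: "x \<in> M"
  shows "R (diag_coeff i j x) = diag_coeff i j (R x)"
proof -
  have "(S ^^ k) y \<in> M \<and> R ((S ^^ k) y) = (S ^^ k) (R y)" if "y \<in> M" for y k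
    using that by (induction k) (simp_all add: M RS)
  moreover have "(T ^^ k) y \<in> M \<and> R ((T ^^ k) y) = (T ^^ k) (R y)" if "y \<in> M" for y k
    using that by (induction k) (simp_all add: M RT)
  ultimately show ?thesis
    using x by (simp add: diag_coeff_def additive.sum[OF R] RS)
qed

lemma diag_op_commute_on:
  assumes "additive R" "\<And>x. x \<in> M \<Longrightarrow> T x \<in> M" "\<And>x. x \<in> M \<Longrightarrow> S x \<in> M"
    and "\<And>x. x \<in> M \<Longrightarrow> R (T x) = T (R x)" "\<And>x. x \<in> M \<Longrightarrow> R (S x) = S (R x)"
    and "\<And>i. i \<le> n \<Longrightarrow> c i (n - i) \<in> M"
  shows "R (diag_op n c) = diag_op n (\<lambda>i j. R (c i j))"
  unfolding diag_op_def additive.sum[OF assms(1)]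
  by (intro sum.cong refl diag_coeff_commute[where M = M]) (simp_all add: assms)

lemmas diag_op_commute = diag_op_commute_on[where M = UNIV, simplified]

lemma diag_op_add: "diag_op n (\<lambda>i j. c i j + d i j) = diag_op n c + diag_op n d"
  by (simp add: diag_op_def additive.add[OF additive_diag_coeff] sum.distrib)

lemma diag_op_alt:
  "diag_op n (\<lambda>i j. alt (i + j + k) (c i j)) = alt (n + k) (diag_op n c)"
  by (simp add: diag_op_def additive_alt[OF additive_diag_coeff] alt_sum)

text \<open>The chain map property of the diagonal, one coefficient at a time;
  \<open>T \<circ> S\<close> is the diagonal action. Where the double sum occurs, each of T - 1, S -
  1 and TS - 1 makes it telescope to a difference of two norms.\<close>

lemma diag_coeff_bd:
  "diag_coeff (Suc i) j (cyc_bd p T (Suc i) x) + alt i (diag_coeff i (Suc j) (cyc_bd p S (Suc j) x))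
    = cyc_bd p (T \<circ> S) (Suc (i + j)) (diag_coeff i j x)"
proof -
  have Tp: "(T ^^ a) (x - y) = (T ^^ a) x - (T ^^ a) y" "(S ^^ a) (x - y) = (S ^^ a) x - (S ^^ a) y"
    for a x y
    by (simp_all add: additive.diff[OF additive_pow(1)] additive.diff[OF additive_pow(2)])
  have 1: "(\<Sum>b<p. \<Sum>a<b. (T ^^ a) ((S ^^ b) (T x - x))) =
      (\<Sum>b<p. (T ^^ b) ((S ^^ b) x)) - (\<Sum>b<p. (S ^^ b) x)" for x
  proof -
    have "(T ^^ a) ((S ^^ b) (T x - x)) = (T ^^ Suc a) ((S ^^ b) x) - (T ^^ a) ((S ^^ b) x)" for a b
      using pow_commute[of 1 b x] by (simp add: Tp funpow_swap1)
    note * = this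
    have "(\<Sum>a<b. (T ^^ a) ((S ^^ b) (T x - x))) = (T ^^ b) ((S ^^ b) x) - (S ^^ b) x" for b
      unfolding * by (subst sum_lessThan_telescope) simp
    then show ?thesis
      by (simp add: sum_subtractf)
  qed
  \<comment> \<open>With the sum over b inside, S - 1 telescopes from a + 1 up to p, where the
    period of S closes it.\<close>
  have swap: "(\<Sum>b<p. \<Sum>a<b. f a b) = (\<Sum>a<p. \<Sum>b=Suc a..<p. f a b)" for f :: "nat \<Rightarrow> nat \<Rightarrow> 'a"
    by (subst (1 2) sum.Sigma) (auto intro!: sum.reindex_bij_witness[of _ prod.swap prod.swap])
  have 2: "(\<Sum>b<p. \<Sum>a<b. (T ^^ a) ((S ^^ b) (S x - x))) =
      (\<Sum>a<p. (T ^^ a) x) - (\<Sum>a<p. (T ^^ a) ((S ^^ a) (S x)))" for x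
  proof -
    have *: "(\<Sum>b=Suc a..<p. (T ^^ a) ((S ^^ b) (S x - x))) = (T ^^ a) x - (T ^^ a) ((S ^^ a) (S x))"
      if "a < p" for a
    proof -
      have "(\<Sum>b=Suc a..<p. (S ^^ b) (S x - x)) = (\<Sum>b=Suc a..<p. (S ^^ Suc b) x - (S ^^ b) x)"
        by (simp add: Tp funpow_swap1)
      also have "\<dots> = x - (S ^^ a) (S x)"
        using that by (subst sum_Suc_diff') (simp_all add: S.period funpow_swap1)
      finally show ?thesis
        unfolding additive.sum[OF additive_pow(1), symmetric] by (simp only: Tp)
    qed
    show ?thesis
      unfolding swap by (simp add: * sum_subtractf)
  qed
  \<comment> \<open>This combines the previous two identities through TS - 1 = (T - 1)S + (S -
    1).\<close>
  have 3: "(\<Sum>b<p. \<Sum>a<b. T (S ((T ^^ a) ((S ^^ b) x)))) - (\<Sum>b<p. \<Sum>a<b. (T ^^ a) ((S ^^ b) x)) =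
      (\<Sum>a<p. (T ^^ a) x) - (\<Sum>a<p. (S ^^ a) x)" for x
  proof -
    have TS: "T (S ((T ^^ a) ((S ^^ b) x))) = (T ^^ a) ((S ^^ b) (T (S x)))" for a b
    proof -
      have "S ((T ^^ a) y) = (T ^^ a) (S y)" "T ((S ^^ b) y) = (S ^^ b) (T y)" for y
        using pow_commute[of a 1] pow_commute[of 1 b] by simp_all
      then show ?thesis
        by (simp only: funpow_swap1)
    qed
    have "(\<Sum>b<p. \<Sum>a<b. T (S ((T ^^ a) ((S ^^ b) x)))) - (\<Sum>b<p. \<Sum>a<b. (T ^^ a) ((S ^^ b) x)) =
        (\<Sum>b<p. \<Sum>a<b. (T ^^ a) ((S ^^ b) (T (S x) - S x))) +
        (\<Sum>b<p. \<Sum>a<b. (T ^^ a) ((S ^^ b) (S x - x)))"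
      by (simp add: TS Tp sum_subtractf)
    then show ?thesis
      unfolding 1 2 using S.shift_sum[of x] by (simp add: funpow_swap1)
  qed
  show ?thesis
    by (cases "even i"; cases "even j")
      (simp_all add: diag_coeff_def cyc_bd_def 1 2 3[unfolded commute] pow_comp S.T.diff commute
        S.T.sum T.sum S.shift_sum alt_def)
qed

text \<open>Both sums over i are reindexed to run over the terms of degree n - 1. The truncated
  indices \<open>i - 1\<close> and \<open>j - 1\<close> at 0 are harmless, since
  \<open>cyc_bd\<close> is zero in degree 0.\<close>

lemma diag_op_bd:
  "diag_op n (\<lambda>i j. cyc_bd p T i (c (i - 1) j) + alt i (cyc_bd p S j (c i (j - 1)))) =
    cyc_bd p (T \<circ> S) n (diag_op (n - 1) c)"
proof (cases n)
  case 0
  then show ?thesis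
    by (simp add: diag_op_def additive.zero[OF additive_diag_coeff])
next
  case (Suc m)
  have "(\<Sum>i\<le>Suc m. diag_coeff i (Suc m - i) (cyc_bd p T i (c (i - 1) (Suc m - i)))) =
      (\<Sum>i\<le>m. diag_coeff (Suc i) (m - i) (cyc_bd p T (Suc i) (c i (m - i))))"
    by (subst sum.atMost_Suc_shift) (simp add: additive.zero[OF additive_diag_coeff])
  moreover have "(\<Sum>i\<le>Suc m. diag_coeff i (Suc m - i)
      (alt i (cyc_bd p S (Suc m - i) (c i (Suc m - i - 1))))) =
      (\<Sum>i\<le>m. alt i (diag_coeff i (Suc (m - i)) (cyc_bd p S (Suc (m - i)) (c i (m - i)))))"
    by (simp add: additive.zero[OF additive_diag_coeff] additive_alt[OF additive_diag_coeff])
      (intro sum.cong refl, simp add: Suc_diff_le)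
  ultimately have "diag_op n (\<lambda>i j. cyc_bd p T i (c (i - 1) j) + alt i (cyc_bd p S j (c i (j - 1)))) =
      (\<Sum>i\<le>m. diag_coeff (Suc i) (m - i) (cyc_bd p T (Suc i) (c i (m - i)))
        + alt i (diag_coeff i (Suc (m - i)) (cyc_bd p S (Suc (m - i)) (c i (m - i)))))"
    unfolding diag_op_def Suc additive.add[OF additive_diag_coeff] sum.distrib by simp
  also have "\<dots> = (\<Sum>i\<le>m. cyc_bd p (T \<circ> S) (Suc m) (diag_coeff i (m - i) (c i (m - i))))"
    unfolding diag_coeff_bd by (intro sum.cong refl) simp
  also have "\<dots> = cyc_bd p (T \<circ> S) n (diag_op (n - 1) c)"
  proof -
    have "additive (T \<circ> S)" by (simp add: additive_def T.add S.T.add)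
    from additive.sum[OF additive_cyc_bd[OF this]] show ?thesis
      unfolding Suc diag_op_def diff_Suc_1 by (rule sym)
  qed
  finally show ?thesis .
qed

end

section \<open>Bisequences\<close>

text \<open>A bisequence is the image of the basis of the tensor square of the standard resolution under
  a chain map to the bar resolution that is equivariant along the homomorphism from the product
  of two cyclic groups given by \<open>t\<close> and \<open>s\<close>.\<close>

definition cyclic_pair :: "('g, 'm) monoid_scheme \<Rightarrow> nat \<Rightarrow> 'g \<Rightarrow> 'g \<Rightarrow> bool"
  where "cyclic_pair G p t s \<longleftrightarrow> t \<in> carrier G \<and> s \<in> carrier G \<and>
    t [^]\<^bsub>G\<^esub> p = \<one>\<^bsub>G\<^esub> \<and> s [^]\<^bsub>G\<^esub> p = \<one>\<^bsub>G\<^esub> \<and> t \<otimes>\<^bsub>G\<^esub> s = s \<otimes>\<^bsub>G\<^esub> t"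

definition bisequence ::
  "('g, 'm) monoid_scheme \<Rightarrow> nat \<Rightarrow> 'g \<Rightarrow> 'g \<Rightarrow> (nat \<Rightarrow> nat \<Rightarrow> ('g \<times> 'g list) \<Rightarrow>\<^sub>0 'k::comm_ring_1) \<Rightarrow> bool"
  where "bisequence G p t s c \<longleftrightarrow> coinv (c 0 0) = gen [] \<and>
    (\<forall>m n. c m n \<in> res_chains G (m + n) \<and>
      res_bd G (c m n) = cyc_bd p (res_act G t) m (c (m - 1) n)
        + alt m (cyc_bd p (res_act G s) n (c m (n - 1))))"

text \<open>The usual inductive homotopy on the generator of bidegree (m, n): \<open>u\<close> is
  the difference of the two chain maps, \<open>A\<close> and \<open>B\<close> are the two
  differentials and \<open>h\<close> is a contraction. The patterns at 0 make the recursion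
  structural; \<open>htpy_eq\<close> restores the uniform formula.\<close>

fun htpy :: "('a \<Rightarrow> 'a) \<Rightarrow> (nat \<Rightarrow> 'a \<Rightarrow> 'a) \<Rightarrow> (nat \<Rightarrow> 'a \<Rightarrow> 'a) \<Rightarrow> (nat \<Rightarrow> nat \<Rightarrow> 'a::ab_group_add)
    \<Rightarrow> nat \<Rightarrow> nat \<Rightarrow> 'a" where
  "htpy h A B u 0 0 = h (u 0 0)"
| "htpy h A B u (Suc m) 0 = h (u (Suc m) 0 - A (Suc m) (htpy h A B u m 0))"
| "htpy h A B u 0 (Suc n) = h (u 0 (Suc n) - B (Suc n) (htpy h A B u 0 n))"
| "htpy h A B u (Suc m) (Suc n) = h (u (Suc m) (Suc n) - A (Suc m) (htpy h A B u m (Suc n))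
     - alt (Suc m) (B (Suc n) (htpy h A B u (Suc m) n)))"

lemma htpy_eq:
  assumes "\<And>x. A 0 x = 0" "\<And>x. B 0 x = 0"
  shows "htpy h A B u m n =
    h (u m n - A m (htpy h A B u (m - 1) n) - alt m (B n (htpy h A B u m (n - 1))))"
  by (cases m; cases n) (simp_all add: assms)

lemma additive_chain_linear: "chain_linear f \<Longrightarrow> additive f"
  by (simp add: additive_def module_hom.add)

lemma coinv_funpow_act [simp]: "coinv ((res_act G t ^^ k) x) = coinv x"
  by (induction k) simp_all

lemma sum_const_chain: "(\<Sum>k<(n::nat). x) = chain_scale (of_nat n) x"
  by (induction n) (simp_all add: chain_scale_distribs add.commute)

text \<open>On coinvariants T - 1 becomes 0 and the norm becomes p. Hence modulo p every generator
  of the standard resolution, and of its tensor square, yields a cycle.\<close>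

lemma coinv_cyc_bd [simp]:
  assumes "of_nat p = (0::'k::comm_ring_1)"
  shows "coinv (cyc_bd p (res_act G t) n x :: _ \<Rightarrow>\<^sub>0 'k) = 0"
  by (simp add: cyc_bd_def sum_const_chain assms)

context group begin

lemma res_act_cyclic_operator:
  assumes "t \<in> carrier G" "t [^] p = \<one>"
  shows "cyclic_operator (res_act G t) p"
  using assms by unfold_locales (simp_all add: res_act_pow)

lemma res_act_cyclic_operators:
  assumes "cyclic_pair G p t s"
  shows "cyclic_operators (res_act G t) (res_act G s) p"
  using assms
  by unfold_locales (simp_all add: cyclic_pair_def res_act_pow res_act_mult)

lemma funpow_act_chains [simp]:
  "t \<in> carrier G \<Longrightarrow> c \<in> res_chains G n \<Longrightarrow> (res_act G t ^^ k) c \<in> res_chains G n"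
  by (induction k) simp_all

lemma cyc_bd_chains [simp]:
  "t \<in> carrier G \<Longrightarrow> c \<in> res_chains G n \<Longrightarrow> cyc_bd p (res_act G t) m c \<in> res_chains G n"
  by (simp add: cyc_bd_def)

lemma res_bd_funpow_act:
  "t \<in> carrier G \<Longrightarrow> c \<in> res_chains G n \<Longrightarrow>
    res_bd G ((res_act G t ^^ k) c) = (res_act G t ^^ k) (res_bd G c)"
  by (induction k) (simp_all add: res_bd_act[where n = n])

lemma res_bd_cyc_bd:
  "t \<in> carrier G \<Longrightarrow> c \<in> res_chains G n \<Longrightarrow>
    res_bd G (cyc_bd p (res_act G t) m c) = cyc_bd p (res_act G t) m (res_bd G c)"
  by (simp add: cyc_bd_def res_bd_act[where n = n] res_bd_funpow_act[where n = n])

text \<open>This is the comparison theorem for free resolutions; the homotopy comes from the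
  contraction of the bar resolution.\<close>

theorem bisequence_unique:
  fixes c c' :: "nat \<Rightarrow> nat \<Rightarrow> ('a \<times> 'a list) \<Rightarrow>\<^sub>0 'k::comm_ring_1"
  assumes p: "of_nat p = (0::'k)" and ts: "cyclic_pair G p t s"
    and c: "bisequence G p t s c" and c': "bisequence G p t s c'"
  shows "coinv (c m n) - coinv (c' m n) \<in> bar_boundaries G"
proof -
  interpret cyclic_operators "res_act G t" "res_act G s" p
    by (rule res_act_cyclic_operators[OF ts])
  have t: "t \<in> carrier G" and s: "s \<in> carrier G"
    using ts by (simp_all add: cyclic_pair_def)
  let ?A = "cyc_bd p (res_act G t)" and ?B = "cyc_bd p (res_act G s)"
  note additives = additive_cyc_bd[OF T.additive_axioms] additive_cyc_bd[OF S.T.additive_axioms]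
  note AB_simps = additive.zero[OF additives(1)] additive.zero[OF additives(2)]
    additive.diff[OF additives(1)] additive.diff[OF additives(2)]
    additive.add[OF additives(1)] additive.add[OF additives(2)]
    additive_alt[OF additives(1)] additive_alt[OF additives(2)]
  have AB: "?A i (?B j x) = ?B j (?A i x)" for i j and x :: "_ \<Rightarrow>\<^sub>0 'k"
    using cyc_bd_commute[OF additives(1), where T = "res_act G s"]
      cyc_bd_commute[OF S.T.additive_axioms, where T = "res_act G t"] commute by metis
  define u where "u m n = c m n - c' m n" for m n
  define k where "k = htpy (cone \<one>) ?A ?B u"
  \<comment> \<open>The part of \<open>u\<close> left over by the homotopy in lower degrees; the
    homotopy in bidegree (m, n) is its cone.\<close>
  define r where "r m n = u m n - ?A m (k (m - 1) n) - alt m (?B n (k m (n - 1)))" for m n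
  have k: "k m n = cone \<one> (r m n)" for m n
    unfolding k_def r_def by (rule htpy_eq) simp_all
  have u: "u m n \<in> res_chains G (m + n)"
    "res_bd G (u m n) = ?A m (u (m - 1) n) + alt m (?B n (u m (n - 1)))" for m n
    using c c' by (simp_all add: bisequence_def u_def AB_simps alt_diff)
  have "k m n \<in> res_chains G (Suc (m + n)) \<and> r m n \<in> res_chains G (m + n) \<and> res_bd G (k m n) = r m
      n" for m n
  proof (induction "m + n" arbitrary: m n rule: less_induct)
    case less
    have Ak: "?A m (k (m - 1) n) \<in> res_chains G (m + n)"
      "res_bd G (?A m (k (m - 1) n)) = ?A m (r (m - 1) n)"
      using less[of "m - 1" n] t by (cases m; simp add: res_bd_cyc_bd[where n = "m + n"])+
    have Bk: "?B n (k m (n - 1)) \<in> res_chains G (m + n)"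
      "res_bd G (?B n (k m (n - 1))) = ?B n (r m (n - 1))"
      using less[of m "n - 1"] s by (cases n; simp add: res_bd_cyc_bd[where n = "m + n"])+
    have r: "r m n \<in> res_chains G (m + n)"
      using u(1) Ak(1) Bk(1) by (simp add: r_def)
    have r1: "?A m (r (m - 1) n) = ?A m (u (m - 1) n) + alt m (?A m (?B n (k (m - 1) (n - 1))))"
      by (cases m) (simp_all add: r_def AB_simps cyc_bd_square[of "Suc _", simplified])
    have r2: "?B n (r m (n - 1)) = ?B n (u m (n - 1)) - ?A m (?B n (k (m - 1) (n - 1)))"
      by (cases n) (simp_all add: r_def AB_simps AB S.cyc_bd_square[of "Suc _", simplified])
    have "res_bd G (r m n) = res_bd G (u m n) - res_bd G (?A m (k (m - 1) n)) - alt m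
        (res_bd G (?B n (k m (n - 1))))"
      by (simp add: r_def additive_alt[OF additive_chain_linear[OF chain_linear_res(1)]])
    then have dr: "res_bd G (r m n) = 0"
      unfolding u(2) Ak(2) Bk(2) r1 r2 by (simp add: alt_diff AB)
    \<comment> \<open>In positive degree this holds because \<open>r\<close> is a cycle, in degree 0
      because both families have the same augmentation.\<close>
    have "res_bd G (cone \<one> (r m n)) = r m n"
    proof (cases "m + n")
      case 0
      then have "coinv (r m n) = 0"
        using c c' by (simp add: r_def u_def bisequence_def)
      with 0 r show ?thesis by (simp add: res_bd_cone_0)
    next
      case (Suc l)
      with r dr show ?thesis by (simp add: res_bd_cone[of _ l])
    qed
    with r show ?case by (simp add: k)
  qed
  note k_props = this[of m n]
  have "coinv (c m n) - coinv (c' m n) = coinv (r m n)"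
    by (simp add: r_def u_def p additive_alt[OF additive_chain_linear[OF chain_linear_res(4)]])
  also have "\<dots> = bar_bd G (coinv (k m n))"
    using k_props bar_bd_coinv[of "k m n" "Suc (m + n)"] by simp
  finally show ?thesis
    using k_props by (auto simp: bar_boundaries_def intro: coinv_chains)
qed

end

section \<open>Sequences over one cyclic group, functoriality and explicit families\<close>

definition cyclic_sequence ::
  "('g, 'm) monoid_scheme \<Rightarrow> nat \<Rightarrow> 'g \<Rightarrow> (nat \<Rightarrow> ('g \<times> 'g list) \<Rightarrow>\<^sub>0 'k::comm_ring_1) \<Rightarrow> bool"
  where "cyclic_sequence G p t e \<longleftrightarrow> coinv (e 0) = gen [] \<and>
    (\<forall>n. e n \<in> res_chains G n \<and> res_bd G (e n) = cyc_bd p (res_act G t) n (e (n - 1)))"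

lemma push_funpow_act:
  assumes "group G" "\<phi> \<in> hom G H" "t \<in> carrier G" "c \<in> res_chains G n"
  shows "push \<phi> ((res_act G t ^^ k) c) = (res_act H (\<phi> t) ^^ k) (push \<phi> c)"
  by (induction k)
    (simp_all add: push_act[OF assms(2,3), where n = n] group.funpow_act_chains[OF assms(1,3,4)])

lemma push_cyc_bd:
  assumes "group G" "\<phi> \<in> hom G H" "t \<in> carrier G" "c \<in> res_chains G n"
  shows "push \<phi> (cyc_bd p (res_act G t) k c) = cyc_bd p (res_act H (\<phi> t)) k (push \<phi> c)"
  by (simp add: cyc_bd_def push_act[OF assms(2-4)] push_funpow_act[OF assms])

lemma additive_push: "additive (push \<phi>)"
  by (rule additive_chain_linear[OF chain_linear_res(5)])

lemma bisequence_push: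
  assumes "group G" "group H" "\<phi> \<in> hom G H" "cyclic_pair G p t s" "bisequence G p t s c"
  shows "bisequence H p (\<phi> t) (\<phi> s) (\<lambda>m n. push \<phi> (c m n))"
proof -
  have c: "c m n \<in> res_chains G (m + n)"
    "res_bd G (c m n) = cyc_bd p (res_act G t) m (c (m - 1) n)
        + alt m (cyc_bd p (res_act G s) n (c m (n - 1)))" for m n
    using assms(5) by (simp_all add: bisequence_def)
  have ts: "t \<in> carrier G" "s \<in> carrier G"
    using assms(4) by (auto simp: cyclic_pair_def)
  show ?thesis
    using assms(5)
    by (auto simp: bisequence_def coinv_push push_chains[OF assms(3)] push_res_bd[OF assms(1-3) c(1)]
        push_cyc_bd[OF assms(1,3) ts(1) c(1)] push_cyc_bd[OF assms(1,3) ts(2) c(1)]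
        additive_alt[OF additive_push])
qed

lemma sequence_push:
  assumes "group G" "group H" "\<phi> \<in> hom G H" "t \<in> carrier G" "cyclic_sequence G p t e"
  shows "cyclic_sequence H p (\<phi> t) (\<lambda>n. push \<phi> (e n))"
proof -
  have e: "e n \<in> res_chains G n" for n
    using assms(5) by (simp add: cyclic_sequence_def)
  show ?thesis
    using assms(5)
    by (auto simp: cyclic_sequence_def coinv_push push_chains[OF assms(3)] push_res_bd[OF assms(1-3) e]
        push_cyc_bd[OF assms(1,3,4) e])
qed

lemma cyclic_pair_hom:
  assumes "group G" "group H" "\<phi> \<in> hom G H" "cyclic_pair G p t s"
  shows "cyclic_pair H p (\<phi> t) (\<phi> s)"
proof -
  interpret group_hom G H \<phi>
    using assms by (simp add: group_hom_def group_hom_axioms_def)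
  show ?thesis
    using assms(4) by (metis cyclic_pair_def hom_closed hom_mult hom_nat_pow hom_one)
qed

context group begin

text \<open>Acting by \<open>g\<close> does not change coinvariants and conjugates the pair; hence inner
  automorphisms act trivially on the classes represented by bisequences.\<close>

lemma bisequence_conj:
  fixes c :: "nat \<Rightarrow> nat \<Rightarrow> ('a \<times> 'a list) \<Rightarrow>\<^sub>0 'k::comm_ring_1"
  assumes g: "g \<in> carrier G" and ts: "t \<in> carrier G" "s \<in> carrier G" "t' \<in> carrier G" "s' \<in> carrier G"
    and t': "t' \<otimes> g = g \<otimes> t" and s': "s' \<otimes> g = g \<otimes> s" and c: "bisequence G p t s c"
  shows "bisequence G p t' s' (\<lambda>m n. res_act G g (c m n))"
proof -
  have c': "c m n \<in> res_chains G (m + n)" for m n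
    using c by (simp add: bisequence_def)
  have *: "additive (res_act G g)"
    by (rule additive_chain_linear[OF chain_linear_res(2)])
  have "res_act G g (cyc_bd p (res_act G t) k x) = cyc_bd p (res_act G t') k (res_act G g x)"
    if "t' \<otimes> g = g \<otimes> t" "t \<in> carrier G" "t' \<in> carrier G" for k t t' and x :: "_ \<Rightarrow>\<^sub>0 'k"
  proof -
    have *: "res_act G g (res_act G t x) = res_act G t' (res_act G g x)" for x :: "_ \<Rightarrow>\<^sub>0 'k"
      using g that by (simp add: res_act_mult)
    moreover have "res_act G g ((res_act G t ^^ k) x) = (res_act G t' ^^ k) (res_act G g x)" for k
        and x :: "_ \<Rightarrow>\<^sub>0 'k"
      by (induction k) (simp_all add: *)
    ultimately show ?thesis
      by (simp add: cyc_bd_def)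
  qed
  note ** = this[OF t' ts(1,3)] this[OF s' ts(2,4)]
  show ?thesis
    using c by (simp add: bisequence_def g ** res_bd_act[OF g c'] additive_alt[OF *])
qed

lemma bisequence_sequence:
  "bisequence G p t s c \<Longrightarrow> cyclic_sequence G p t (\<lambda>n. c n 0)"
  by (auto simp: bisequence_def cyclic_sequence_def) (metis add_0_right)+

lemma cyc_bd_one:
  assumes "of_nat p = (0::'k::comm_ring_1)"
  shows "cyc_bd p (res_act G \<one>) n (x :: ('a \<times> 'a list) \<Rightarrow>\<^sub>0 'k) = 0"
proof -
  have "(res_act G \<one> ^^ k) x = x" for k
    by (induction k) simp_all
  then show ?thesis
    by (simp add: cyc_bd_def sum_const_chain assms)
qed

text \<open>For the unit element T - 1 is 0 and the norm is p, so modulo p the second differential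
  vanishes. In this way the uniqueness of bisequences also serves for sequences.\<close>

lemma sequence_bisequence:
  fixes e :: "nat \<Rightarrow> ('a \<times> 'a list) \<Rightarrow>\<^sub>0 'k::comm_ring_1"
  assumes "of_nat p = (0::'k)" "t \<in> carrier G" "cyclic_sequence G p t e"
  shows "bisequence G p t \<one> (\<lambda>m n. if n = 0 then e m else 0)"
proof -
  have "cyc_bd p (res_act G t) n 0 = (0 :: _ \<Rightarrow>\<^sub>0 'k)" for n
    by (rule additive.zero[OF additive_cyc_bd[OF additive_chain_linear[OF chain_linear_res(2)]]])
  then show ?thesis
    using assms(3) by (auto simp: bisequence_def cyclic_sequence_def cyc_bd_one[OF assms(1)])
qed

lemma trivial_sequence:
  assumes "of_nat p = (0::'k::comm_ring_1)"
  shows "cyclic_sequence G p \<one> (\<lambda>n. if n = 0 then gen (\<one>, []) else (0 :: _ \<Rightarrow>\<^sub>0 'k))"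
  by (auto simp: cyclic_sequence_def cyc_bd_one[OF assms])

lemma res_act_pow_fun: "t \<in> carrier G \<Longrightarrow> res_act G (t [^] (k::nat)) = res_act G t ^^ k"
  by (simp add: fun_eq_iff res_act_pow)

text \<open>A chain map over the homomorphism (a, b) |-> k a + b. The operator P = 1 + t + ... +
  t^(k-1) lifts multiplication by k, since P(t - 1) = t^k - 1 and the norm of t^k composed with P is
  k times the norm of t. The binomial coefficients are those of a divided power algebra; in even
  bidegrees the boundary formula is Pascal's rule.\<close>

lemma power_bisequence:
  fixes e :: "nat \<Rightarrow> ('a \<times> 'a list) \<Rightarrow>\<^sub>0 'k::comm_ring_1" and k :: nat
  assumes t: "t \<in> carrier G" "t [^] p = \<one>" and e: "cyclic_sequence G p t e"
  defines "w \<equiv> \<lambda>i j. of_nat (k ^ i * ((i + j) choose i)) :: 'k"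
  shows "bisequence G p (t [^] k) t (\<lambda>m n. if odd m \<and> odd n then 0 else
    chain_scale (w (m div 2) (n div 2)) (if odd m then \<Sum>b<k. (res_act G t ^^ b) (e (m + n)) else e
        (m + n)))"
    (is "bisequence _ _ _ _ ?c")
proof -
  define T where "T = (res_act G t :: (('a \<times> 'a list) \<Rightarrow>\<^sub>0 'k) \<Rightarrow> _)"
  interpret cyclic_operator T p
    unfolding T_def by (rule res_act_cyclic_operator[OF t])
  have lin: "chain_linear T" "chain_linear (T ^^ b)" for b
  proof -
    show T: "chain_linear T"
      unfolding T_def by (rule chain_linear_res)
    show "chain_linear (T ^^ b)"
      by (induction b) (use chain_linear_id chain_linear_comp[OF T] in \<open>auto simp: id_def comp_def\<close>)
  qed
  note simps = chain_linear_simps[OF lin(1)] chain_linear_simps[OF lin(2)]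
  define P where "P x = (\<Sum>b<k. (T ^^ b) x)" for x
  have P_diff: "P (T x - x) = (T ^^ k) x - x" for x
  proof -
    have "P (T x - x) = (\<Sum>b<k. (T ^^ Suc b) x - (T ^^ b) x)"
      by (simp add: P_def simps funpow_swap1)
    then show ?thesis by (subst (asm) sum_lessThan_telescope) simp
  qed
  \<comment> \<open>The exponents below p k are grouped once into blocks of length k and once into
    blocks of length p; each of the latter is a full norm.\<close>
  have P_norm: "(\<Sum>a<p. ((T ^^ k) ^^ a) (P x)) = chain_scale (of_nat k) (\<Sum>a<p. (T ^^ a) x)" for x
  proof -
    have shift: "(\<Sum>i\<in>{a..<a + l}. f i) = (\<Sum>b<l. f (a + b))" for a l and f ::
        "nat \<Rightarrow> ('a \<times> 'a list) \<Rightarrow>\<^sub>0 'k"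
      by (simp add: sum.atLeastLessThan_shift_0[of f a "a + l"] lessThan_atLeast0)
    have "(\<Sum>a<p. ((T ^^ k) ^^ a) (P x)) = (\<Sum>a<p. \<Sum>b<k. (T ^^ (a * k + b)) x)"
      by (simp add: P_def simps(5) additive.sum[OF additive_funpow[OF T.additive_axioms]]
          funpow_mult funpow_add mult.commute)
    also have "\<dots> = (\<Sum>i<p * k. (T ^^ i) x)"
      unfolding sum.nat_group[symmetric] shift ..
    also have "\<dots> = (\<Sum>b<k. \<Sum>a<p. (T ^^ (b * p + a)) x)"
      unfolding mult.commute[of p] sum.nat_group[symmetric] shift ..
    also have "\<dots> = (\<Sum>b<k. \<Sum>a<p. (T ^^ a) x)"
    proof -
      have "(T ^^ (b * p)) y = y" for b y
        by (induction b) (simp_all add: funpow_add period)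
      then have "(T ^^ (b * p + a)) x = (T ^^ a) x" for a b
        by (subst add.commute) (simp add: funpow_add)
      then show ?thesis by simp
    qed
    finally show ?thesis by (simp add: sum_const_chain)
  qed
  have e_props: "e n \<in> res_chains G n" "res_bd G (e n) = cyc_bd p T n (e (n - 1))" for n
    using e by (simp_all add: cyclic_sequence_def T_def)
  have P_chains: "P x \<in> res_chains G n" if "x \<in> res_chains G n" for x n
    using that t by (simp add: P_def T_def)
  have P_bd: "res_bd G (P x) = P (res_bd G x)" if "x \<in> res_chains G n" for x n
    using that t by (simp add: P_def T_def res_bd_funpow_act[where n = n])
  have P_scale: "P (chain_scale a x) = chain_scale a (P x)" for a x
    by (simp add: P_def simps chain_scale_distribs)
  have P_diff': "T (P x) - P x = (T ^^ k) x - x" for x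
    by (simp add: P_diff[symmetric], simp add: P_def simps funpow_swap1 sum_subtractf)
  define N where "N x = (\<Sum>a<p. (T ^^ a) x)" for x
  have N_scale: "N (chain_scale a x) = chain_scale a (N x)" for a x
    by (simp add: N_def simps chain_scale_distribs)
  have cyc_even: "cyc_bd p T n x = N x" "cyc_bd p (T ^^ k) n (P x) = chain_scale (of_nat k) (N x)"
    if "even n" "n > 0" for n x
    using that by (simp_all add: cyc_bd_def N_def P_norm)
  have cyc_odd: "cyc_bd p T n x = T x - x" "cyc_bd p (T ^^ k) n x = (T ^^ k) x - x"
    if "odd n" for n x
    using that by (auto simp: cyc_bd_def odd_pos)
  have cyc_0: "cyc_bd p T n 0 = 0" "cyc_bd p (T ^^ k) n 0 = 0" for n
    using additive.zero[OF additive_cyc_bd[OF additive_funpow[OF T.additive_axioms]]]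
      additive.zero[OF additive_cyc_bd[OF T.additive_axioms]] by auto
  define c where "c m n = (if odd m \<and> odd n then 0 else
    chain_scale (w (m div 2) (n div 2)) (if odd m then P (e (m + n)) else e (m + n)))" for m n
  have "res_bd G (c m n) = cyc_bd p (T ^^ k) m (c (m - 1) n) + alt m (cyc_bd p T n (c m (n - 1)))"
      for m n
  proof (cases "even m"; cases "even n")
    assume "even m" "even n"
    then obtain i j where [simp]: "m = 2 * i" "n = 2 * j" by (elim evenE)
    have 1: "cyc_bd p (T ^^ k) m (c (m - 1) n) =
        chain_scale (if i = 0 then 0 else w (i - 1) j * of_nat k) (N (e (m + n - 1)))"
    proof (cases i)
      case (Suc i')
      have "cyc_bd p (T ^^ k) m (c (m - 1) n) = cyc_bd p (T ^^ k) m
          (P (chain_scale (w i' j) (e (m + n - 1))))"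
        by (simp add: c_def Suc P_scale)
      also have "\<dots> = chain_scale (w i' j * of_nat k) (N (e (m + n - 1)))"
        by (subst cyc_even(2)) (simp_all add: Suc N_scale mult.commute)
      finally show ?thesis by (simp add: Suc)
    qed simp
    have 2: "cyc_bd p T n (c m (n - 1)) = chain_scale (if j = 0 then 0 else w i (j - 1))
        (N (e (m + n - 1)))"
    proof (cases j)
      case (Suc j')
      have "cyc_bd p T n (c m (n - 1)) = N (chain_scale (w i j') (e (m + n - 1)))"
        by (subst cyc_even(1)) (simp_all add: c_def Suc)
      then show ?thesis by (simp add: Suc N_scale)
    qed simp
    have 3: "(if i = 0 then 0 else w (i - 1) j * of_nat k) + (if j = 0 then 0 else w i (j - 1)) = w i j"
      if "i + j > 0"
      using that by (cases i; cases j) (simp_all add: w_def algebra_simps binomial_eq_0)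
    have "res_bd G (c m n) = chain_scale (w i j) (cyc_bd p T (m + n) (e (m + n - 1)))"
      by (simp add: c_def e_props)
    also have "\<dots> = (if i + j > 0 then chain_scale (w i j) (N (e (m + n - 1))) else 0)"
      using cyc_even(1)[of "m + n"] by simp
    finally show ?thesis
      unfolding 1 2 by (auto simp: alt_def chain_scale_distribs(2)[symmetric] 3)
  next
    assume "even m" "odd n"
    then obtain i j where [simp]: "m = 2 * i" "n = 2 * j + 1" by (elim evenE oddE)
    have "cyc_bd p (T ^^ k) m (c (m - 1) n) = 0"
      by (cases i) (simp_all add: c_def cyc_0)
    then show ?thesis
      by (simp add: alt_def cyc_odd) (simp add: c_def e_props cyc_odd simps chain_scale_distribs)
  next
    assume "odd m" "even n"
    then obtain i j where [simp]: "m = 2 * i + 1" "n = 2 * j" by (elim evenE oddE)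
    have "cyc_bd p T n (c m (n - 1)) = 0"
      by (cases j) (simp_all add: c_def cyc_0)
    moreover have "res_bd G (P (e (m + n))) = (T ^^ k) (e (2 * i + 2 * j)) - e (2 * i + 2 * j)"
      using P_bd[OF e_props(1)] by (simp add: e_props(2) cyc_odd P_diff)
    ultimately show ?thesis
      by (simp add: alt_def cyc_odd) (simp add: c_def simps chain_scale_distribs)
  next
    assume "odd m" "odd n"
    then obtain i j where [simp]: "m = 2 * i + 1" "n = 2 * j + 1" by (elim oddE)
    have "T (P x) = P x + (T ^^ k) x - x" for x
      using P_diff'[of x] by (simp add: algebra_simps)
    then show ?thesis
      by (simp add: alt_def cyc_odd) (simp add: c_def simps chain_scale_distribs)
  qed
  moreover have "c m n \<in> res_chains G (m + n)" for m n
    by (simp add: c_def e_props P_chains)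
  moreover have "coinv (c 0 0) = gen []"
    using e by (simp add: c_def w_def cyclic_sequence_def)
  ultimately have "bisequence G p (t [^] k) t c"
    unfolding bisequence_def res_act_pow_fun[OF t(1)] T_def[symmetric] by blast
  then show ?thesis
    unfolding c_def P_def T_def .
qed

text \<open>The case k = 1 for p = 2 in a form that ignores parities, as the identity for p = 2
  does. In characteristic 2 the operators t - 1 and 1 + t agree, so all positive differentials
  coincide and Pascal's rule is all that is needed.\<close>

lemma binomial_bisequence:
  fixes e :: "nat \<Rightarrow> ('a \<times> 'a list) \<Rightarrow>\<^sub>0 'k::comm_ring_1"
  assumes two: "(2::'k) = 0" and e: "cyclic_sequence G 2 t e"
  shows "bisequence G 2 t t (\<lambda>m n. chain_scale (of_nat ((m + n) choose m)) (e (m + n)))"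
proof -
  have "(1::'k) + 1 = 0" using two by simp
  then have "(- 1 :: 'k) = 1" by (simp add: eq_neg_iff_add_eq_0 flip: minus_equation_iff)
  then have neg: "- x = x" for x :: "_ \<Rightarrow>\<^sub>0 'k"
    by (metis chain_scale_minus_one chain_scale_simps(3))
  have alt: "alt n x = x" for n and x :: "('a \<times> 'a list) \<Rightarrow>\<^sub>0 'k"
    by (simp add: alt_def neg)
  have cyc: "cyc_bd 2 T n x = (if n = 0 then 0 else T x + x)" for T n and x :: "('a \<times> 'a list) \<Rightarrow>\<^sub>0 'k"
    using neg[of x] by (simp add: cyc_bd_def lessThan_Suc numeral_2_eq_2 add.commute flip:
        diff_conv_add_uminus)
  have e': "e n \<in> res_chains G n" "res_bd G (e n) = cyc_bd 2 (res_act G t) n (e (n - 1))" for n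
    using e by (simp_all add: cyclic_sequence_def)
  have "chain_scale (of_nat ((m + n) choose m)) (cyc_bd 2 (res_act G t) (m + n) (e (m + n - 1))) =
    cyc_bd 2 (res_act G t) m (chain_scale (of_nat ((m - 1 + n) choose (m - 1))) (e (m - 1 + n))) +
    cyc_bd 2 (res_act G t) n (chain_scale (of_nat ((m + (n - 1)) choose m)) (e (m + (n - 1))))" for m n
    by (cases m; cases n) (simp_all add: cyc chain_scale_distribs algebra_simps)
  with e e' show ?thesis
    by (simp add: bisequence_def cyclic_sequence_def alt)
qed

end

text \<open>The effect of \<open>diag_coeff\<close> on coinvariants.\<close>

definition kappa :: "nat \<Rightarrow> nat \<Rightarrow> nat \<Rightarrow> 'k::comm_ring_1"
  where "kappa p i j = (if odd i \<and> odd j then of_nat (\<Sum>b<p. b) else 1)"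

section \<open>Cross products of families and the diagonal of the square of a cyclic group\<close>

context group_pair begin

lemma cross_funpow:
  assumes "g \<in> carrier G" "h \<in> carrier H" "a \<in> res_chains G m" "b \<in> res_chains H n"
  shows "res_cross G H ((res_act G g ^^ k) a) b = (res_act GH (g, \<one>\<^bsub>H\<^esub>) ^^ k) (res_cross G H a b)"
    "res_cross G H a ((res_act H h ^^ k) b) = (res_act GH (\<one>\<^bsub>G\<^esub>, h) ^^ k) (res_cross G H a b)"
proof -
  have "res_cross G H (res_act G g a) b = res_act GH (g, \<one>\<^bsub>H\<^esub>) (res_cross G H a b)"
    if "a \<in> res_chains G m" for a
    using cross_act[of g "\<one>\<^bsub>H\<^esub>" a m b n] assms that by simp
  then show "res_cross G H ((res_act G g ^^ k) a) b = (res_act GH (g, \<one>\<^bsub>H\<^esub>) ^^ k) (res_cross G H a b)"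
    using assms by (induction k) simp_all
  have "res_cross G H a (res_act H h b) = res_act GH (\<one>\<^bsub>G\<^esub>, h) (res_cross G H a b)"
    if "b \<in> res_chains H n" for b
    using cross_act[of "\<one>\<^bsub>G\<^esub>" h a m b n] assms that by simp
  then show "res_cross G H a ((res_act H h ^^ k) b) = (res_act GH (\<one>\<^bsub>G\<^esub>, h) ^^ k) (res_cross G H a b)"
    using assms by (induction k) simp_all
qed

lemma cross_cyc_bd:
  assumes "g \<in> carrier G" "h \<in> carrier H" "a \<in> res_chains G m" "b \<in> res_chains H n"
  shows "res_cross G H (cyc_bd p (res_act G g) k a) b =
      cyc_bd p (res_act GH (g, \<one>\<^bsub>H\<^esub>)) k (res_cross G H a b)"
    "res_cross G H a (cyc_bd p (res_act H h) k b) =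
      cyc_bd p (res_act GH (\<one>\<^bsub>G\<^esub>, h)) k (res_cross G H a b)"
  using cross_funpow[OF assms] cross_funpow[OF assms, of 1] by (simp_all add: cyc_bd_def)

lemma cross_gen_Nil: "coinv a = gen [] \<Longrightarrow> coinv b = gen [] \<Longrightarrow> coinv (res_cross G H a b) = gen []"
  by (simp add: coinv_cross bar_cross_gen)

lemma cross_sequences:
  assumes t: "t \<in> carrier G" and s: "s \<in> carrier H"
    and e: "cyclic_sequence G p t e" and f: "cyclic_sequence H p s f"
  shows "bisequence GH p (t, \<one>\<^bsub>H\<^esub>) (\<one>\<^bsub>G\<^esub>, s) (\<lambda>m n. res_cross G H (e m) (f n))"
proof -
  have e': "e n \<in> res_chains G n" "res_bd G (e n) = cyc_bd p (res_act G t) n (e (n - 1))" for n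
    using e by (simp_all add: cyclic_sequence_def)
  have f': "f n \<in> res_chains H n" "res_bd H (f n) = cyc_bd p (res_act H s) n (f (n - 1))" for n
    using f by (simp_all add: cyclic_sequence_def)
  show ?thesis
    using e f
    by (simp add: bisequence_def cyclic_sequence_def cross_gen_Nil cross_bd[OF e'(1) f'(1)]
        cross_cyc_bd[OF t s e'(1) f'(1)])
qed

lemma point_cross_sequence:
  fixes f :: "nat \<Rightarrow> ('h \<times> 'h list) \<Rightarrow>\<^sub>0 'k::comm_ring_1"
  assumes s: "s \<in> carrier H" and f: "cyclic_sequence H p s f"
  shows "cyclic_sequence GH p (\<one>\<^bsub>G\<^esub>, s) (\<lambda>n. res_cross G H (gen (\<one>\<^bsub>G\<^esub>, [])) (f n))"
proof -
  have f': "f n \<in> res_chains H n" "res_bd H (f n) = cyc_bd p (res_act H s) n (f (n - 1))" for n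
    using f by (simp_all add: cyclic_sequence_def)
  have 0: "gen (\<one>\<^bsub>G\<^esub>, []) \<in> res_chains G 0"
    by (rule chains_on_gen) simp
  have "res_cross G H (gen (\<one>\<^bsub>G\<^esub>, [])) (f n) \<in> res_chains GH n" for n
    using cross_chains[OF 0 f'(1)[of n]] by simp
  then show ?thesis
    using f
    by (simp add: cyclic_sequence_def cross_gen_Nil cross_bd[OF 0 f'(1)]
        cross_cyc_bd(2)[OF G.one_closed s 0 f'(1)] del: res_cross_gen)
qed

text \<open>The elements \<open>(t, t')\<close> and \<open>(s, s')\<close> are the images of the two
  generators under the diagonal of \<pi> \<times> \<pi> followed by the two given homomorphisms. The
  diagonal of the standard resolution is therefore applied in each of the two variables to the cross
  product of the families; \<open>kappa\<close> is what remains of its coefficients on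
  coinvariants.\<close>

theorem bisequence_product:
  fixes c :: "nat \<Rightarrow> nat \<Rightarrow> ('g \<times> 'g list) \<Rightarrow>\<^sub>0 'k::comm_ring_1"
  assumes ts: "cyclic_pair G p t s" and ts': "cyclic_pair H p t' s'"
    and c: "bisequence G p t s c" and c': "bisequence H p t' s' c'"
  obtains C where "bisequence GH p (t, t') (s, s') C"
    "\<And>m n. coinv (C m n) = (\<Sum>j\<le>n. \<Sum>i\<le>m. chain_scale (kappa p i (m - i) * kappa p j (n - j))
       (alt ((m - i) * j) (bar_cross G H (coinv (c i j)) (coinv (c' (m - i) (n - j))))))"
proof -
  interpret GH: group GH by (rule group_prod)
  have carr: "t \<in> carrier G" "s \<in> carrier G" "t' \<in> carrier H" "s' \<in> carrier H"
    using ts ts' by (simp_all add: cyclic_pair_def)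
  have pows: "(g, h) [^]\<^bsub>GH\<^esub> (n::nat) = (g [^]\<^bsub>G\<^esub> n, h [^]\<^bsub>H\<^esub> n)" for g h n
    by (induction n) (simp_all add: one_DirProd)
  define T T' S S' where TS_def: "T = (res_act GH (t, \<one>\<^bsub>H\<^esub>) :: (_ \<Rightarrow>\<^sub>0 'k) \<Rightarrow> _)"
    "T' = (res_act GH (\<one>\<^bsub>G\<^esub>, t') :: (_ \<Rightarrow>\<^sub>0 'k) \<Rightarrow> _)"
    "S = (res_act GH (s, \<one>\<^bsub>H\<^esub>) :: (_ \<Rightarrow>\<^sub>0 'k) \<Rightarrow> _)"
    "S' = (res_act GH (\<one>\<^bsub>G\<^esub>, s') :: (_ \<Rightarrow>\<^sub>0 'k) \<Rightarrow> _)"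
  have "cyclic_pair GH p (t, \<one>\<^bsub>H\<^esub>) (\<one>\<^bsub>G\<^esub>, t')" "cyclic_pair GH p (s, \<one>\<^bsub>H\<^esub>) (\<one>\<^bsub>G\<^esub>, s')"
    using ts ts' by (simp_all add: cyclic_pair_def pows)
  note this[THEN GH.res_act_cyclic_operators, folded TS_def]
  then interpret X: cyclic_operators T T' p + Y: cyclic_operators S S' p
    unfolding TS_def by auto
  have commute: "T (S x) = S (T x)" "T (S' x) = S' (T x)" "T' (S x) = S (T' x)"
      "T' (S' x) = S' (T' x)" for x
    using ts ts' unfolding TS_def by (simp_all add: GH.res_act_mult cyclic_pair_def)
  have TT: "T \<circ> T' = res_act GH (t, t')" "S \<circ> S' = res_act GH (s, s')"
    unfolding TS_def using carr by (simp_all add: fun_eq_iff GH.res_act_mult)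
  have cp: "c i j \<in> res_chains G (i + j)" "res_bd G (c i j) =
      cyc_bd p (res_act G t) i (c (i - 1) j) + alt i (cyc_bd p (res_act G s) j (c i (j - 1)))" for i j
    using c by (simp_all add: bisequence_def)
  have cp': "c' i j \<in> res_chains H (i + j)" "res_bd H (c' i j) =
      cyc_bd p (res_act H t') i (c' (i - 1) j) + alt i (cyc_bd p (res_act H s') j (c' i (j - 1)))"
          for i j
    using c' by (simp_all add: bisequence_def)
  \<comment> \<open>The sign comes from interchanging the second factor of \<open>c\<close>, of
    degree j, with the first factor of \<open>c'\<close>, of degree i'.\<close>
  define Q where "Q i i' j j' = alt (i' * j) (res_cross G H (c i j) (c' i' j'))" for i i' j j'
  have add: "additive (cyc_bd p T i)" "additive (cyc_bd p T' i)" "additive (cyc_bd p S i)"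
      "additive (cyc_bd p S' i)" for i
    by (rule additive_cyc_bd, rule X.T.additive_axioms X.S.T.additive_axioms Y.T.additive_axioms
        Y.S.T.additive_axioms)+
  have add_d: "additive (res_bd GH :: (_ \<Rightarrow>\<^sub>0 'k) \<Rightarrow> _)"
    by (rule additive_chain_linear[OF chain_linear_res(1)])
  have Q_chains: "Q i i' j j' \<in> res_chains GH (i + i' + j + j')" for i i' j j'
    using cross_chains[OF cp(1)[of i j] cp'(1)[of i' j']]
        by (simp add: Q_def add.commute add.left_commute)
  have Q_chains': "Q i (m - i) j j' \<in> res_chains GH (m + j + j')" if "i \<le> m" for i m j j'
    using Q_chains[of i "m - i" j j'] that by simp
  define RQ where "RQ i i' j j' = cyc_bd p S j (Q i i' (j - 1) j') + alt j
      (cyc_bd p S' j' (Q i i' j (j' - 1)))" for i i' j j'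
  \<comment> \<open>With this sign the boundary separates into a part in the first variable and a
    part in the second, which carries the sign of the total first degree. The summand 0 fits the
    shape of \<open>diag_op_alt\<close>.\<close>
  have dQ: "res_bd GH (Q i i' j j') =
      (cyc_bd p T i (Q (i - 1) i' j j') + alt i (cyc_bd p T' i' (Q i (i' - 1) j j')))
      + alt (i + i' + 0) (RQ i i' j j')" for i i' j j'
  proof -
    have "res_bd GH (Q i i' j j') = alt (i' * j)
        ((cyc_bd p T i (res_cross G H (c (i - 1) j) (c' i' j')) +
          alt i (cyc_bd p S j (res_cross G H (c i (j - 1)) (c' i' j')))) +
         alt (i + j) (cyc_bd p T' i' (res_cross G H (c i j) (c' (i' - 1) j')) +
          alt i' (cyc_bd p S' j' (res_cross G H (c i j) (c' i' (j' - 1))))))"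
      unfolding Q_def additive_alt[OF add_d] cross_bd[OF cp(1) cp'(1)] cp(2) cp'(2)
      by (simp add: cross_cyc_bd[OF carr(1) carr(3) cp(1) cp'(1)]
          cross_cyc_bd[OF carr(2) carr(4) cp(1) cp'(1)] TS_def
        additive_alt[OF additive_chain_linear[OF chain_linear_res_cross(1)]]
        additive_alt[OF additive_chain_linear[OF chain_linear_res_cross(2)]])
    then show ?thesis
      unfolding Q_def RQ_def additive_alt[OF add(1)] additive_alt[OF add(2)]
          additive_alt[OF add(3)] additive_alt[OF add(4)]
      by (cases i'; cases j; cases "even i"; cases "even (i' - 1)"; cases "even (j - 1)")
        (simp_all add: alt_def algebra_simps)
  qed
  \<comment> \<open>The diagonal in the first variable; the second variable is still split into j
    and j' and is treated by \<open>C\<close>.\<close>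
  define C1 where "C1 m j j' = X.diag_op m (\<lambda>i i'. Q i i' j j')" for m j j'
  define C where "C m n = Y.diag_op n (C1 m)" for m n
  have T_chains: "T x \<in> res_chains GH k" "T' x \<in> res_chains GH k"
    "S x \<in> res_chains GH k" "S' x \<in> res_chains GH k"
    "res_bd GH (T x) = T (res_bd GH x)" "res_bd GH (T' x) = T' (res_bd GH x)"
    "res_bd GH (S x) = S (res_bd GH x)" "res_bd GH (S' x) = S' (res_bd GH x)"
    if "x \<in> res_chains GH k" for x k
    using that carr unfolding TS_def by (simp_all add: GH.res_bd_act[where n = k])
  have pow_chains: "(T ^^ a) x \<in> res_chains GH k" "(T' ^^ a) x \<in> res_chains GH k"
    "(S ^^ a) x \<in> res_chains GH k" "(S' ^^ a) x \<in> res_chains GH k"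
    if "x \<in> res_chains GH k" for x k a
    using that by (induction a) (simp_all add: T_chains)
  have C1_chains: "C1 m j j' \<in> res_chains GH (m + j + j')" for m j j'
    unfolding C1_def X.diag_op_def X.diag_coeff_def
    using Q_chains' by (auto intro!: chains_on_sum T_chains pow_chains)
  have C1_chains': "C1 m j (n - j) \<in> res_chains GH (m + n)" if "j \<le> n" for m j n
    using C1_chains[of m j "n - j"] that by simp
  have C_chains: "C m n \<in> res_chains GH (m + n)" for m n
    unfolding C_def Y.diag_op_def Y.diag_coeff_def
    using C1_chains' by (auto intro!: chains_on_sum T_chains pow_chains)
  have dC1: "res_bd GH (C1 m j j') = cyc_bd p (T \<circ> T') m (C1 (m - 1) j j')
      + alt m (cyc_bd p S j (C1 m (j - 1) j') + alt j (cyc_bd p S' j' (C1 m j (j' - 1))))" for m j j'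
  proof -
    have "res_bd GH (C1 m j j') = X.diag_op m (\<lambda>i i'. res_bd GH (Q i i' j j'))"
      unfolding C1_def
      by (rule X.diag_op_commute_on[OF add_d, where M = "res_chains GH (m + j + j')"])
        (use Q_chains' in \<open>auto simp: T_chains\<close>)
    also have "\<dots> = cyc_bd p (T \<circ> T') m (C1 (m - 1) j j') + alt m (X.diag_op m (\<lambda>i i'. RQ i i' j j'))"
      unfolding dQ by (subst X.diag_op_add, unfold X.diag_op_alt
          X.diag_op_bd[of m "\<lambda>i i'. Q i i' j j'"] C1_def) simp
    also have "X.diag_op m (\<lambda>i i'. RQ i i' j j') =
        cyc_bd p S j (C1 m (j - 1) j') + alt j (cyc_bd p S' j' (C1 m j (j' - 1)))"
    proof -
      have *: "cyc_bd p S j (T x) = T (cyc_bd p S j x)" "cyc_bd p S j (T' x) = T' (cyc_bd p S j x)"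
        "cyc_bd p S' j (T x) = T (cyc_bd p S' j x)" "cyc_bd p S' j (T' x) = T' (cyc_bd p S' j x)"
            for x j
        by (simp_all add: cyc_bd_commute[OF X.T.additive_axioms]
            cyc_bd_commute[OF X.S.T.additive_axioms] commute)
      have "X.diag_op m (\<lambda>i i'. alt j (f i i')) = alt j (X.diag_op m f)" for f
        by (simp add: X.diag_op_def additive_alt[OF X.additive_diag_coeff] alt_sum)
      then show ?thesis
        unfolding RQ_def X.diag_op_add C1_def
        by (simp add: X.diag_op_commute[OF add(3) *(1,2)] X.diag_op_commute[OF add(4) *(3,4)])
    qed
    finally show ?thesis .
  qed
  have dC: "res_bd GH (C m n) = cyc_bd p (T \<circ> T') m (C (m - 1) n) + alt m
      (cyc_bd p (S \<circ> S') n (C m (n - 1)))" for m n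
  proof -
    have "res_bd GH (C m n) = Y.diag_op n (\<lambda>j j'. res_bd GH (C1 m j j'))"
      unfolding C_def
      by (rule Y.diag_op_commute_on[OF add_d, where M = "res_chains GH (m + n)"])
        (use C1_chains' in \<open>auto simp: T_chains\<close>)
    also have "\<dots> = Y.diag_op n (\<lambda>j j'. cyc_bd p (T \<circ> T') m (C1 (m - 1) j j')) +
        alt m (cyc_bd p (S \<circ> S') n (C m (n - 1)))"
    proof -
      have "Y.diag_op n (\<lambda>i i'. alt m (f i i')) = alt m (Y.diag_op n f)" for f
        by (simp add: Y.diag_op_def additive_alt[OF Y.additive_diag_coeff] alt_sum)
      then show ?thesis
        unfolding dC1 Y.diag_op_add C_def by (simp only: Y.diag_op_bd[of n "C1 m"])
    qed
    also have "Y.diag_op n (\<lambda>j j'. cyc_bd p (T \<circ> T') m (C1 (m - 1) j j')) = cyc_bd p (T \<circ> T') m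
        (C (m - 1) n)"
    proof -
      have TT: "additive (T \<circ> T')"
        by (simp add: additive_def X.T.add X.S.T.add)
      have "cyc_bd p (T \<circ> T') m (S x) = S (cyc_bd p (T \<circ> T') m x)"
        "cyc_bd p (T \<circ> T') m (S' x) = S' (cyc_bd p (T \<circ> T') m x)" for x
        by (simp_all add: cyc_bd_commute[OF Y.T.additive_axioms]
            cyc_bd_commute[OF Y.S.T.additive_axioms] commute)
      from Y.diag_op_commute[OF additive_cyc_bd[OF TT] this] show ?thesis
        by (simp add: C_def)
    qed
    finally show ?thesis .
  qed
  have coinv_TS: "coinv (T x) = coinv x" "coinv (T' x) = coinv x" "coinv (S x) = coinv x"
      "coinv (S' x) = coinv x"
    "coinv ((T ^^ a) x) = coinv x" "coinv ((T' ^^ a) x) = coinv x"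
    "coinv ((S ^^ a) x) = coinv x" "coinv ((S' ^^ a) x) = coinv x" for x a
    by (simp_all add: TS_def)
  have kap: "coinv (X.diag_coeff i j x) = chain_scale (kappa p i j) (coinv x)"
    "coinv (Y.diag_coeff i j x) = chain_scale (kappa p i j) (coinv x)" for i j x
    by (simp_all add: X.diag_coeff_def Y.diag_coeff_def kappa_def coinv_TS sum_const_chain
        chain_scale_distribs)
  have coinv_C: "coinv (C m n) = (\<Sum>j\<le>n. \<Sum>i\<le>m. chain_scale (kappa p i (m - i) * kappa p j (n - j))
       (alt ((m - i) * j) (bar_cross G H (coinv (c i j)) (coinv (c' (m - i) (n - j))))))" for m n
    by (simp add: C_def C1_def X.diag_op_def Y.diag_op_def kap Q_def chain_scale_distribs mult.commute
        additive_alt[OF additive_chain_linear[OF chain_linear_res(4)]] coinv_cross)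
  have "coinv (C 0 0) = gen []"
    using c c' by (simp add: coinv_C kappa_def bisequence_def bar_cross_gen)
  with dC C_chains have "bisequence GH p (t, t') (s, s') C"
    by (simp add: bisequence_def TT)
  with coinv_C show ?thesis using that by blast
qed

end

section \<open>Products in homology\<close>

text \<open>The degree involution. Chains of all degrees are collected in one module, so the sign in
  the Leibniz rule has to be a linear map rather than a power of -1.\<close>

definition sign_inv :: "('g list \<Rightarrow>\<^sub>0 'k) \<Rightarrow> 'g list \<Rightarrow>\<^sub>0 'k::comm_ring_1"
  where "sign_inv = lin_ext (\<lambda>gs. alt (length gs) (gen gs))"

lemma chain_linear_bar:
  "chain_linear (bar_bd G)" "chain_linear sign_inv"
  "chain_linear (\<lambda>a. bar_cross G H a b)" "chain_linear (bar_cross G H a)"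
proof -
  show "chain_linear (\<lambda>a. bar_cross G H a b)"
    unfolding bar_cross_def by (rule chain_linear_intros)
  show "chain_linear (bar_cross G H a)"
    unfolding bar_cross_def lin_ext_def[where c = a] by (intro chain_linear_intros)
qed (unfold bar_bd_def sign_inv_def, (rule chain_linear_intros)+)

lemmas bar_simps [simp] =
  chain_linear_simps[OF chain_linear_bar(1)] chain_linear_simps[OF chain_linear_bar(2)]
  chain_linear_simps[OF chain_linear_bar(3)] chain_linear_simps[OF chain_linear_bar(4)]

lemma bar_chains_eq: "bar_chains G = chains_on (lists (carrier G))"
  by (simp add: bar_chains_def chains_on_def)

lemma sign_inv_gen: "sign_inv (gen gs) = alt (length gs) (gen gs)"
  by (simp add: sign_inv_def)

lemma sign_inv_sign_inv: "sign_inv (sign_inv c) = c"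
  by (rule chain_linear_eqI[where c = c])
    (auto intro!: chain_linear_comp[OF chain_linear_bar(2)] chain_linear_bar chain_linear_id
        simp: sign_inv_gen alt_def)

lemma sign_inv_chains: "c \<in> bar_chains G \<Longrightarrow> sign_inv c \<in> bar_chains G"
  unfolding bar_chains_eq
  by (rule chain_linear_chains_on[OF chain_linear_bar(2)])
    (auto simp: sign_inv_gen intro!: chains_on_alt chains_on_gen)

lemma sign_inv_homogeneous:
  assumes "c \<in> chains_on {gs. length gs = n}" shows "sign_inv c = alt n c"
  by (rule chain_linear_eq_on[OF _ _ assms])
    (auto intro!: chain_linear_bar chain_linear_intros' simp: sign_inv_def)

context group begin

lemma bar_bd_gen: "bar_bd G (gen gs) = coinv (bar_res_bd G (\<one>, gs))"
  by (simp add: bar_bd_def coinv_def)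

lemma bar_bd_sign_inv:
  fixes c :: "'a list \<Rightarrow>\<^sub>0 'k::comm_ring_1"
  assumes "c \<in> bar_chains G" shows "bar_bd G (sign_inv c) = - sign_inv (bar_bd G c)"
proof (rule chain_linear_eq_on[OF _ _ assms[unfolded bar_chains_eq]])
  fix gs assume gs: "gs \<in> lists (carrier G)"
  show "bar_bd G (sign_inv (gen gs)) = - sign_inv (bar_bd G (gen gs :: _ \<Rightarrow>\<^sub>0 'k))"
  proof (cases gs)
    case Nil
    then show ?thesis by (simp add: sign_inv_def bar_bd_gen)
  next
    case (Cons x xs)
    with gs have "(bar_res_bd G (\<one>, gs) :: _ \<Rightarrow>\<^sub>0 'k) \<in> res_chains G (length xs)"
      by (auto intro!: bar_res_bd_chains)
    then have "bar_bd G (gen gs :: _ \<Rightarrow>\<^sub>0 'k) \<in> chains_on {gs. length gs = length xs}"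
      unfolding bar_bd_gen
      by (rule chain_linear_chains_on[OF chain_linear_res(4)]) auto
    from sign_inv_homogeneous[OF this] show ?thesis
      using Cons by (simp add: sign_inv_gen alt_def)
  qed
qed (auto intro!: chain_linear_comp[OF chain_linear_bar(1)] chain_linear_comp[OF chain_linear_bar(2)]
    chain_linear_bar chain_linear_uminus)

end

lemma bar_cycles_iff: "c \<in> bar_cycles G \<longleftrightarrow> c \<in> bar_chains G \<and> bar_bd G c = 0"
  by (simp add: bar_cycles_def)

context group_pair begin

lemma bar_cross_chains:
  assumes "a \<in> bar_chains G" "b \<in> bar_chains H"
  shows "bar_cross G H a b \<in> bar_chains GH"
proof -
  have *: "signed_shuffles (map (\<lambda>g. (g, \<one>\<^bsub>H\<^esub>)) gs) (map (\<lambda>h. (\<one>\<^bsub>G\<^esub>, h)) hs) \<in> bar_chains GH"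
    if "gs \<in> lists (carrier G)" "hs \<in> lists (carrier H)" for gs hs
    using signed_shuffles_chains[of "map (\<lambda>g. (g, \<one>\<^bsub>H\<^esub>)) gs" "carrier GH" "map (\<lambda>h. (\<one>\<^bsub>G\<^esub>, h)) hs"] that
    by (auto simp: bar_chains_eq chains_on_def)
  have "bar_cross G H (gen gs) b \<in> chains_on (lists (carrier GH))" if "gs \<in> lists (carrier G)" for gs
    by (rule chain_linear_chains_on[OF chain_linear_bar(4) assms(2)[unfolded bar_chains_eq]])
      (use *[OF that] in \<open>simp add: bar_cross_gen bar_chains_eq\<close>)
  then show ?thesis
    unfolding bar_chains_eq
    by (intro chain_linear_chains_on[OF chain_linear_bar(3) assms(1)[unfolded bar_chains_eq]])
qed

lemma bar_cross_bd:
  assumes "a \<in> bar_chains G" "b \<in> bar_chains H"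
  shows "bar_bd GH (bar_cross G H a b) =
    bar_cross G H (bar_bd G a) b + bar_cross G H (sign_inv a) (bar_bd H b)"
proof (rule chain_linear_eq_on2[OF _ _ _ _ assms[unfolded bar_chains_eq]])
  interpret GH: group GH by (rule group_prod)
  fix gs hs assume "gs \<in> lists (carrier G)" "hs \<in> lists (carrier H)"
  then have gs: "gen (\<one>\<^bsub>G\<^esub>, gs) \<in> res_chains G (length gs)" and hs:
      "gen (\<one>\<^bsub>H\<^esub>, hs) \<in> res_chains H (length hs)"
    by (auto intro!: chains_on_gen)
  have "bar_bd GH (bar_cross G H (gen gs) (gen hs)) =
      coinv (res_bd GH (res_cross G H (gen (\<one>\<^bsub>G\<^esub>, gs)) (gen (\<one>\<^bsub>H\<^esub>, hs))))"
    using GH.bar_bd_coinv[OF cross_chains[OF gs hs]] by (simp add: coinv_cross del: res_cross_gen)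
  also have "\<dots> = bar_cross G H (bar_bd G (gen gs)) (gen hs)
      + alt (length gs) (bar_cross G H (gen gs) (bar_bd H (gen hs)))"
    unfolding cross_bd[OF gs hs]
    by (simp add: coinv_cross additive_alt[OF additive_chain_linear[OF chain_linear_res(4)]]
        G.bar_bd_gen H.bar_bd_gen del: res_cross_gen)
  finally show "bar_bd GH (bar_cross G H (gen gs) (gen hs)) =
      bar_cross G H (bar_bd G (gen gs)) (gen hs) + bar_cross G H (sign_inv (gen gs))
          (bar_bd H (gen hs))"
    by (simp add: sign_inv_def additive_alt[OF additive_chain_linear[OF chain_linear_bar(3)]])
qed (intro chain_linear_add chain_linear_comp[OF chain_linear_bar(1)] chain_linear_bar
    chain_linear_comp[OF chain_linear_bar(3)] chain_linear_comp[OF chain_linear_bar(4)])+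

lemma bar_cross_cycles:
  "a \<in> bar_cycles G \<Longrightarrow> b \<in> bar_cycles H \<Longrightarrow> bar_cross G H a b \<in> bar_cycles GH"
  by (simp add: bar_cycles_iff bar_cross_chains bar_cross_bd)

lemma bar_cross_boundary_left:
  assumes "a \<in> bar_boundaries G" "b \<in> bar_cycles H"
  shows "bar_cross G H a b \<in> bar_boundaries GH"
proof -
  obtain a' where a': "a' \<in> bar_chains G" "a = bar_bd G a'"
    using assms(1) by (auto simp: bar_boundaries_def)
  have "bar_bd GH (bar_cross G H a' b) = bar_cross G H a b"
    using assms(2) a' by (simp add: bar_cycles_iff bar_cross_bd)
  then show ?thesis
    using bar_cross_chains[OF a'(1), of b] assms(2) unfolding bar_boundaries_def bar_cycles_iff
    by (metis imageI)
qed

lemma bar_cross_boundary_right: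
  assumes "a \<in> bar_cycles G" "b \<in> bar_boundaries H"
  shows "bar_cross G H a b \<in> bar_boundaries GH"
proof -
  obtain b' where b': "b' \<in> bar_chains H" "b = bar_bd H b'"
    using assms(2) by (auto simp: bar_boundaries_def)
  \<comment> \<open>Replacing \<open>a\<close> by \<open>sign_inv a\<close>, again a cycle, cancels
    the sign in the Leibniz rule.\<close>
  have "bar_bd GH (bar_cross G H (sign_inv a) b') = bar_cross G H a b"
    using assms(1) b'
    by (simp add: bar_cycles_iff bar_cross_bd sign_inv_chains G.bar_bd_sign_inv sign_inv_sign_inv)
  then show ?thesis
    using bar_cross_chains[OF sign_inv_chains b'(1), of a] assms(1)
    unfolding bar_boundaries_def bar_cycles_iff by (metis imageI)
qed

end

context
  fixes G :: "('g, 'm) monoid_scheme" and H :: "('h, 'n) monoid_scheme" and \<phi>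
  assumes G: "group G" and H: "group H" and \<phi>: "\<phi> \<in> hom G H"
begin

lemma bar_map_chains:
  assumes "c \<in> bar_chains G" shows "lin_map (map \<phi>) c \<in> bar_chains H"
  unfolding bar_chains_eq
  by (rule chain_linear_chains_on[OF chain_linear_lin_map assms[unfolded bar_chains_eq]])
    (use hom_in_carrier[OF \<phi>] in \<open>auto intro!: chains_on_gen\<close>)

lemma bar_map_bd:
  assumes "c \<in> bar_chains G"
  shows "bar_bd H (lin_map (map \<phi>) c) = lin_map (map \<phi>) (bar_bd G c)"
proof (rule chain_linear_eq_on[OF _ _ assms[unfolded bar_chains_eq]])
  interpret group_hom G H \<phi>
    using G H \<phi> by (simp add: group_hom_def group_hom_axioms_def)
  fix gs assume "gs \<in> lists (carrier G)"
  then have "set gs \<subseteq> carrier G" by auto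
  then show "bar_bd H (lin_map (map \<phi>) (gen gs)) = lin_map (map \<phi>) (bar_bd G (gen gs))"
    by (simp add: G.bar_bd_gen H.bar_bd_gen push_bar_res_bd[OF G H \<phi> G.one_closed] flip: coinv_push)
qed (intro chain_linear_comp[OF chain_linear_bar(1)] chain_linear_lin_map
    chain_linear_comp[OF chain_linear_lin_map] chain_linear_bar)+

lemma bar_map_cycles: "c \<in> bar_cycles G \<Longrightarrow> lin_map (map \<phi>) c \<in> bar_cycles H"
  by (simp add: bar_cycles_iff bar_map_chains bar_map_bd)

lemma bar_map_boundaries: "c \<in> bar_boundaries G \<Longrightarrow> lin_map (map \<phi>) c \<in> bar_boundaries H"
  unfolding bar_boundaries_def using bar_map_bd bar_map_chains by (auto intro!: image_eqI)

end

section \<open>Homology classes of the symmetric groups as a module\<close>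

lemma sym_homologous_refl_single:
  "z \<in> bar_cycles (sym_group k) \<Longrightarrow>
    sym_homologous (Poly_Mapping.single k z) (Poly_Mapping.single k z)"
  by (simp add: sym_homologous_def lookup_single when_def bar_cycles_closed bar_boundaries_closed)

lemma sym_class_eqI:
  assumes "z \<in> bar_cycles (sym_group k)" "w \<in> bar_cycles (sym_group k)"
    "z - w \<in> bar_boundaries (sym_group k)"
  shows "sym_class k z = sym_class k w"
proof -
  have "sym_homologous (Poly_Mapping.single k z) (Poly_Mapping.single k w)"
    using assms by (simp add: sym_homologous_def lookup_single when_def bar_cycles_closed
        bar_boundaries_closed)
  then show ?thesis
    unfolding sym_class_def by (rule Quotient_rel_abs[OF Quotient_sym_homology])
qed

lemma sym_class_add:
  assumes "z \<in> bar_cycles (sym_group k)" "w \<in> bar_cycles (sym_group k)"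
  shows "sym_class k (z + w) = sym_class k z + sym_class k w"
  unfolding sym_class_def single_add
  using assms by (simp add: plus_sym_homology.abs_eq sym_homologous_refl_single)

lemma sym_class_zero [simp]: "sym_class k 0 = 0"
  by (simp add: sym_class_def zero_sym_homology_def)

lemma sym_class_scale:
  assumes "z \<in> bar_cycles (sym_group k)"
  shows "sym_class k (chain_scale a z) = homology_scale a (sym_class k z)"
proof -
  have "Poly_Mapping.map (chain_scale a) (Poly_Mapping.single k z) = Poly_Mapping.single k
      (chain_scale a z)"
    by (rule poly_mapping_eqI) (simp add: Poly_Mapping.map.rep_eq lookup_single when_def)
  then show ?thesis
    unfolding sym_class_def
    using assms by (simp add: homology_scale.abs_eq sym_homologous_refl_single)
qed

lemma sym_class_sum:
  assumes "\<And>i. i \<in> A \<Longrightarrow> f i \<in> bar_cycles (sym_group k)"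
  shows "sym_class k (sum f A) = (\<Sum>i\<in>A. sym_class k (f i))"
proof -
  have "sym_class k (sum f A) = (\<Sum>i\<in>A. sym_class k (f i)) \<and> sum f A \<in> bar_cycles (sym_group k)"
    using assms
    by (induction A rule: infinite_finite_induct) (simp_all add: sym_class_add bar_cycles_closed)
  then show ?thesis by simp
qed

lemma module_homology_scale: "Modules.module (homology_scale :: 'k::comm_ring_1 \<Rightarrow> _)"
proof -
  have lookup: "Poly_Mapping.lookup (Poly_Mapping.map (chain_scale a) x) k
      = chain_scale a (Poly_Mapping.lookup x k)" for x :: "'k sym_chain" and k a
    by (auto simp: Poly_Mapping.map.rep_eq when_def)
  show ?thesis
  proof
    fix a b :: 'k and x y :: "'k sym_homology"
    show "homology_scale a (x + y) = homology_scale a x + homology_scale a y"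
      by transfer (simp add: sym_homologous_def lookup lookup_add chain_scale_distribs
          bar_cycles_closed bar_boundaries_closed)
    show "homology_scale (a + b) x = homology_scale a x + homology_scale b x"
      by transfer (simp add: sym_homologous_def lookup lookup_add chain_scale_distribs
          bar_cycles_closed bar_boundaries_closed)
    show "homology_scale a (homology_scale b x) = homology_scale (a * b) x"
      by transfer (simp add: sym_homologous_def lookup bar_cycles_closed bar_boundaries_closed)
    show "homology_scale 1 x = x"
      by transfer (simp add: sym_homologous_def lookup bar_cycles_closed bar_boundaries_closed)
  qed
qed

lemmas homology_scale_simps [simp] =
  Modules.module.scale_zero_left[OF module_homology_scale]
  Modules.module.scale_zero_right[OF module_homology_scale]
  Modules.module.scale_one[OF module_homology_scale]
  Modules.module.scale_scale[OF module_homology_scale]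
  Modules.module.scale_minus_left[OF module_homology_scale]
  Modules.module.scale_minus_right[OF module_homology_scale]

lemmas homology_scale_distribs =
  Modules.module.scale_right_distrib[OF module_homology_scale]
  Modules.module.scale_left_distrib[OF module_homology_scale]
  Modules.module.scale_right_diff_distrib[OF module_homology_scale]
  Modules.module.scale_left_diff_distrib[OF module_homology_scale]
  Modules.module.scale_sum_left[OF module_homology_scale]
  Modules.module.scale_sum_right[OF module_homology_scale]

section \<open>Well-definedness and bilinearity of the induced products\<close>

locale induced_product =
  fixes N :: "nat \<Rightarrow> nat \<Rightarrow> nat" and \<phi> :: "nat \<Rightarrow> nat \<Rightarrow> (nat \<Rightarrow> nat) \<times> (nat \<Rightarrow> nat) \<Rightarrow> nat \<Rightarrow> nat"
  assumes hom: "\<phi> m n \<in> hom (sym_group m \<times>\<times> sym_group n) (sym_group (N m n))"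
begin

definition chain_prod ::
  "nat \<Rightarrow> nat \<Rightarrow> ((nat \<Rightarrow> nat) list \<Rightarrow>\<^sub>0 'k) \<Rightarrow> ((nat \<Rightarrow> nat) list \<Rightarrow>\<^sub>0 'k) \<Rightarrow> (nat \<Rightarrow> nat) list \<Rightarrow>\<^sub>0
      'k::comm_ring_1"
  where "chain_prod m n a b = lin_map (map (\<phi> m n)) (bar_cross (sym_group m) (sym_group n) a b)"

lemma chain_prod_linear:
  "chain_linear (\<lambda>a. chain_prod m n a b)" "chain_linear (chain_prod m n a)"
  unfolding chain_prod_def
  by (intro chain_linear_comp[OF chain_linear_lin_map] chain_linear_bar)+

lemmas chain_prod_simps [simp] =
  chain_linear_simps[OF chain_prod_linear(1)] chain_linear_simps[OF chain_prod_linear(2)]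

lemma pair: "group_pair (sym_group m) (sym_group n)"
  by (simp add: group_pair_def sym_group_is_group)

lemma chain_prod_cycles:
  assumes "a \<in> bar_cycles (sym_group m)" "b \<in> bar_cycles (sym_group n)"
  shows "chain_prod m n a b \<in> bar_cycles (sym_group (N m n))"
  unfolding chain_prod_def
  by (intro bar_map_cycles[OF group_pair.group_prod[OF pair] sym_group_is_group hom]
      group_pair.bar_cross_cycles[OF pair] assms)

lemma chain_prod_boundaries:
  "a \<in> bar_boundaries (sym_group m) \<Longrightarrow> b \<in> bar_cycles (sym_group n) \<Longrightarrow>
    chain_prod m n a b \<in> bar_boundaries (sym_group (N m n))"
  "a \<in> bar_cycles (sym_group m) \<Longrightarrow> b \<in> bar_boundaries (sym_group n) \<Longrightarrow>
    chain_prod m n a b \<in> bar_boundaries (sym_group (N m n))"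
  unfolding chain_prod_def
  by (intro bar_map_boundaries[OF group_pair.group_prod[OF pair] sym_group_is_group hom]
      group_pair.bar_cross_boundary_left[OF pair] group_pair.bar_cross_boundary_right[OF pair];
          assumption)+

lemma sym_class_chain_prod_cong:
  assumes "a \<in> bar_cycles (sym_group m)" "a' \<in> bar_cycles (sym_group m)"
      "a - a' \<in> bar_boundaries (sym_group m)"
    "b \<in> bar_cycles (sym_group n)" "b' \<in> bar_cycles (sym_group n)"
        "b - b' \<in> bar_boundaries (sym_group n)"
  shows "sym_class (N m n) (chain_prod m n a b) = sym_class (N m n) (chain_prod m n a' b')"
proof (rule sym_class_eqI)
  have "chain_prod m n a b - chain_prod m n a' b' = chain_prod m n (a - a') b + chain_prod m n a'
      (b - b')"
    by simp
  then show "chain_prod m n a b - chain_prod m n a' b' \<in> bar_boundaries (sym_group (N m n))"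
    using assms by (simp only: bar_boundaries_closed(2) chain_prod_boundaries)
qed (use assms in \<open>simp_all add: chain_prod_cycles\<close>)

text \<open>The chosen representative of a class differs from the given one by a boundary in each
  component, and indices outside the support contribute 0. Hence every representative and all finite
  ranges containing its support may be used.\<close>

lemma induced_prod_abs:
  assumes a: "sym_homologous a a" and b: "sym_homologous b b" and fin: "finite A" "finite B"
    and A: "Poly_Mapping.keys a \<subseteq> A" and B: "Poly_Mapping.keys b \<subseteq> B"
  shows "induced_prod N \<phi> (abs_sym_homology a) (abs_sym_homology b) =
    (\<Sum>m\<in>A. \<Sum>n\<in>B. sym_class (N m n) (chain_prod m n (Poly_Mapping.lookup a m)
        (Poly_Mapping.lookup b n)))"
proof -
  define a' where "a' = rep_sym_homology (abs_sym_homology a)"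
  define b' where "b' = rep_sym_homology (abs_sym_homology b)"
  have a': "sym_homologous a' a" and b': "sym_homologous b' b"
    unfolding a'_def b'_def using a b by (auto intro: rep_abs_rsp_left[OF Quotient3_sym_homology])
  let ?A = "A \<union> Poly_Mapping.keys a'" and ?B = "B \<union> Poly_Mapping.keys b'"
  let ?f = "\<lambda>a b m n. sym_class (N m n) (chain_prod m n (Poly_Mapping.lookup a m)
      (Poly_Mapping.lookup b n))"
  have ext: "(\<Sum>m\<in>C. \<Sum>n\<in>D. ?f x y m n) = (\<Sum>m\<in>?A. \<Sum>n\<in>?B. ?f x y m n)"
    if "Poly_Mapping.keys x \<subseteq> C" "Poly_Mapping.keys y \<subseteq> D" "C \<subseteq> ?A" "D \<subseteq> ?B" for x y C D
  proof -
    have x0: "Poly_Mapping.lookup x i = 0" if "i \<notin> C" for i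
      using that \<open>Poly_Mapping.keys x \<subseteq> C\<close> by (auto simp: Poly_Mapping.in_keys_iff)
    have y0: "Poly_Mapping.lookup y i = 0" if "i \<notin> D" for i
      using that \<open>Poly_Mapping.keys y \<subseteq> D\<close> by (auto simp: Poly_Mapping.in_keys_iff)
    have "(\<Sum>m\<in>C. \<Sum>n\<in>D. ?f x y m n) = (\<Sum>m\<in>C. \<Sum>n\<in>?B. ?f x y m n)"
      by (rule sum.cong[OF refl], rule sum.mono_neutral_left)
        (use that(4) fin in \<open>auto simp: y0\<close>)
    also have "\<dots> = (\<Sum>m\<in>?A. \<Sum>n\<in>?B. ?f x y m n)"
      using that(3) fin by (intro sum.mono_neutral_left) (auto simp: x0)
    finally show ?thesis .
  qed
  have "induced_prod N \<phi> (abs_sym_homology a) (abs_sym_homology b) =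
      (\<Sum>m\<in>Poly_Mapping.keys a'. \<Sum>n\<in>Poly_Mapping.keys b'. ?f a' b' m n)"
    by (simp add: induced_prod_def Let_def a'_def b'_def chain_prod_def)
  also have "\<dots> = (\<Sum>m\<in>?A. \<Sum>n\<in>?B. ?f a' b' m n)"
    by (intro ext) auto
  also have "\<dots> = (\<Sum>m\<in>?A. \<Sum>n\<in>?B. ?f a b m n)"
    using a' b' unfolding sym_homologous_def by (intro sum.cong refl sym_class_chain_prod_cong) auto
  also have "\<dots> = (\<Sum>m\<in>A. \<Sum>n\<in>B. ?f a b m n)"
    by (intro ext[symmetric] A B) auto
  finally show ?thesis .
qed

lemma induced_prod_sym_class:
  assumes "a \<in> bar_cycles (sym_group m)" "b \<in> bar_cycles (sym_group n)"
  shows "induced_prod N \<phi> (sym_class m a) (sym_class n b) = sym_class (N m n) (chain_prod m n a b)"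
  using induced_prod_abs[OF assms[THEN sym_homologous_refl_single], of "{m}" "{n}"]
  by (simp add: sym_class_def)

lemma ex_rep:
  obtains a where "sym_homologous a a" "x = abs_sym_homology a"
  using Quotient_abs_rep[OF Quotient_sym_homology] Quotient_rep_reflp[OF Quotient_sym_homology] by metis

lemma induced_prod_add:
  "induced_prod N \<phi> (x + x') y = induced_prod N \<phi> x y + induced_prod N \<phi> x' y"
  "induced_prod N \<phi> y (x + x') = induced_prod N \<phi> y x + induced_prod N \<phi> y x'"
proof -
  obtain a where a: "sym_homologous a a" "x = abs_sym_homology a" by (rule ex_rep)
  obtain a' where a': "sym_homologous a' a'" "x' = abs_sym_homology a'" by (rule ex_rep)
  obtain b where b: "sym_homologous b b" "y = abs_sym_homology b" by (rule ex_rep)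
  have s: "x + x' = abs_sym_homology (a + a')"
    using a a' by (simp add: plus_sym_homology.abs_eq)
  have aa: "sym_homologous (a + a') (a + a')"
    using a(1) a'(1) by (simp add: sym_homologous_def lookup_add bar_cycles_closed
        bar_boundaries_closed)
  let ?A = "Poly_Mapping.keys a \<union> Poly_Mapping.keys a'" and ?B = "Poly_Mapping.keys b"
  have A: "Poly_Mapping.keys (a + a') \<subseteq> ?A" by (rule Poly_Mapping.keys_add)
  note cyc = a(1) a'(1) b(1)
  show "induced_prod N \<phi> (x + x') y = induced_prod N \<phi> x y + induced_prod N \<phi> x' y"
    unfolding s unfolding a(2) a'(2) b(2)
    using cyc
    by (simp add: induced_prod_abs[of _ _ ?A ?B] aa A sum.distrib[symmetric] lookup_add)
      (intro sum.cong refl sym_class_add chain_prod_cycles; simp add: sym_homologous_def)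
  show "induced_prod N \<phi> y (x + x') = induced_prod N \<phi> y x + induced_prod N \<phi> y x'"
    unfolding s unfolding a(2) a'(2) b(2)
    using cyc
    by (simp add: induced_prod_abs[of _ _ ?B ?A] aa A sum.distrib[symmetric] lookup_add)
      (intro sum.cong refl sym_class_add chain_prod_cycles; simp add: sym_homologous_def)
qed

lemma additive_induced_prod:
  "additive (\<lambda>x. induced_prod N \<phi> x y)" "additive (induced_prod N \<phi> y)"
  by (simp_all add: additive_def induced_prod_add)

end

section \<open>Permutation actions and the three products\<close>

lemma enumeration_bij:
  assumes "finite A" shows "bij_betw (enumeration A) A {1..card A}"
proof -
  have "\<exists>e. bij_betw e A {1..card A}"
    using assms bij_betw_iff_card[of A "{1..card A}"] by simp
  then show ?thesis
    unfolding enumeration_def by (rule someI_ex)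
qed

lemma to_sym_permutes:
  assumes "finite A" "bij_betw g A A" shows "to_sym A g permutes {1..card A}"
proof -
  note e = enumeration_bij[OF assms(1)]
  have "bij_betw (enumeration A \<circ> g \<circ> inv_into A (enumeration A)) {1..card A} {1..card A}"
    by (intro bij_betw_trans[of _ _ A] bij_betw_inv_into e assms(2))
  then have "bij_betw (to_sym A g) {1..card A} {1..card A}"
    by (rule bij_betw_cong[THEN iffD1, rotated]) (auto simp: to_sym_def)
  then show ?thesis
    by (rule bij_imp_permutes) (auto simp: to_sym_def)
qed

lemma to_sym_enumeration:
  assumes "finite A" "x \<in> A" shows "to_sym A g (enumeration A x) = enumeration A (g x)"
  using enumeration_bij[OF assms(1)] assms(2)
  by (auto simp: to_sym_def bij_betw_def)

text \<open>The common source of the three products: the actions on a product, on a disjoint sum and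
  on a set of functions.\<close>

lemma to_sym_hom:
  assumes "finite A" "group G"
    and closed: "\<And>g a. g \<in> carrier G \<Longrightarrow> a \<in> A \<Longrightarrow> \<alpha> g a \<in> A"
    and mult: "\<And>g h a. g \<in> carrier G \<Longrightarrow> h \<in> carrier G \<Longrightarrow> a \<in> A \<Longrightarrow> \<alpha> (g \<otimes>\<^bsub>G\<^esub> h) a = \<alpha> g (\<alpha> h a)"
    and one: "\<And>a. a \<in> A \<Longrightarrow> \<alpha> \<one>\<^bsub>G\<^esub> a = a"
  shows "(\<lambda>g. to_sym A (\<alpha> g)) \<in> hom G (sym_group (card A))"
proof -
  interpret group G by fact
  have bij: "bij_betw (\<alpha> g) A A" if "g \<in> carrier G" for g
    by (rule bij_betw_byWitness[of A "\<alpha> (inv\<^bsub>G\<^esub> g)"])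
      (use that closed one in \<open>auto simp flip: mult\<close>)
  have e: "inv_into A (enumeration A) i \<in> A" if "i \<in> {1..card A}" for i
    using bij_betw_apply[OF bij_betw_inv_into[OF enumeration_bij[OF assms(1)]] that] .
  have "to_sym A (\<alpha> (g \<otimes>\<^bsub>G\<^esub> h)) = to_sym A (\<alpha> g) \<circ> to_sym A (\<alpha> h)" if gh: "g \<in> carrier G"
      "h \<in> carrier G" for g h
  proof
    fix i
    show "to_sym A (\<alpha> (g \<otimes>\<^bsub>G\<^esub> h)) i = (to_sym A (\<alpha> g) \<circ> to_sym A (\<alpha> h)) i"
    proof (cases "i \<in> {1..card A}")
      case True
      then show ?thesis
        using to_sym_enumeration[OF assms(1) closed[OF gh(2) e[OF True]], of "\<alpha> g"]
            mult[OF gh e[OF True]]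
        by (simp add: to_sym_def[of _ _ i])
    qed (auto simp: to_sym_def)
  qed
  then show ?thesis
    using bij to_sym_permutes[OF assms(1)] by (auto simp: hom_def sym_group_def)
qed

lemma sym_group_simps [simp]:
  "g \<in> carrier (sym_group n) \<longleftrightarrow> g permutes {1..n}" "g \<otimes>\<^bsub>sym_group n\<^esub> h = g \<circ> h" "\<one>\<^bsub>sym_group n\<^esub> = id"
  by (simp_all add: sym_group_def)

lemma sym_pair_group: "group (sym_group m \<times>\<times> sym_group n)"
  by (simp add: DirProd_group sym_group_is_group)

lemma permutes_bounds:
  "x permutes {Suc 0..k} \<Longrightarrow> Suc 0 \<le> j \<Longrightarrow> j \<le> k \<Longrightarrow> Suc 0 \<le> x j \<and> x j \<le> k"
  using permutes_in_image[of x "{Suc 0..k}" j] by simp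

interpretation circ: induced_product "\<lambda>m n. m * n" times_hom
proof
  fix m n :: nat
  have "(\<lambda>g. to_sym ({1..m} \<times> {1..n}) (case g of (\<sigma>, \<tau>) \<Rightarrow> map_prod \<sigma> \<tau>))
      \<in> hom (sym_group m \<times>\<times> sym_group n) (sym_group (card ({1..m} \<times> {1..n})))"
    by (rule to_sym_hom) (auto simp: sym_pair_group one_DirProd permutes_bounds)
  then show "times_hom m n \<in> hom (sym_group m \<times>\<times> sym_group n) (sym_group (m * n))"
    by (simp add: times_hom_def split_def)
qed

interpretation dot: induced_product "\<lambda>m n. m + n" plus_hom
proof
  fix m n :: nat
  have "(\<lambda>g. to_sym ({1..m} <+> {1..n}) (case g of (\<sigma>, \<tau>) \<Rightarrow> map_sum \<sigma> \<tau>))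
      \<in> hom (sym_group m \<times>\<times> sym_group n) (sym_group (card ({1..m} <+> {1..n})))"
    by (rule to_sym_hom) (auto simp: sym_pair_group one_DirProd permutes_bounds)
  then show "plus_hom m n \<in> hom (sym_group m \<times>\<times> sym_group n) (sym_group (m + n))"
    by (simp add: plus_hom_def split_def card_Plus)
qed

text \<open>Precomposition reverses the order of composition; the inverse of \<sigma> turns it back
  into a left action.\<close>

lemma power_action_mult:
  assumes "\<sigma> permutes {1..m}" "\<sigma>' permutes {1..m}"
  shows "(\<lambda>j\<in>{1..m}. (\<tau> \<circ> \<tau>') (f (inv' (\<sigma> \<circ> \<sigma>') j))) =
    (\<lambda>j\<in>{1..m}. \<tau> ((\<lambda>j\<in>{1..m}. \<tau>' (f (inv' \<sigma>' j))) (inv' \<sigma> j)))"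
proof -
  have "inv' (\<sigma> \<circ> \<sigma>') = inv' \<sigma>' \<circ> inv' \<sigma>"
    using assms by (simp add: o_inv_distrib permutes_bij)
  then show ?thesis
    using permutes_in_image[OF permutes_inv[OF assms(1)]] by (auto simp: restrict_def fun_eq_iff)
qed

interpretation sharp: induced_product "\<lambda>m n. n ^ m" power_hom
proof
  fix m n :: nat
  let ?F = "{1..m} \<rightarrow>\<^sub>E {1..n}"
  have *: "x permutes {1..k} \<Longrightarrow> j \<in> {1..k} \<Longrightarrow> x j \<in> {1..k}" for x and j k :: nat
    by (simp only: permutes_in_image)
  have "(\<lambda>g. to_sym ?F (case g of (\<sigma>, \<tau>) \<Rightarrow> \<lambda>f. \<lambda>j\<in>{1..m}. \<tau> (f (inv' \<sigma> j))))
      \<in> hom (sym_group m \<times>\<times> sym_group n) (sym_group (card ?F))"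
  proof (rule to_sym_hom)
    show "finite ?F" by (simp add: finite_PiE)
  next
    fix g f assume g: "g \<in> carrier (sym_group m \<times>\<times> sym_group n)" and f: "f \<in> ?F"
    obtain \<sigma> \<tau> where [simp]: "g = (\<sigma>, \<tau>)" by (cases g)
    have "\<tau> (f (inv' \<sigma> j)) \<in> {1..n}" if "j \<in> {1..m}" for j
    proof -
      have "inv' \<sigma> j \<in> {1..m}"
        using g that by (intro *[of "inv' \<sigma>"] permutes_inv) auto
      then show ?thesis
        using g f by (intro *[of \<tau>]) auto
    qed
    then show "(case g of (\<sigma>, \<tau>) \<Rightarrow> \<lambda>f. \<lambda>j\<in>{1..m}. \<tau> (f (inv' \<sigma> j))) f \<in> ?F"
      by auto
  next
    fix g h f assume "g \<in> carrier (sym_group m \<times>\<times> sym_group n)"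
        "h \<in> carrier (sym_group m \<times>\<times> sym_group n)"
    then show "(case g \<otimes>\<^bsub>sym_group m \<times>\<times> sym_group n\<^esub> h of (\<sigma>, \<tau>) \<Rightarrow> \<lambda>f. \<lambda>j\<in>{1..m}. \<tau> (f (inv' \<sigma> j))) f =
        (case g of (\<sigma>, \<tau>) \<Rightarrow> \<lambda>f. \<lambda>j\<in>{1..m}. \<tau> (f (inv' \<sigma> j)))
          ((case h of (\<sigma>, \<tau>) \<Rightarrow> \<lambda>f. \<lambda>j\<in>{1..m}. \<tau> (f (inv' \<sigma> j))) f)"
      using power_action_mult[of "fst g" m "fst h" "snd g" "snd h" f]
      by (cases g; cases h) simp
  next
    fix f assume "f \<in> ?F"
    then show "(case \<one>\<^bsub>sym_group m \<times>\<times> sym_group n\<^esub> of (\<sigma>, \<tau>) \<Rightarrow> \<lambda>f. \<lambda>j\<in>{1..m}. \<tau> (f (inv' \<sigma> j))) f = f"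
      by (simp add: one_DirProd PiE_restrict)
  qed (rule sym_pair_group)
  then show "power_hom m n \<in> hom (sym_group m \<times>\<times> sym_group n) (sym_group (n ^ m))"
    by (simp add: power_hom_def split_def card_funcsetE)
qed

section \<open>Classes realised by actions of the square of a cyclic group\<close>

lemma (in group) bisequence_cycles:
  assumes "of_nat p = (0::'k::comm_ring_1)" "cyclic_pair G p t s" "bisequence G p t s c"
  shows "coinv (c m n :: _ \<Rightarrow>\<^sub>0 'k) \<in> bar_cycles G"
proof -
  have c: "c m n \<in> res_chains G (m + n)"
    using assms(3) by (simp add: bisequence_def)
  then have "bar_bd G (coinv (c m n)) = 0"
    using assms(1,3)
    by (simp add: bar_bd_coinv[OF c] bisequence_def
        additive_alt[OF additive_chain_linear[OF chain_linear_res(4)]])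
  with c show ?thesis
    by (simp add: bar_cycles_iff coinv_chains)
qed

text \<open>The commuting permutations \<open>\<tau>\<close> and \<open>\<sigma>\<close> of \<open>A\<close>, of order dividing \<open>p\<close>, define a
  homomorphism from the square of the cyclic group to the symmetric group; \<open>X m n\<close> is the image
  of the cross product of the standard classes of degrees \<open>m\<close> and \<open>n\<close>.\<close>

definition realizes ::
  "nat \<Rightarrow> 'a set \<Rightarrow> ('a \<Rightarrow> 'a) \<Rightarrow> ('a \<Rightarrow> 'a) \<Rightarrow> (nat \<Rightarrow> nat \<Rightarrow> 'k::comm_ring_1 sym_homology) \<Rightarrow> bool"
  where "realizes p A \<tau> \<sigma> X \<longleftrightarrow> finite A \<and> (\<exists>\<beta> t s c.
    bij_betw \<beta> A {1..card A} \<and> cyclic_pair (sym_group (card A)) p t s \<and>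
    bisequence (sym_group (card A)) p t s c \<and>
    (\<forall>a\<in>A. \<tau> a \<in> A \<and> \<sigma> a \<in> A \<and> t (\<beta> a) = \<beta> (\<tau> a) \<and> s (\<beta> a) = \<beta> (\<sigma> a)) \<and>
    (\<forall>m n. X m n = sym_class (card A) (coinv (c m n))))"

lemma realizesI:
  assumes "finite A" "K = card A" "bij_betw \<beta> A {1..K}" "cyclic_pair (sym_group K) p t s"
    "bisequence (sym_group K) p t s c"
    "\<And>a. a \<in> A \<Longrightarrow> \<tau> a \<in> A" "\<And>a. a \<in> A \<Longrightarrow> \<sigma> a \<in> A"
    "\<And>a. a \<in> A \<Longrightarrow> t (\<beta> a) = \<beta> (\<tau> a)" "\<And>a. a \<in> A \<Longrightarrow> s (\<beta> a) = \<beta> (\<sigma> a)"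
    "\<And>m n. X m n = sym_class K (coinv (c m n))"
  shows "realizes p A \<tau> \<sigma> X"
  unfolding realizes_def using assms by blast

lemma realizesE:
  assumes "realizes p A \<tau> \<sigma> X"
  obtains \<beta> t s c where "finite A" "bij_betw \<beta> A {1..card A}" "cyclic_pair (sym_group (card A)) p t s"
    "bisequence (sym_group (card A)) p t s c"
    "\<And>a. a \<in> A \<Longrightarrow> \<tau> a \<in> A" "\<And>a. a \<in> A \<Longrightarrow> \<sigma> a \<in> A"
    "\<And>a. a \<in> A \<Longrightarrow> t (\<beta> a) = \<beta> (\<tau> a)" "\<And>a. a \<in> A \<Longrightarrow> s (\<beta> a) = \<beta> (\<sigma> a)"
    "\<And>m n. X m n = sym_class (card A) (coinv (c m n))"
  using assms unfolding realizes_def by blast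

text \<open>Two numberings of \<open>A\<close> differ by a permutation, which conjugates one pair of
  permutations into the other. Conjugation preserves the classes, and a pair determines them; so
  they depend only on the set with its action. The identities will follow by realizing the same set
  in two ways.\<close>

lemma realizes_unique:
  fixes X X' :: "nat \<Rightarrow> nat \<Rightarrow> 'k::comm_ring_1 sym_homology"
  assumes p: "of_nat p = (0::'k)" and X: "realizes p A \<tau> \<sigma> X" and X': "realizes p A \<tau> \<sigma> X'"
  shows "X = X'"
proof -
  let ?K = "card A"
  interpret G: group "sym_group ?K" by (rule sym_group_is_group)
  from X obtain \<beta> t s c where "finite A" and \<beta>: "bij_betw \<beta> A {1..?K}" and ts:
      "cyclic_pair (sym_group ?K) p t s"
    and c: "bisequence (sym_group ?K) p t s c" and closed: "\<And>a. a \<in> A \<Longrightarrow> \<tau> a \<in> A" "\<And>a. a \<in> A \<Longrightarrow> \<sigma> a \<in> A"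
    and \<beta>': "\<And>a. a \<in> A \<Longrightarrow> t (\<beta> a) = \<beta> (\<tau> a)" "\<And>a. a \<in> A \<Longrightarrow> s (\<beta> a) = \<beta> (\<sigma> a)"
    and Xc: "\<And>m n. X m n = sym_class ?K (coinv (c m n))"
    by (elim realizesE) blast
  from X' obtain \<gamma> t' s' c' where \<gamma>: "bij_betw \<gamma> A {1..?K}" and ts':
      "cyclic_pair (sym_group ?K) p t' s'"
    and c': "bisequence (sym_group ?K) p t' s' c'"
    and \<gamma>': "\<And>a. a \<in> A \<Longrightarrow> t' (\<gamma> a) = \<gamma> (\<tau> a)" "\<And>a. a \<in> A \<Longrightarrow> s' (\<gamma> a) = \<gamma> (\<sigma> a)"
    and Xc': "\<And>m n. X' m n = sym_class ?K (coinv (c' m n))"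
    by (elim realizesE) blast
  define g where "g i = (if i \<in> {1..?K} then \<gamma> (inv_into A \<beta> i) else i)" for i
  have g\<beta>: "g (\<beta> a) = \<gamma> a" if "a \<in> A" for a
    using that \<beta> bij_betw_apply[OF \<beta> that] by (auto simp: g_def bij_betw_inv_into_left)
  have "bij_betw (\<gamma> \<circ> inv_into A \<beta>) {1..?K} {1..?K}"
    by (rule bij_betw_trans[OF bij_betw_inv_into[OF \<beta>] \<gamma>])
  then have "bij_betw g {1..?K} {1..?K}"
    by (rule bij_betw_cong[THEN iffD1, rotated]) (auto simp: g_def)
  then have g: "g permutes {1..?K}"
    by (rule bij_imp_permutes) (auto simp: g_def)
  have conj: "t' \<circ> g = g \<circ> t"
    if "t permutes {1..?K}" "t' permutes {1..?K}" "\<And>a. a \<in> A \<Longrightarrow> t (\<beta> a) = \<beta> (\<tau> a)"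
      "\<And>a. a \<in> A \<Longrightarrow> t' (\<gamma> a) = \<gamma> (\<tau> a)" "\<And>a. a \<in> A \<Longrightarrow> \<tau> a \<in> A" for t t' \<tau>
  proof
    fix i
    show "(t' \<circ> g) i = (g \<circ> t) i"
    proof (cases "i \<in> {1..?K}")
      case True
      then obtain a where "a \<in> A" "i = \<beta> a"
        using \<beta> True unfolding bij_betw_def by blast
      then show ?thesis
        using that by (simp add: g\<beta>)
    next
      case False
      then show ?thesis
        using that(1,2) g by (metis comp_apply permutes_not_in)
    qed
  qed
  have tc: "t permutes {1..?K}" "s permutes {1..?K}" "t' permutes {1..?K}" "s' permutes {1..?K}"
    using ts ts' by (auto simp: cyclic_pair_def)
  have "bisequence (sym_group ?K) p t' s' (\<lambda>m n. res_act (sym_group ?K) g (c m n))"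
    by (rule G.bisequence_conj[OF _ _ _ _ _ _ _ c])
      (use g tc conj[OF tc(1,3) \<beta>'(1) \<gamma>'(1) closed(1)] conj[OF tc(2,4) \<beta>'(2) \<gamma>'(2) closed(2)]
          in simp_all)
  from G.bisequence_unique[OF p ts' this c']
  have "sym_class ?K (coinv (c m n)) = sym_class ?K (coinv (c' m n))" for m n
    by (intro sym_class_eqI G.bisequence_cycles[OF p ts c] G.bisequence_cycles[OF p ts' c']) simp
  then show ?thesis
    by (simp add: fun_eq_iff Xc Xc')
qed

text \<open>The coproduct of the homology of \<pi> \<times> \<pi> followed by juxtaposition:
  \<open>kappa\<close> gives the structure constants of the diagonal, and the sign comes from
  interchanging two middle factors.\<close>

definition conv ::
  "nat \<Rightarrow> (nat \<Rightarrow> nat \<Rightarrow> 'k sym_homology) \<Rightarrow> (nat \<Rightarrow> nat \<Rightarrow> 'k sym_homology) \<Rightarrow> nat \<Rightarrow> nat \<Rightarrow>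
      'k::comm_ring_1 sym_homology"
  where "conv p X Y m n = (\<Sum>j\<le>n. \<Sum>i\<le>m. homology_scale (kappa p i (m - i) * kappa p j (n - j))
    (alt ((m - i) * j) (dot_prod (X i j) (Y (m - i) (n - j)))))"

lemma alt_bar_cycles: "c \<in> bar_cycles G \<Longrightarrow> alt n c \<in> bar_cycles G"
  by (simp add: alt_def bar_cycles_closed)

lemma sym_class_alt:
  "z \<in> bar_cycles (sym_group k) \<Longrightarrow> sym_class k (alt n z) = alt n (sym_class k z)"
  using sym_class_scale[of z k "- 1"] by (simp add: alt_def chain_scale_minus_one)

lemma sum_bar_cycles: "(\<And>i. i \<in> A \<Longrightarrow> f i \<in> bar_cycles G) \<Longrightarrow> sum f A \<in> bar_cycles G"
  by (induction A rule: infinite_finite_induct) (simp_all add: bar_cycles_closed)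

lemma group_pair_sym: "group_pair (sym_group m) (sym_group n)"
  by (simp add: group_pair_def sym_group_is_group)

lemma cyclic_pair_prod:
  assumes "group G" "group H" "cyclic_pair G p t s" "cyclic_pair H p t' s'"
  shows "cyclic_pair (G \<times>\<times> H) p (t, t') (s, s')"
proof -
  have "(g, h) [^]\<^bsub>G \<times>\<times> H\<^esub> (n::nat) = (g [^]\<^bsub>G\<^esub> n, h [^]\<^bsub>H\<^esub> n)" for g h n
    by (induction n) (simp_all add: one_DirProd)
  then show ?thesis
    using assms by (simp add: cyclic_pair_def)
qed

text \<open>On a disjoint union the action factors through the juxtaposition homomorphism and the
  diagonal, so the classes are those of \<open>bisequence_product\<close> pushed forward along
  \<open>plus_hom\<close>.\<close>

lemma realizes_union:
  fixes X Y :: "nat \<Rightarrow> nat \<Rightarrow> 'k::comm_ring_1 sym_homology"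
  assumes p: "of_nat p = (0::'k)" and X: "realizes p A \<tau> \<sigma> X" and Y: "realizes p B \<tau> \<sigma> Y"
    and disj: "A \<inter> B = {}"
  shows "realizes p (A \<union> B) \<tau> \<sigma> (conv p X Y)"
proof -
  let ?K = "card A" and ?L = "card B"
  let ?G = "sym_group ?K" and ?H = "sym_group ?L"
  interpret G: group ?G by (rule sym_group_is_group)
  interpret H: group ?H by (rule sym_group_is_group)
  interpret P: group_pair ?G ?H by (rule group_pair_sym)
  from X obtain \<beta> t s c where finA: "finite A" and \<beta>: "bij_betw \<beta> A {1..?K}" and ts:
      "cyclic_pair ?G p t s"
    and c: "bisequence ?G p t s c" and closedA: "\<And>a. a \<in> A \<Longrightarrow> \<tau> a \<in> A" "\<And>a. a \<in> A \<Longrightarrow> \<sigma> a \<in> A"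
    and \<beta>': "\<And>a. a \<in> A \<Longrightarrow> t (\<beta> a) = \<beta> (\<tau> a)" "\<And>a. a \<in> A \<Longrightarrow> s (\<beta> a) = \<beta> (\<sigma> a)"
    and Xc: "\<And>m n. X m n = sym_class ?K (coinv (c m n))"
    by (elim realizesE) blast
  from Y obtain \<gamma> t' s' c' where finB: "finite B" and \<gamma>: "bij_betw \<gamma> B {1..?L}" and ts':
      "cyclic_pair ?H p t' s'"
    and c': "bisequence ?H p t' s' c'" and closedB: "\<And>a. a \<in> B \<Longrightarrow> \<tau> a \<in> B" "\<And>a. a \<in> B \<Longrightarrow> \<sigma> a \<in> B"
    and \<gamma>': "\<And>a. a \<in> B \<Longrightarrow> t' (\<gamma> a) = \<gamma> (\<tau> a)" "\<And>a. a \<in> B \<Longrightarrow> s' (\<gamma> a) = \<gamma> (\<sigma> a)"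
    and Yc: "\<And>m n. Y m n = sym_class ?L (coinv (c' m n))"
    by (elim realizesE) blast
  from P.bisequence_product[OF ts ts' c c'] obtain C where C:
      "bisequence (?G \<times>\<times> ?H) p (t, t') (s, s') C"
    and coinv_C: "\<And>m n. coinv (C m n) = (\<Sum>j\<le>n. \<Sum>i\<le>m. chain_scale (kappa p i (m - i) * kappa p j (n - j))
       (alt ((m - i) * j) (bar_cross ?G ?H (coinv (c i j)) (coinv (c' (m - i) (n - j))))))"
    by blast
  have tts: "cyclic_pair (?G \<times>\<times> ?H) p (t, t') (s, s')"
    by (rule cyclic_pair_prod[OF G.group_axioms H.group_axioms ts ts'])
  let ?\<phi> = "plus_hom ?K ?L" and ?U = "{1..?K} <+> {1..?L}"
  have cardU: "card ?U = ?K + ?L"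
    by (simp add: card_Plus)
  have fin: "finite ?U" by simp
  have cyc: "coinv (c i j) \<in> bar_cycles ?G" "coinv (c' i j) \<in> bar_cycles ?H" for i j
    by (rule G.bisequence_cycles[OF p ts c], rule H.bisequence_cycles[OF p ts' c'])
  let ?z = "\<lambda>m n i j. dot.chain_prod ?K ?L (coinv (c i j)) (coinv (c' (m - i) (n - j)))"
  have zcyc: "?z m n i j \<in> bar_cycles (sym_group (?K + ?L))" for m n i j
    by (intro dot.chain_prod_cycles cyc)
  have "sym_class (?K + ?L) (coinv (push ?\<phi> (C m n))) = conv p X Y m n" for m n
  proof -
    have "coinv (push ?\<phi> (C m n)) = (\<Sum>j\<le>n. \<Sum>i\<le>m. chain_scale (kappa p i (m - i) * kappa p j (n - j))
        (alt ((m - i) * j) (?z m n i j)))"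
      by (simp add: coinv_push coinv_C dot.chain_prod_def
          additive_alt[OF additive_chain_linear[OF chain_linear_lin_map]])
    then show ?thesis
      by (simp add: sym_class_sum sym_class_scale sym_class_alt zcyc alt_bar_cycles bar_cycles_closed
          sum_bar_cycles conv_def Xc Yc dot_prod_def dot.induced_prod_sym_class cyc)
  qed
  note cls = this
  let ?\<delta> = "\<lambda>a. enumeration ?U (if a \<in> A then Inl (\<beta> a) else Inr (\<gamma> a))"
  have "bij_betw (\<lambda>a. if a \<in> A then Inl (\<beta> a) else Inr (\<gamma> a)) (A \<union> B) ?U"
  proof -
    have "bij_betw (\<lambda>a. if a \<in> A then Inl (\<beta> a) else Inr (\<gamma> a)) A (Inl ` {1..?K})"
      using \<beta> by (auto simp: bij_betw_def inj_on_def image_iff)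
    moreover have "bij_betw (\<lambda>a. if a \<in> A then Inl (\<beta> a) else Inr (\<gamma> a)) B (Inr ` {1..?L})"
    proof -
      have "bij_betw (\<lambda>a. Inr (\<gamma> a)) B (Inr ` {1..?L})"
        using \<gamma> by (auto simp: bij_betw_def inj_on_def image_iff)
      then show ?thesis
        by (rule bij_betw_cong[THEN iffD1, rotated]) (use disj in auto)
    qed
    ultimately show ?thesis
      unfolding Plus_def by (rule bij_betw_combine) auto
  qed
  from bij_betw_trans[OF this enumeration_bij[OF fin]]
  have \<delta>: "bij_betw ?\<delta> (A \<union> B) {1..?K + ?L}"
    unfolding comp_def cardU .
  have memU: "Inl (\<beta> a) \<in> ?U" if "a \<in> A" for a
    using bij_betw_apply[OF \<beta> that] by (intro InlI)
  have memU': "Inr (\<gamma> a) \<in> ?U" if "a \<in> B" for a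
    using bij_betw_apply[OF \<gamma> that] by (intro InrI)
  have notA: "a \<notin> A" if "a \<in> B" for a
    using that disj by auto
  show ?thesis
  proof (rule realizesI[OF _ _ \<delta>])
    show "card A + card B = card (A \<union> B)"
      using finA finB disj by (simp add: card_Un_disjoint)
    show "cyclic_pair (sym_group (?K + ?L)) p (?\<phi> (t, t')) (?\<phi> (s, s'))"
      by (rule cyclic_pair_hom[OF P.group_prod sym_group_is_group dot.hom tts])
    show "bisequence (sym_group (?K + ?L)) p (?\<phi> (t, t')) (?\<phi> (s, s')) (\<lambda>m n. push ?\<phi> (C m n))"
      by (rule bisequence_push[OF P.group_prod sym_group_is_group dot.hom tts C])
    show "?\<phi> (t, t') (?\<delta> a) = ?\<delta> (\<tau> a)" "?\<phi> (s, s') (?\<delta> a) = ?\<delta> (\<sigma> a)" if "a \<in> A \<union> B" for a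
      using that memU memU' notA closedA closedB
      by (auto simp: plus_hom_def to_sym_enumeration[OF fin] \<beta>' \<gamma>'
          simp del: atLeastAtMost_iff One_nat_def)
  qed (use finA finB closedA closedB cls in auto)
qed

lemma realizes_empty:
  assumes p: "of_nat p = (0::'k::comm_ring_1)"
  shows "realizes p {} \<tau> \<sigma> (\<lambda>m n. if m = 0 \<and> n = 0 then point_class 0 else (0 :: 'k sym_homology))"
proof -
  interpret G: group "sym_group 0" by (rule sym_group_is_group)
  have id_mem: "id \<in> carrier (sym_group 0)" by (simp add: permutes_id)
  have pow: "id [^]\<^bsub>sym_group 0\<^esub> n = id" for n :: nat
    using G.nat_pow_one by simp
  have "cyclic_pair (sym_group 0) p id id"
    using id_mem pow by (simp add: cyclic_pair_def)
  moreover have "bisequence (sym_group 0) p id id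
      (\<lambda>m n. if n = 0 then if m = 0 then gen (id, []) else 0 else (0 :: _ \<Rightarrow>\<^sub>0 'k))"
    using G.sequence_bisequence[OF p _ G.trivial_sequence[OF p]]
        by (simp add: permutes_id cong: if_cong)
  ultimately show ?thesis
    by (intro realizesI[of _ 0 "\<lambda>_. 0"]) (auto simp: point_class_def bij_betw_def)
qed

section \<open>The cyclic group in the symmetric group\<close>

definition rot :: "nat \<Rightarrow> nat \<Rightarrow> nat"
  where "rot p = cycle_of_list [1..<Suc p]"

lemma rot_permutes: "rot p permutes {1..p}"
  using cycle_permutes[of "[1..<Suc p]"]
  by (simp add: rot_def atLeastLessThanSuc_atLeastAtMost del: upt_Suc)

lemma rot_pow_permutes: "(rot p ^^ k) permutes {1..p}"
  by (rule permutes_funpow[OF rot_permutes])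

lemmas rot_permutes_simps [simp] = rot_permutes[simplified] rot_pow_permutes[simplified]

text \<open>The point \<open>Suc i\<close> stands for the residue i, so that rotation becomes
  addition of residues.\<close>

lemma rot_pow:
  assumes "i < p" shows "(rot p ^^ k) (Suc i) = Suc ((k + i) mod p)"
proof -
  let ?cs = "[1..<Suc p]"
  have "map (rot p ^^ k) ?cs ! i = rotate k ?cs ! i"
    using cyclic_rotation[of ?cs k] by (simp add: rot_def del: upt_Suc)
  then show ?thesis
    using assms by (simp add: nth_rotate nth_append del: upt_Suc)
qed

lemma rot_pow_p: "rot p ^^ p = id"
proof
  fix i
  show "(rot p ^^ p) i = id i"
  proof (cases "i \<in> {1..p}")
    case True
    then obtain y where "i = Suc y" "y < p"
      by (cases i) auto
    then show ?thesis
      by (simp add: rot_pow)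
  next
    case False
    then show ?thesis
      using permutes_not_in[OF rot_pow_permutes] by simp
  qed
qed

lemma rot_pow_mod: "rot p ^^ (k mod p) = rot p ^^ k"
proof -
  have "rot p ^^ (k div p * p + k mod p) = (rot p ^^ p) ^^ (k div p) \<circ> rot p ^^ (k mod p)"
    by (simp only: funpow_add funpow_mult mult.commute)
  then show ?thesis
    by (simp add: rot_pow_p id_funpow)
qed

lemma rot_pow_fixpoint:
  assumes "x \<in> {1..p}" "a \<le> b" "(rot p ^^ a) x = (rot p ^^ b) x" shows "p dvd (b - a)"
proof -
  obtain y where "x = Suc y" "y < p"
    using assms(1) by (cases x) auto
  then have "(a + y) mod p = (b + y) mod p"
    using assms(3) by (simp add: rot_pow)
  then show ?thesis
    using assms(2) mod_eq_dvd_iff_nat[of "a + y" "b + y" p]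
        by (metis add_le_cancel_right add_diff_cancel_right)
qed

lemma sym_group_pow: "x [^]\<^bsub>sym_group n\<^esub> (k::nat) = x ^^ k"
  by (induction k) (simp_all add: funpow_swap1 fun_eq_iff sym_group_def nat_pow_def)

lemma rot_cyclic_pair: "cyclic_pair (sym_group p) p (rot p) id"
    "cyclic_pair (sym_group p) p (rot p ^^ k) (rot p)"
proof -
  have "(rot p ^^ k) ^^ p = id"
    by (metis funpow_mult mult.commute rot_pow_p id_funpow)
  then show "cyclic_pair (sym_group p) p (rot p) id" "cyclic_pair (sym_group p) p (rot p ^^ k) (rot p)"
    by (simp_all add: cyclic_pair_def sym_group_pow rot_permutes rot_pow_permutes rot_pow_p
        permutes_id id_funpow fun_eq_iff funpow_swap1)
qed

text \<open>Each generator is the cone over its prescribed boundary. The contraction recovers this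
  boundary, which is a cycle in positive degree and has augmentation 0 in degree 0.\<close>

lemma std_res_sequence:
  assumes p: "p > 1" "of_nat p = (0::'k::comm_ring_1)"
  shows "cyclic_sequence (integer_mod_group p) p 1 (std_res p :: nat \<Rightarrow> _ \<Rightarrow>\<^sub>0 'k)"
proof -
  let ?Z = "integer_mod_group p"
  interpret Z: group ?Z by simp
  have one: "1 \<in> carrier ?Z"
    using p by (simp add: carrier_integer_mod_group)
  define T where "T = (res_act ?Z 1 :: (_ \<Rightarrow>\<^sub>0 'k) \<Rightarrow> _)"
  have pow: "1 [^]\<^bsub>?Z\<^esub> (k::nat) = int k mod int p" for k
    using one by simp
  interpret cyclic_operator T p
    unfolding T_def by (rule Z.res_act_cyclic_operator[OF one]) (simp add: pow)
  have act: "cyc_act p k c = (T ^^ k) c" if "c \<in> res_chains ?Z n" "k < p" for k c n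
  proof -
    have "cyc_act p k c = res_act ?Z (1 [^]\<^bsub>?Z\<^esub> k) c"
      by (rule chain_linear_eq_on[OF _ _ that(1)])
        (use that(2) in \<open>auto intro!: chain_linear_intros' simp: cyc_act_def cells_def pow zmod_int\<close>)
    then show ?thesis
      by (simp add: T_def Z.res_act_pow[OF one])
  qed
  have "(std_res p n :: _ \<Rightarrow>\<^sub>0 'k) \<in> res_chains ?Z n \<and> res_bd ?Z (std_res p n) = cyc_bd p T n
      (std_res p (n - 1) :: _ \<Rightarrow>\<^sub>0 'k)" for n
  proof (induction n)
    case 0
    show ?case using p by (auto intro!: chains_on_gen simp: carrier_integer_mod_group cells_def)
  next
    case (Suc n)
    let ?y = "cyc_bd p T (Suc n) (std_res p n) :: _ \<Rightarrow>\<^sub>0 'k"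
    have n: "(std_res p n :: _ \<Rightarrow>\<^sub>0 'k) \<in> res_chains ?Z n" using Suc by simp
    have y: "?y \<in> res_chains ?Z n"
      unfolding T_def by (rule Z.cyc_bd_chains[OF one n])
    have "std_res p (Suc n) = cone \<one>\<^bsub>?Z\<^esub> ?y"
      using act[OF n] act[OF n, of 1] p(1) by (simp add: cone_def cyc_bd_def)
    moreover have "res_bd ?Z (cone \<one>\<^bsub>?Z\<^esub> ?y) = ?y"
    proof (cases n)
      case 0
      then show ?thesis
        using y Z.res_bd_cone_0[of ?y] coinv_cyc_bd[OF p(2), of ?Z 1 "Suc n"] by (simp add: T_def)
    next
      case (Suc m)
      have "res_bd ?Z ?y = cyc_bd p T (Suc n) (res_bd ?Z (std_res p n))"
        unfolding T_def by (rule Z.res_bd_cyc_bd[OF one n])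
      also have "\<dots> = 0"
        using Suc.IH cyc_bd_square[of "Suc n"] by simp
      finally show ?thesis
        using y Z.res_bd_cone[of ?y m] Suc by simp
    qed
    ultimately show ?case
      using Z.cone_chains[OF Z.one_closed y] by simp
  qed
  then show ?thesis
    by (simp add: cyclic_sequence_def T_def)
qed

definition cyc_seq :: "nat \<Rightarrow> nat \<Rightarrow> ((nat \<Rightarrow> nat) \<times> (nat \<Rightarrow> nat) list) \<Rightarrow>\<^sub>0 'k::comm_ring_1"
  where "cyc_seq p n = push (\<lambda>k. rot p ^^ nat k) (std_res p n)"

lemma cyc_class_eq: "cyc_class p n = sym_class p (coinv (cyc_seq p n))"
  by (simp add: cyc_class_def cyc_seq_def coinv_push rot_def del: upt_Suc) (simp add: coinv_def)

lemma cyc_seq_sequence: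
  assumes p: "p > 1" "of_nat p = (0::'k::comm_ring_1)"
  shows "cyclic_sequence (sym_group p) p (rot p) (cyc_seq p :: nat \<Rightarrow> _ \<Rightarrow>\<^sub>0 'k)"
proof -
  have "(\<lambda>k. rot p ^^ nat k) \<in> hom (integer_mod_group p) (sym_group p)"
  proof (rule homI)
    fix x y assume "x \<in> carrier (integer_mod_group p)" "y \<in> carrier (integer_mod_group p)"
    then obtain a b where "x = int a" "y = int b"
      using p by (auto simp: carrier_integer_mod_group elim!: nonneg_int_cases)
    then show "rot p ^^ nat (x \<otimes>\<^bsub>integer_mod_group p\<^esub> y) = rot p ^^ nat x \<otimes>\<^bsub>sym_group p\<^esub> rot p ^^ nat y"
      by (simp add: rot_pow_mod funpow_add flip: of_nat_add zmod_int)
  qed (simp add: rot_pow_permutes)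
  from sequence_push[OF group_integer_mod_group sym_group_is_group this _ std_res_sequence[OF p]]
      show ?thesis
    using p by (simp add: cyc_seq_def[abs_def] carrier_integer_mod_group)
qed

lemma cyc_seq_cycles:
  assumes p: "p > 1" "of_nat p = (0::'k::comm_ring_1)"
  shows "coinv (cyc_seq p n :: _ \<Rightarrow>\<^sub>0 'k) \<in> bar_cycles (sym_group p)"
proof -
  interpret G: group "sym_group p" by (rule sym_group_is_group)
  have "rot p \<in> carrier (sym_group p)" by (simp add: rot_permutes)
  from G.bisequence_cycles[OF p(2) rot_cyclic_pair(1), of _ n 0]
    G.sequence_bisequence[OF p(2) this cyc_seq_sequence[OF p]]
  show ?thesis by fastforce
qed

text \<open>The classes of the homomorphism that sends \<open>(a, b)\<close> to \<open>k a + b\<close>.\<close>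

definition power_classes :: "nat \<Rightarrow> nat \<Rightarrow> nat \<Rightarrow> nat \<Rightarrow> 'k::comm_ring_1 sym_homology"
  where "power_classes p k m n = (if odd m \<and> odd n then 0 else
    homology_scale (of_nat (k ^ ((m + 1) div 2) * ((m div 2 + n div 2) choose (m div 2))))
        (cyc_class p (m + n)))"

lemma power_classes_bisequence:
  assumes p: "p > 1" "of_nat p = (0::'k::comm_ring_1)"
  obtains c where "bisequence (sym_group p) p (rot p ^^ k) (rot p) c"
    "\<And>m n. sym_class p (coinv (c m n)) = (power_classes p k m n :: 'k sym_homology)"
proof -
  interpret G: group "sym_group p" by (rule sym_group_is_group)
  have rot: "rot p \<in> carrier (sym_group p)" "rot p [^]\<^bsub>sym_group p\<^esub> p = \<one>\<^bsub>sym_group p\<^esub>"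
    by (simp_all add: rot_permutes sym_group_pow rot_pow_p)
  note * = G.power_bisequence[OF rot cyc_seq_sequence[OF p], of k, unfolded sym_group_pow]
  show ?thesis
  proof (rule that[OF *])
    fix m n
    \<comment> \<open>For odd m the partial norm acts on coinvariants as multiplication by k; this
      extra factor raises the exponent \<open>m div 2\<close> to
      \<open>(m + 1) div 2\<close>.\<close>
    have "(of_nat k :: 'k) ^ (m div 2) * of_nat k = of_nat k ^ ((m + 1) div 2)" if "odd m"
      using that by (auto elim!: oddE)
    moreover have "(m + 1) div 2 = m div 2" if "even m"
      using that by (auto elim!: evenE)
    ultimately show "sym_class p (coinv (if odd m \<and> odd n then 0 else
        chain_scale (of_nat (k ^ (m div 2) * ((m div 2 + n div 2) choose (m div 2))))
         (if odd m then \<Sum>b<k. (res_act (sym_group p) (rot p) ^^ b) (cyc_seq p (m + n)) else cyc_seq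
             p (m + n))))
      = (power_classes p k m n :: 'k sym_homology)"
      by (auto simp: power_classes_def sum_const_chain sym_class_scale bar_cycles_closed
          cyc_seq_cycles[OF p]
          cyc_class_eq ac_simps simp flip: mult.assoc)
  qed
qed

text \<open>Multiplication by a unit \<open>u\<close> on the cyclic group is induced by conjugation in the symmetric
  group, but acts on the standard classes through powers of \<open>u\<close>.\<close>

lemma cyc_class_unit:
  assumes p: "p > 1" "of_nat p = (0::'k::comm_ring_1)" and u: "coprime u p"
  shows "homology_scale (of_nat (u ^ ((n + 1) div 2))) (cyc_class p n) =
      (cyc_class p n :: 'k sym_homology)"
proof -
  interpret G: group "sym_group p" by (rule sym_group_is_group)
  \<comment> \<open>Multiplication by u on the residues i - 1; it conjugates the rotation into its
    u-th power.\<close>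
  define g where "g i = (if i \<in> {1..p} then Suc (u * (i - 1) mod p) else i)" for i
  have "inj_on (\<lambda>i. Suc (u * (i - 1) mod p)) {1..p}"
  proof (rule inj_onI)
    fix i j assume ij: "i \<in> {1..p}" "j \<in> {1..p}" "Suc (u * (i - 1) mod p) = Suc (u * (j - 1) mod p)"
    then have "[u * (i - 1) = u * (j - 1)] (mod p)"
      by (simp add: cong_def)
    then have "[i - 1 = j - 1] (mod p)"
      using u by (simp add: cong_mult_lcancel_nat)
    then show "i = j"
      using ij cong_less_modulus_unique_nat[of "i - 1" "j - 1" p] by simp linarith
  qed
  moreover have "(\<lambda>i. Suc (u * (i - 1) mod p)) ` {1..p} \<subseteq> {1..p}"
    using p(1) by (auto simp: Suc_le_eq)
  ultimately have "bij_betw (\<lambda>i. Suc (u * (i - 1) mod p)) {1..p} {1..p}"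
    by (simp add: bij_betw_def endo_inj_surj)
  then have "bij_betw g {1..p} {1..p}"
    by (rule bij_betw_cong[THEN iffD1, rotated]) (auto simp: g_def)
  then have g: "g permutes {1..p}"
    by (rule bij_imp_permutes) (auto simp: g_def)
  have conj: "(rot p ^^ u) \<circ> g = g \<circ> rot p"
  proof
    fix i
    show "((rot p ^^ u) \<circ> g) i = (g \<circ> rot p) i"
    proof (cases "i \<in> {1..p}")
      case True
      then obtain j where j: "i = Suc j" "j < p" by (cases i) auto
      have "(u + u * j mod p) mod p = u * (Suc j mod p) mod p"
        by (simp add: mod_simps)
      then show ?thesis
        using j rot_pow[of j p 1] rot_pow[of "u * j mod p" p u] p(1) by (simp add: g_def Suc_le_eq)
    next
      case False
      then show ?thesis
        using g by (metis comp_apply permutes_not_in rot_permutes rot_pow_permutes)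
    qed
  qed
  have rot: "rot p \<in> carrier (sym_group p)" "rot p ^^ u \<in> carrier (sym_group p)"
      "g \<in> carrier (sym_group p)"
    "id \<in> carrier (sym_group p)"
    using g by (simp_all add: permutes_id)
  have "bisequence (sym_group p) p (rot p) id (\<lambda>m n. if n = 0 then cyc_seq p m else (0 :: _ \<Rightarrow>\<^sub>0 'k))"
    using G.sequence_bisequence[OF p(2) rot(1) cyc_seq_sequence[OF p]] by simp
  from G.bisequence_conj[OF rot(3,1,4,2,4) _ _ this]
  have 1: "bisequence (sym_group p) p (rot p ^^ u) id
      (\<lambda>m n. res_act (sym_group p) g (if n = 0 then cyc_seq p m else (0 :: _ \<Rightarrow>\<^sub>0 'k)))"
    using conj by simp
  obtain c where c: "bisequence (sym_group p) p (rot p ^^ u) (rot p) c"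
    "\<And>m n. sym_class p (coinv (c m n)) = (power_classes p u m n :: 'k sym_homology)"
    using power_classes_bisequence[OF p, of u] by blast
  \<comment> \<open>The explicit family for multiplication by u belongs to the same pair as the
    conjugated standard family; its coefficients are the powers of u in the claim.\<close>
  have 2: "bisequence (sym_group p) p (rot p ^^ u) id (\<lambda>m n. if n = 0 then c m 0 else 0)"
    using G.sequence_bisequence[OF p(2) rot(2) G.bisequence_sequence[OF c(1)]] by simp
  have ts: "cyclic_pair (sym_group p) p (rot p ^^ u) id"
    using rot_cyclic_pair(2)[of p u] rot(4) by (simp add: cyclic_pair_def sym_group_pow id_funpow)
  have "sym_class p (coinv (cyc_seq p n)) = sym_class p (coinv (c n 0))"
    by (rule sym_class_eqI)
      (use G.bisequence_cycles[OF p(2) ts 1, where m = n and n = 0]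
          G.bisequence_cycles[OF p(2) ts 2, where m = n and n = 0]
        G.bisequence_unique[OF p(2) ts 1 2, where m = n and n = 0] in simp_all)
  then show ?thesis
    by (simp add: c(2) power_classes_def cyc_class_eq)
qed

section \<open>Actions that realize the sharp and circle products\<close>

lemma pow_DirProd: "(g, h) [^]\<^bsub>G \<times>\<times> H\<^esub> (n::nat) = (g [^]\<^bsub>G\<^esub> n, h [^]\<^bsub>H\<^esub> n)"
  by (induction n) (simp_all add: one_DirProd)

text \<open>The left-hand sides of the identities: the two cyclic factors act on functions by
  rotation of the argument and of the value.\<close>

lemma realizes_sharp:
  assumes p: "p > 1" "of_nat p = (0::'k::comm_ring_1)"
  shows "realizes p ({1..p} \<rightarrow>\<^sub>E {1..p}) (\<lambda>f. \<lambda>j\<in>{1..p}. f (inv' (rot p) j)) (\<lambda>f. \<lambda>j\<in>{1..p}. rot p (f j))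
    (\<lambda>m n. sharp_prod (cyc_class p m) (cyc_class p n) :: 'k sym_homology)"
proof -
  let ?G = "sym_group p" and ?F = "{1..p} \<rightarrow>\<^sub>E {1..p}"
  interpret G: group ?G by (rule sym_group_is_group)
  interpret P: group_pair ?G ?G by (rule group_pair_sym)
  have rot: "rot p \<in> carrier ?G" by simp
  have cardF: "card ?F = p ^ p" by (simp add: card_funcsetE)
  have finF: "finite ?F" by (simp add: finite_PiE)
  have pair: "cyclic_pair (?G \<times>\<times> ?G) p (rot p, id) (id, rot p)"
    using cyclic_pair_prod[OF G.group_axioms G.group_axioms rot_cyclic_pair(1) rot_cyclic_pair(1)]
      cyclic_pair_prod[OF G.group_axioms G.group_axioms rot_cyclic_pair(1) rot_cyclic_pair(1)]
    by (simp add: cyclic_pair_def pow_DirProd sym_group_pow id_funpow rot_pow_p permutes_id one_DirProd)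
  have bi: "bisequence (?G \<times>\<times> ?G) p (rot p, id) (id, rot p)
      (\<lambda>m n. res_cross ?G ?G (cyc_seq p m) (cyc_seq p n :: _ \<Rightarrow>\<^sub>0 'k))"
    using P.cross_sequences[OF rot rot cyc_seq_sequence[OF p] cyc_seq_sequence[OF p]] by simp
  show ?thesis
  proof (rule realizesI[OF finF cardF[symmetric]])
    show "bij_betw (enumeration ?F) ?F {1..p ^ p}"
      using enumeration_bij[OF finF] unfolding cardF .
    show "cyclic_pair (sym_group (p ^ p)) p (power_hom p p (rot p, id)) (power_hom p p (id, rot p))"
      by (rule cyclic_pair_hom[OF P.group_prod sym_group_is_group sharp.hom pair])
    show "bisequence (sym_group (p ^ p)) p (power_hom p p (rot p, id)) (power_hom p p (id, rot p))
        (\<lambda>m n. push (power_hom p p) (res_cross ?G ?G (cyc_seq p m) (cyc_seq p n :: _ \<Rightarrow>\<^sub>0 'k)))"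
      by (rule bisequence_push[OF P.group_prod sym_group_is_group sharp.hom pair bi])
    show "sharp_prod (cyc_class p m) (cyc_class p n) = sym_class (p ^ p)
        (coinv (push (power_hom p p) (res_cross ?G ?G (cyc_seq p m) (cyc_seq p n :: _ \<Rightarrow>\<^sub>0 'k))))"
            for m n
      by (simp add: sharp_prod_def cyc_class_eq sharp.induced_prod_sym_class cyc_seq_cycles[OF p]
          coinv_push coinv_cross sharp.chain_prod_def)
    have inv_mem: "inv' (rot p) j \<in> {1..p}" if "j \<in> {1..p}" for j
      using that permutes_in_image[OF permutes_inv[OF rot_permutes]] by metis
    have mem: "rot p j \<in> {1..p}" if "j \<in> {1..p}" for j
      using that permutes_in_image[OF rot_permutes] by metis
    fix f assume f: "f \<in> ?F"
    then show "(\<lambda>j\<in>{1..p}. f (inv' (rot p) j)) \<in> ?F" "(\<lambda>j\<in>{1..p}. rot p (f j)) \<in> ?F"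
      using inv_mem mem by (auto simp del: atLeastAtMost_iff)
    show "power_hom p p (rot p, id) (enumeration ?F f) = enumeration ?F (\<lambda>j\<in>{1..p}. f (inv' (rot p) j))"
      "power_hom p p (id, rot p) (enumeration ?F f) = enumeration ?F (\<lambda>j\<in>{1..p}. rot p (f j))"
      using f by (simp_all add: power_hom_def to_sym_enumeration[OF finF] del: One_nat_def)
  qed
qed

text \<open>The map \<gamma> identifies \<open>A\<close> with N copies of the regular \<pi> \<times>
  \<pi>-set, and the iterated circle product is defined by the action on just this product of three
  sets.\<close>

lemma realizes_circ:
  assumes p: "p > 1" "of_nat p = (0::'k::comm_ring_1)"
    and \<gamma>: "bij_betw \<gamma> ({1..N} \<times> {1..p} \<times> {1..p}) A"
    and \<tau>: "\<And>r i j. r \<in> {1..N} \<Longrightarrow> i \<in> {1..p} \<Longrightarrow> j \<in> {1..p} \<Longrightarrow> \<tau> (\<gamma> (r, i, j)) = \<gamma> (r, rot p i, j)"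
    and \<sigma>: "\<And>r i j. r \<in> {1..N} \<Longrightarrow> i \<in> {1..p} \<Longrightarrow> j \<in> {1..p} \<Longrightarrow> \<sigma> (\<gamma> (r, i, j)) = \<gamma> (r, i, rot p j)"
  shows "realizes p A \<tau> \<sigma>
    (\<lambda>m n. circ_prod (circ_prod (point_class N) (cyc_class p m)) (cyc_class p n) :: 'k sym_homology)"
proof -
  let ?G = "sym_group p" and ?H = "sym_group N" and ?K = "sym_group (N * p)"
  interpret G: group ?G by (rule sym_group_is_group)
  interpret H: group ?H by (rule sym_group_is_group)
  interpret K: group ?K by (rule sym_group_is_group)
  interpret HG: group_pair ?H ?G by (rule group_pair_sym)
  interpret KG: group_pair ?K ?G by (rule group_pair_sym)
  have rot: "rot p \<in> carrier ?G" by simp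
  have idrot: "(id, rot p) \<in> carrier (?H \<times>\<times> ?G)" by (simp add: permutes_id)
  define t1 where "t1 = times_hom N p (id, rot p)"
  define e1 where "e1 m = push (times_hom N p) (res_cross ?H ?G (gen (id, []))
      (cyc_seq p m :: _ \<Rightarrow>\<^sub>0 'k))" for m
  have "cyclic_sequence (?H \<times>\<times> ?G) p (id, rot p) (\<lambda>m. res_cross ?H ?G (gen (id, []))
      (cyc_seq p m :: _ \<Rightarrow>\<^sub>0 'k))"
    using HG.point_cross_sequence[OF rot cyc_seq_sequence[OF p]] by simp
  from sequence_push[OF HG.group_prod K.group_axioms circ.hom idrot this]
  have e1: "cyclic_sequence ?K p t1 e1"
    by (simp add: t1_def e1_def[abs_def])
  have "cyclic_pair (?H \<times>\<times> ?G) p (id, rot p) (id, id)"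
    using rot_cyclic_pair(1)[of p]
    by (simp add: cyclic_pair_def pow_DirProd sym_group_pow id_funpow rot_pow_p permutes_id one_DirProd)
  from cyclic_pair_hom[OF HG.group_prod K.group_axioms circ.hom this]
  have t1: "t1 \<in> carrier ?K" "t1 ^^ p = id"
    by (simp_all add: cyclic_pair_def t1_def sym_group_pow)
  have pair: "cyclic_pair (?K \<times>\<times> ?G) p (t1, id) (id, rot p)"
    using t1 by (simp add: cyclic_pair_def pow_DirProd sym_group_pow id_funpow rot_pow_p
        permutes_id one_DirProd)
  define c where "c m n = res_cross ?K ?G (e1 m) (cyc_seq p n)" for m n
  have bi: "bisequence (?K \<times>\<times> ?G) p (t1, id) (id, rot p) c"
    using KG.cross_sequences[OF t1(1) rot e1 cyc_seq_sequence[OF p]] by (simp add: c_def[abs_def])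
  let ?U = "{1..N} \<times> {1..p}" and ?V = "{1..N * p} \<times> {1..p}"
  have fin: "finite ?U" "finite ?V" by simp_all
  have eU: "bij_betw (enumeration ?U) ?U {1..N * p}" and eV:
      "bij_betw (enumeration ?V) ?V {1..N * p * p}"
    using enumeration_bij[OF fin(1)] enumeration_bij[OF fin(2)] by simp_all
  let ?e = "\<lambda>(r, i, j). enumeration ?V (enumeration ?U (r, i), j)"
  have b1: "bij_betw (\<lambda>(r, i, j). ((r, i), j)) ({1..N} \<times> {1..p} \<times> {1..p}) (?U \<times> {1..p})"
    by (rule bij_betwI[where g = "\<lambda>((r, i), j). (r, i, j)"]) auto
  have b2: "bij_betw (map_prod (enumeration ?U) id) (?U \<times> {1..p}) ?V"
    by (rule bij_betw_map_prod[OF eU]) simp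
  have "bij_betw (enumeration ?V \<circ> (map_prod (enumeration ?U) id \<circ> (\<lambda>(r, i, j). ((r, i), j))))
      ({1..N} \<times> {1..p} \<times> {1..p}) {1..N * p * p}"
    by (rule bij_betw_trans[OF bij_betw_trans[OF b1 b2] eV])
  also have "enumeration ?V \<circ> (map_prod (enumeration ?U) id \<circ> (\<lambda>(r, i, j). ((r, i), j))) = ?e"
    by auto
  finally have e: "bij_betw ?e ({1..N} \<times> {1..p} \<times> {1..p}) {1..N * p * p}" .
  define \<delta> where "\<delta> = inv_into ({1..N} \<times> {1..p} \<times> {1..p}) \<gamma>"
  have \<delta>: "bij_betw \<delta> A ({1..N} \<times> {1..p} \<times> {1..p})"
    unfolding \<delta>_def by (rule bij_betw_inv_into[OF \<gamma>])
  have \<delta>\<gamma>: "\<delta> (\<gamma> x) = x" if "x \<in> {1..N} \<times> {1..p} \<times> {1..p}" for x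
    unfolding \<delta>_def by (rule bij_betw_inv_into_left[OF \<gamma> that])
  have mem: "rot p j \<in> {1..p}" if "j \<in> {1..p}" for j
    using that permutes_in_image[OF rot_permutes] by metis
  have \<gamma>_mem: "\<gamma> x \<in> A" if "x \<in> {1..N} \<times> {1..p} \<times> {1..p}" for x
    by (rule bij_betw_apply[OF \<gamma> that])
  have cardA: "N * p * p = card A"
    using bij_betw_same_card[OF \<gamma>] by simp
  have finA: "finite A"
    using bij_betw_finite[OF \<gamma>] by simp
  have t1_act: "t1 (enumeration ?U (r, i)) = enumeration ?U (r, rot p i)" if "(r, i) \<in> ?U" for r i
    using to_sym_enumeration[OF fin(1) that] by (simp add: t1_def times_hom_def)
  have eU_mem: "enumeration ?U x \<in> {1..N * p}" if "x \<in> ?U" for x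
    by (rule bij_betw_apply[OF eU that])
  show ?thesis
  proof (rule realizesI[OF finA cardA bij_betw_trans[OF \<delta> e]])
    show "cyclic_pair (sym_group (N * p * p)) p (times_hom (N * p) p (t1, id))
        (times_hom (N * p) p (id, rot p))"
      by (rule cyclic_pair_hom[OF KG.group_prod sym_group_is_group circ.hom pair])
    show "bisequence (sym_group (N * p * p)) p (times_hom (N * p) p (t1, id))
        (times_hom (N * p) p (id, rot p))
        (\<lambda>m n. push (times_hom (N * p) p) (c m n))"
      by (rule bisequence_push[OF KG.group_prod sym_group_is_group circ.hom pair bi])
    have point: "gen [] \<in> bar_cycles ?H"
      by (simp add: bar_cycles_iff bar_chains_eq bar_bd_def chains_on_gen)
    show "circ_prod (circ_prod (point_class N) (cyc_class p m)) (cyc_class p n) =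
        sym_class (N * p * p) (coinv (push (times_hom (N * p) p) (c m n)))" for m n
    proof -
      have "circ_prod (point_class N) (cyc_class p m) = sym_class (N * p) (coinv (e1 m))"
        unfolding circ_prod_def point_class_def cyc_class_eq
        by (simp add: circ.induced_prod_sym_class[OF point cyc_seq_cycles[OF p]] e1_def coinv_push
            coinv_cross circ.chain_prod_def)
      moreover have "coinv (e1 m) \<in> bar_cycles ?K"
        using circ.chain_prod_cycles[OF point cyc_seq_cycles[OF p]]
        by (simp add: e1_def coinv_push coinv_cross circ.chain_prod_def)
      ultimately show ?thesis
        by (simp add: cyc_class_eq circ_prod_def circ.induced_prod_sym_class cyc_seq_cycles[OF p]
            c_def coinv_push coinv_cross circ.chain_prod_def)
    qed
    fix a assume "a \<in> A"
    then obtain r i j where x: "(r, i, j) \<in> {1..N} \<times> {1..p} \<times> {1..p}" and a: "a = \<gamma> (r, i, j)"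
      using \<gamma> unfolding bij_betw_def by fastforce
    then have rij: "r \<in> {1..N}" "i \<in> {1..p}" "j \<in> {1..p}" by auto
    have \<tau>a: "\<tau> a = \<gamma> (r, rot p i, j)" and \<sigma>a: "\<sigma> a = \<gamma> (r, i, rot p j)"
      using \<tau>[OF rij] \<sigma>[OF rij] a by simp_all
    have y: "(r, rot p i, j) \<in> {1..N} \<times> {1..p} \<times> {1..p}" "(r, i, rot p j) \<in> {1..N} \<times> {1..p} \<times> {1..p}"
      using rij mem by auto
    show "\<tau> a \<in> A" "\<sigma> a \<in> A"
      unfolding \<tau>a \<sigma>a using y by (simp_all only: \<gamma>_mem)
    have V: "(enumeration ?U (r, i), j) \<in> ?V"
      using rij eU_mem[of "(r, i)"] by blast
    have U: "(r, i) \<in> ?U" using rij by blast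
    show "times_hom (N * p) p (t1, id) ((?e \<circ> \<delta>) a) = (?e \<circ> \<delta>) (\<tau> a)"
      unfolding \<tau>a unfolding a comp_apply \<delta>\<gamma>[OF x] \<delta>\<gamma>[OF y(1)]
      by (simp add: times_hom_def to_sym_enumeration[OF fin(2) V] t1_act[OF U] del: One_nat_def)
    show "times_hom (N * p) p (id, rot p) ((?e \<circ> \<delta>) a) = (?e \<circ> \<delta>) (\<sigma> a)"
      unfolding \<sigma>a unfolding a comp_apply \<delta>\<gamma>[OF x] \<delta>\<gamma>[OF y(2)]
      by (simp add: times_hom_def to_sym_enumeration[OF fin(2) V] del: One_nat_def)
  qed
qed

text \<open>One representative is chosen in each orbit, and freeness makes the exponents of the two
  operators coordinates on the orbit. The exponents run over \<open>{1..p}\<close> instead of the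
  residues below p, so that they match the points moved by \<open>rot p\<close>.\<close>

lemma free_orbits:
  fixes \<tau> \<sigma> :: "'a \<Rightarrow> 'a"
  assumes fin: "finite A" and p: "p > 0"
    and closed: "\<And>a. a \<in> A \<Longrightarrow> \<tau> a \<in> A" "\<And>a. a \<in> A \<Longrightarrow> \<sigma> a \<in> A"
    and comm: "\<And>a. a \<in> A \<Longrightarrow> \<tau> (\<sigma> a) = \<sigma> (\<tau> a)"
    and period: "\<And>a. a \<in> A \<Longrightarrow> (\<tau> ^^ p) a = a" "\<And>a. a \<in> A \<Longrightarrow> (\<sigma> ^^ p) a = a"
    and free: "\<And>a i j. a \<in> A \<Longrightarrow> i < p \<Longrightarrow> j < p \<Longrightarrow> (\<tau> ^^ i) ((\<sigma> ^^ j) a) = a \<Longrightarrow> i = 0 \<and> j = 0"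
  obtains N \<gamma> where "card A = N * p * p" "bij_betw \<gamma> ({1..N} \<times> {1..p} \<times> {1..p}) A"
    "\<And>r i j. r \<in> {1..N} \<Longrightarrow> i \<in> {1..p} \<Longrightarrow> j \<in> {1..p} \<Longrightarrow> \<tau> (\<gamma> (r, i, j)) = \<gamma> (r, rot p i, j)"
    "\<And>r i j. r \<in> {1..N} \<Longrightarrow> i \<in> {1..p} \<Longrightarrow> j \<in> {1..p} \<Longrightarrow> \<sigma> (\<gamma> (r, i, j)) = \<gamma> (r, i, rot p j)"
proof -
  define act where "act i j a = (\<tau> ^^ i) ((\<sigma> ^^ j) a)" for i j a
  have pow_closed: "(\<tau> ^^ i) a \<in> A" "(\<sigma> ^^ i) a \<in> A" if "a \<in> A" for i a
    using that by (induction i) (simp_all add: closed)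
  have comm1: "\<tau> ((\<sigma> ^^ j) a) = (\<sigma> ^^ j) (\<tau> a)" if "a \<in> A" for j a
    using that by (induction j) (simp_all add: comm pow_closed)
  have comm2: "(\<sigma> ^^ j) ((\<tau> ^^ i) a) = (\<tau> ^^ i) ((\<sigma> ^^ j) a)" if "a \<in> A" for i j a
    using that by (induction i) (simp_all add: comm1[symmetric] pow_closed)
  have act_closed: "act i j a \<in> A" if "a \<in> A" for i j a
    using that by (simp add: act_def pow_closed)
  have act_act: "act i j (act k l a) = act (i + k) (j + l) a" if "a \<in> A" for i j k l a
    using that by (simp add: act_def comm2 pow_closed funpow_add)
  have mod1: "(\<tau> ^^ (i mod p)) a = (\<tau> ^^ i) a" "(\<sigma> ^^ (i mod p)) a = (\<sigma> ^^ i) a" if "a \<in> A" for i a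
    by (rule funpow_mod_eq, rule period[OF that])+
  have act_mod: "act (i mod p) (j mod p) a = act i j a" if "a \<in> A" for i j a
    using that by (simp add: act_def mod1 pow_closed)
  have act_0: "act 0 0 a = a" for a by (simp add: act_def)
  have act_inj: "p dvd i \<and> p dvd j" if "a \<in> A" "act i j a = a" for i j a
  proof -
    have "act (i mod p) (j mod p) a = a"
      using act_mod[OF that(1), of i j] that(2) by simp
    from free[OF that(1) _ _ this[unfolded act_def]] show ?thesis
      using p by (simp add: dvd_eq_mod_eq_0)
  qed
  define orb where "orb a = {act i j a |i j. True}" for a
  have orb_refl: "a \<in> orb a" for a
    unfolding orb_def using act_0 by (metis (mono_tags, lifting) mem_Collect_eq)
  have act_inverse: "act (p - i mod p) (p - j mod p) (act i j a) = a" if "a \<in> A" for i j a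
  proof -
    have "(p - i mod p + i) mod p = 0" for i
    proof -
      have "(p - i mod p + i) mod p = (p - i mod p + i mod p) mod p"
        by (simp only: mod_simps)
      then show ?thesis
        using p by simp
    qed
    then show ?thesis
      using act_mod[OF that, of "p - i mod p + i" "p - j mod p + j"] that by (simp add: act_act act_0)
  qed
  have orb_sym: "orb (act i j a) = orb a" if a: "a \<in> A" for i j a
  proof
    show "orb (act i j a) \<subseteq> orb a"
      using act_act[OF a] by (auto simp: orb_def)
    show "orb a \<subseteq> orb (act i j a)"
    proof
      fix x assume "x \<in> orb a"
      then obtain k l where x: "x = act k l a" by (auto simp: orb_def)
      have "x = act k l (act (p - i mod p) (p - j mod p) (act i j a))"
        using act_inverse[OF a] x by simp
      then show "x \<in> orb (act i j a)"
        using act_act[OF act_closed[OF a]] by (auto simp: orb_def)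
    qed
  qed
  \<comment> \<open>The choice depends only on the orbit as a set, hence is constant on
    orbits.\<close>
  define rep where "rep a = (SOME b. b \<in> orb a)" for a
  have rep: "rep a \<in> orb a" for a
    unfolding rep_def by (rule someI[of "\<lambda>b. b \<in> orb a", OF orb_refl])
  have rep_act: "rep (act i j a) = rep a" if "a \<in> A" for i j a
    using orb_sym[OF that] by (simp add: rep_def)
  define R where "R = rep ` A"
  have R: "r \<in> A" "rep r = r" if "r \<in> R" for r
  proof -
    obtain a where a: "a \<in> A" "r = rep a" using \<open>r \<in> R\<close> by (auto simp: R_def)
    then obtain i j where "rep a = act i j a" using rep[of a] by (auto simp: orb_def)
    then show "r \<in> A" "rep r = r" using a rep_act[OF a(1)] act_closed[OF a(1)] by simp_all
  qed
  have "finite R" using fin by (simp add: R_def)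
  then obtain \<rho> where \<rho>: "bij_betw \<rho> {1..card R} R"
    using ex_bij_betw_nat_finite_1 by blast
  define \<gamma> where "\<gamma> = (\<lambda>(r, i, j). act i j (\<rho> r))"
  have \<rho>R: "\<rho> r \<in> R" if "r \<in> {1..card R}" for r
    by (rule bij_betw_apply[OF \<rho> that])
  note \<rho>A = R(1)[OF \<rho>R]
  have "inj_on \<gamma> ({1..card R} \<times> {1..p} \<times> {1..p})"
  proof (rule inj_onI)
    fix x y assume xy: "x \<in> {1..card R} \<times> {1..p} \<times> {1..p}" "y \<in> {1..card R} \<times> {1..p} \<times> {1..p}"
        "\<gamma> x = \<gamma> y"
    obtain r i j r' i' j' where x: "x = (r, i, j)" and y: "y = (r', i', j')"
      by (cases x; cases y)
    have mem: "r \<in> {1..card R}" "i \<in> {1..p}" "j \<in> {1..p}" "r' \<in> {1..card R}" "i' \<in> {1..p}" "j' \<in> {1..p}"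
      and eq: "act i j (\<rho> r) = act i' j' (\<rho> r')"
      using xy unfolding x y by (simp_all add: \<gamma>_def)
    have "\<rho> r = \<rho> r'"
      using arg_cong[OF eq, of rep] mem \<rho>A R(2)[OF \<rho>R] by (simp add: rep_act)
    from inj_onD[OF bij_betw_imp_inj_on[OF \<rho>] this mem(1,4)] have r: "r = r'" .
    have "act (p - i' mod p + i) (p - j' mod p + j) (\<rho> r) = \<rho> r"
      using arg_cong[OF eq, of "act (p - i' mod p) (p - j' mod p)"]
          act_inverse[OF \<rho>A[OF mem(1)], of i' j'] r
      by (simp add: act_act[OF \<rho>A[OF mem(4)]])
    from act_inj[OF \<rho>A[OF mem(1)] this]
    have d: "p dvd p - i' mod p + i" "p dvd p - j' mod p + j" by auto
    \<comment> \<open>For k' < p the number p - k' + k lies strictly between 0 and 2p, so if p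
      divides it, it equals p. The value k' = p is separate because its residue is 0.\<close>
    have aux: "k = k'" if k: "k \<in> {1..p}" "k' \<in> {1..p}" "p dvd p - k' mod p + k" for k k'
    proof (cases "k' = p")
      case True
      have "p dvd k"
        using k(3) unfolding True mod_self minus_nat.diff_0 by simp
      then have "p \<le> k" using k(1) by (intro dvd_imp_le) auto
      with k(1) True show ?thesis by simp
    next
      case False
      with k have "k' < p" by auto
      obtain q where q: "p - k' + k = p * q" using k \<open>k' < p\<close> by (auto elim: dvdE)
      have "0 < p - k' + k" using \<open>k' < p\<close> by simp
      with q have "q \<noteq> 0" by (metis mult_0_right less_irrefl)
      moreover have "q < 2"
      proof (rule ccontr)
        assume "\<not> q < 2"
        then have "p * 2 \<le> p * q" by simp
        moreover have "1 \<le> k'" "k \<le> p" using k by auto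
        ultimately show False using q \<open>k' < p\<close> by linarith
      qed
      ultimately have "q = 1" by simp
      with q \<open>k' < p\<close> show ?thesis by simp
    qed
    show "x = y"
      unfolding x y using r aux[OF mem(2,5) d(1)] aux[OF mem(3,6) d(2)] by simp
  qed
  moreover have "\<gamma> ` ({1..card R} \<times> {1..p} \<times> {1..p}) = A"
  proof
    show "\<gamma> ` ({1..card R} \<times> {1..p} \<times> {1..p}) \<subseteq> A"
      using act_closed \<rho>A by (auto simp: \<gamma>_def simp del: atLeastAtMost_iff)
    show "A \<subseteq> \<gamma> ` ({1..card R} \<times> {1..p} \<times> {1..p})"
    proof
      fix a assume a: "a \<in> A"
      then have "rep a \<in> R" by (simp add: R_def)
      then obtain r where r: "r \<in> {1..card R}" "rep a = \<rho> r"
        using \<rho> unfolding bij_betw_def by (metis imageE)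
      obtain i j where ij: "rep a = act i j a"
        using rep[of a] by (auto simp: orb_def)
      \<comment> \<open>Exponents of the inverse motion; subtracting a residue from p lands in
        \<open>{1..p}\<close>, never at 0.\<close>
      define k l where "k = p - i mod p" and "l = p - j mod p"
      have "act k l (\<rho> r) = a"
        using act_inverse[OF a, of i j] ij r(2) by (simp add: k_def l_def)
      moreover have "k \<in> {1..p}" "l \<in> {1..p}"
        using p by (auto simp: k_def l_def Suc_le_eq)
      ultimately show "a \<in> \<gamma> ` ({1..card R} \<times> {1..p} \<times> {1..p})"
        using r(1) by (force simp: \<gamma>_def)
    qed
  qed
  ultimately have bij: "bij_betw \<gamma> ({1..card R} \<times> {1..p} \<times> {1..p}) A"
    by (simp add: bij_betw_def)
  have rot1: "rot p i mod p = Suc i mod p" if i: "i \<in> {1..p}" for i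
  proof -
    obtain k where "i = Suc k" "k < p" using i by (cases i) auto
    then show ?thesis using rot_pow[of k p 1] by (simp add: mod_simps)
  qed
  have act_cong: "act i j a = act i' j' a" if "a \<in> A" "i mod p = i' mod p" "j mod p = j' mod p"
      for i j i' j' a
    using act_mod[OF that(1), of i j] act_mod[OF that(1), of i' j'] that by simp
  show ?thesis
  proof (rule that[OF _ bij])
    show "card A = card R * p * p"
      using bij_betw_same_card[OF bij] by simp
    fix r i j assume rij: "r \<in> {1..card R}" "i \<in> {1..p}" "j \<in> {1..p}"
    have "\<tau> (act i j (\<rho> r)) = act (Suc i) j (\<rho> r)" "\<sigma> (act i j (\<rho> r)) = act i (Suc j) (\<rho> r)"
      using act_act[OF \<rho>A[OF rij(1)], of 1 0 i j] act_act[OF \<rho>A[OF rij(1)], of 0 1 i j]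
      by (simp_all add: act_def)
    then show "\<tau> (\<gamma> (r, i, j)) = \<gamma> (r, rot p i, j)" "\<sigma> (\<gamma> (r, i, j)) = \<gamma> (r, i, rot p j)"
      unfolding \<gamma>_def split_conv act_cong[OF \<rho>A[OF rij(1)] rot1[OF rij(2)] refl]
        act_cong[OF \<rho>A[OF rij(1)] refl rot1[OF rij(3)]] .
  qed
qed

section \<open>The orbits of the action on functions\<close>

definition maps :: "nat \<Rightarrow> (nat \<Rightarrow> nat) set"
  where "maps p = {1..p} \<rightarrow>\<^sub>E {1..p}"

definition pre_rot :: "nat \<Rightarrow> (nat \<Rightarrow> nat) \<Rightarrow> nat \<Rightarrow> nat"
  where "pre_rot p f = (\<lambda>j\<in>{1..p}. f (inv' (rot p) j))"

definition post_rot :: "nat \<Rightarrow> (nat \<Rightarrow> nat) \<Rightarrow> nat \<Rightarrow> nat"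
  where "post_rot p f = (\<lambda>j\<in>{1..p}. rot p (f j))"

text \<open>Under the identification of \<open>{1..p}\<close> with the integers modulo \<open>p\<close>, these are the affine
  functions of slope \<open>-c\<close>.\<close>

definition slope_maps :: "nat \<Rightarrow> nat \<Rightarrow> (nat \<Rightarrow> nat) set"
  where "slope_maps p c = {f \<in> maps p. \<forall>j\<in>{1..p}. (rot p ^^ c) (f (rot p j)) = f j}"

lemma finite_maps: "finite (maps p)"
  by (simp add: maps_def finite_PiE)

lemma rot_mem: "j \<in> {1..p} \<Longrightarrow> rot p j \<in> {1..p}"
  using permutes_in_image[OF rot_permutes] by blast

lemma rot_pow_mem: "j \<in> {1..p} \<Longrightarrow> (rot p ^^ k) j \<in> {1..p}"
  using permutes_in_image[OF rot_pow_permutes] by blast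

lemma inv_rot_mem: "j \<in> {1..p} \<Longrightarrow> inv' (rot p) j \<in> {1..p}"
  using permutes_in_image[OF permutes_inv[OF rot_permutes]] by blast

lemma rot_inv [simp]: "rot p (inv' (rot p) j) = j" "inv' (rot p) (rot p j) = j"
  using permutes_inverses[OF rot_permutes] by auto

lemma inj_rot_pow: "inj (rot p ^^ k)"
  by (rule permutes_inj[OF rot_pow_permutes])

lemma rot_pow_last: "j \<in> {1..p} \<Longrightarrow> (rot p ^^ j) p = j"
  using rot_pow[of "p - 1" p j] by (cases "j = p") (auto simp: Suc_diff_Suc mod_if)

lemma rot_pow_eq_id: "p dvd k \<Longrightarrow> rot p ^^ k = id"
  using rot_pow_mod[where p = p and k = k] by simp

lemma maps_eqI: "f \<in> maps p \<Longrightarrow> g \<in> maps p \<Longrightarrow> (\<And>j. j \<in> {1..p} \<Longrightarrow> f j = g j) \<Longrightarrow> f = g"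
  unfolding maps_def by (rule PiE_ext)

lemma maps_mem: "f \<in> maps p \<Longrightarrow> j \<in> {1..p} \<Longrightarrow> f j \<in> {1..p}"
  unfolding maps_def by (rule PiE_mem)

lemma pre_rot_maps: "f \<in> maps p \<Longrightarrow> pre_rot p f \<in> maps p"
  unfolding maps_def pre_rot_def
  by (intro restrict_PiE_iff[THEN iffD2] ballI) (rule PiE_mem, assumption, rule inv_rot_mem)

lemma post_rot_maps: "f \<in> maps p \<Longrightarrow> post_rot p f \<in> maps p"
  unfolding maps_def post_rot_def
  by (intro restrict_PiE_iff[THEN iffD2] ballI) (rule rot_mem, rule PiE_mem)

lemma pre_rot_apply: "j \<in> {1..p} \<Longrightarrow> pre_rot p f j = f (inv' (rot p) j)"
  by (simp add: pre_rot_def)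

lemma post_rot_apply: "j \<in> {1..p} \<Longrightarrow> post_rot p f j = rot p (f j)"
  by (simp add: post_rot_def)

lemma pre_rot_pow:
  assumes "f \<in> maps p"
  shows "(pre_rot p ^^ k) f \<in> maps p \<and> (\<forall>j\<in>{1..p}. (pre_rot p ^^ k) f ((rot p ^^ k) j) = f j)"
proof (induction k)
  case (Suc k)
  have "(pre_rot p ^^ Suc k) f ((rot p ^^ Suc k) j) = f j" if "j \<in> {1..p}" for j
    using Suc rot_mem[OF rot_pow_mem[OF that, of k]] that by (simp add: pre_rot_apply)
  then show ?case
    using Suc by (simp add: pre_rot_maps)
qed (use assms in simp)

lemma post_rot_pow:
  assumes "f \<in> maps p"
  shows "(post_rot p ^^ k) f \<in> maps p \<and> (\<forall>j\<in>{1..p}. (post_rot p ^^ k) f j = (rot p ^^ k) (f j))"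
  by (induction k) (use assms in \<open>simp_all add: post_rot_maps post_rot_apply\<close>)

lemma pre_post_rot: "f \<in> maps p \<Longrightarrow> pre_rot p (post_rot p f) = post_rot p (pre_rot p f)"
  by (rule maps_eqI[of _ p])
    (simp_all add: pre_rot_maps post_rot_maps pre_rot_apply post_rot_apply inv_rot_mem del:
        One_nat_def atLeastAtMost_iff)

lemma pre_rot_period: "f \<in> maps p \<Longrightarrow> (pre_rot p ^^ p) f = f"
  using pre_rot_pow[of f p p] by (intro maps_eqI[of _ p]) (auto simp: rot_pow_p)

lemma post_rot_period: "f \<in> maps p \<Longrightarrow> (post_rot p ^^ p) f = f"
  using post_rot_pow[of f p p] by (intro maps_eqI[of _ p]) (auto simp: rot_pow_p)

lemma pre_rot_slope:
  assumes "f \<in> slope_maps p c" shows "pre_rot p f \<in> slope_maps p c"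
proof -
  have "(rot p ^^ c) (pre_rot p f (rot p j)) = pre_rot p f j" if j: "j \<in> {1..p}" for j
  proof -
    have "(rot p ^^ c) (f (rot p (inv' (rot p) j))) = f (inv' (rot p) j)"
      using assms inv_rot_mem[OF j] unfolding slope_maps_def by blast
    then show ?thesis
      using j rot_mem[OF j] by (simp add: pre_rot_apply del: One_nat_def atLeastAtMost_iff)
  qed
  then show ?thesis
    using assms pre_rot_maps unfolding slope_maps_def by blast
qed

lemma post_rot_slope:
  assumes "f \<in> slope_maps p c" shows "post_rot p f \<in> slope_maps p c"
proof -
  have "(rot p ^^ c) (post_rot p f (rot p j)) = post_rot p f j" if j: "j \<in> {1..p}" for j
  proof -
    have "(rot p ^^ c) (f (rot p j)) = f j"
      using assms j unfolding slope_maps_def by blast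
    then show ?thesis
      using j rot_mem[OF j] by (simp add: post_rot_apply funpow_swap1[symmetric] del: One_nat_def
          atLeastAtMost_iff)
  qed
  then show ?thesis
    using assms post_rot_maps unfolding slope_maps_def by blast
qed

text \<open>An affine function of given slope is determined by one value, which is arbitrary. The
  point p is convenient because its j-th rotation is j.\<close>

lemma slope_maps_evaluation:
  assumes p: "p > 0" shows "bij_betw (\<lambda>f. f p) (slope_maps p c) {1..p}"
proof -
  have "inj_on (\<lambda>f. f p) (slope_maps p c)"
  proof (rule inj_onI)
    fix f g assume f: "f \<in> slope_maps p c" and g: "g \<in> slope_maps p c" and eq: "f p = g p"
    have "f ((rot p ^^ k) p) = g ((rot p ^^ k) p)" for k
    proof (induction k)
      case (Suc k)
      have "(rot p ^^ k) p \<in> {1..p}" using p by (intro rot_pow_mem) auto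
      then have "(rot p ^^ c) (f (rot p ((rot p ^^ k) p))) = (rot p ^^ c) (g (rot p ((rot p ^^ k) p)))"
        using f g Suc unfolding slope_maps_def by (metis (mono_tags, lifting) mem_Collect_eq)
      then show ?case
        using inj_rot_pow by (simp add: inj_eq)
    qed (simp add: eq)
    then show "f = g"
      using f g rot_pow_last by (intro maps_eqI[of f p g])
          (auto simp: slope_maps_def, metis atLeastAtMost_iff One_nat_def)
  qed
  moreover have "(\<lambda>f. f p) ` slope_maps p c = {1..p}"
  proof
    show "(\<lambda>f. f p) ` slope_maps p c \<subseteq> {1..p}"
      using p maps_mem[of _ p p] by (auto simp: slope_maps_def)
    show "{1..p} \<subseteq> (\<lambda>f. f p) ` slope_maps p c"
    proof
      fix x assume x: "x \<in> {1..p}"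
      \<comment> \<open>From j to p there are p - j steps, and each of them lowers the value by
        c.\<close>
      define f where "f = (\<lambda>j\<in>{1..p}. (rot p ^^ (c * (p - j))) x)"
      have f: "f \<in> maps p"
        unfolding maps_def f_def using rot_pow_mem[OF x] by (intro restrict_PiE_iff[THEN iffD2] ballI)
      have "(rot p ^^ c) (f (rot p j)) = f j" if j: "j \<in> {1..p}" for j
      proof -
        obtain i where i: "j = Suc i" "i < p" using j by (cases j) auto
        then have r: "rot p j = Suc (Suc i mod p)"
          using rot_pow[of i p 1] by simp
        show ?thesis
        proof (cases "j = p")
          \<comment> \<open>Here the argument wraps around from p to 1, and consistency requires
            that c p steps of rotation are the identity.\<close>
          case True
          then have "rot p j = 1" using r i by simp
          then have "(rot p ^^ c) (f (rot p j)) = (rot p ^^ (c * p)) x"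
            using p by (simp add: f_def True funpow_add[THEN fun_cong, unfolded comp_apply,
                symmetric] algebra_simps)
          also have "\<dots> = f j"
            using p by (simp add: f_def True rot_pow_eq_id)
          finally show ?thesis .
        next
          case False
          then have "rot p j = Suc j" "Suc j \<le> p" using r i by auto
          moreover have "c + c * (p - Suc j) = c * (p - j)"
            using \<open>Suc j \<le> p\<close> by (metis Suc_diff_Suc Suc_le_lessD mult_Suc_right)
          ultimately show ?thesis
            using j by (simp add: f_def funpow_add[THEN fun_cong, unfolded comp_apply, symmetric])
        qed
      qed
      then have "f \<in> slope_maps p c" using f by (simp add: slope_maps_def)
      moreover have "f p = x" using p by (simp add: f_def)
      ultimately show "x \<in> (\<lambda>f. f p) ` slope_maps p c" by blast
    qed
  qed
  ultimately show ?thesis by (simp add: bij_betw_def)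
qed

lemma card_slope_maps: "p > 0 \<Longrightarrow> card (slope_maps p c) = p"
  using bij_betw_same_card[OF slope_maps_evaluation] by simp

lemma finite_slope_maps: "finite (slope_maps p c)"
  by (rule finite_subset[OF _ finite_maps[of p]]) (auto simp: slope_maps_def)

text \<open>Evaluation at p carries rotation of the value to \<open>rot p\<close>. The slope
  condition one step before p carries rotation of the argument to \<open>rot p ^^ k\<close>, so on
  this set (a, b) acts as translation by k a + b.\<close>

lemma realizes_slope:
  assumes p: "p > 1" "of_nat p = (0::'k::comm_ring_1)"
    and c: "bisequence (sym_group p) p (rot p ^^ k) (rot p) c"
    and X: "\<And>m n. X m n = (sym_class p (coinv (c m n)) :: 'k sym_homology)"
  shows "realizes p (slope_maps p k) (pre_rot p) (post_rot p) X"
proof (rule realizesI[OF finite_slope_maps _ slope_maps_evaluation])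
  show "cyclic_pair (sym_group p) p (rot p ^^ k) (rot p)"
    by (rule rot_cyclic_pair)
  fix f assume f: "f \<in> slope_maps p k"
  have mem: "p \<in> {1..p}" using p by simp
  have "(rot p ^^ k) (f (rot p (inv' (rot p) p))) = f (inv' (rot p) p)"
    using f inv_rot_mem[OF mem] unfolding slope_maps_def by blast
  then show "(rot p ^^ k) (f p) = pre_rot p f p"
    using pre_rot_apply[OF mem] by simp
  show "rot p (f p) = post_rot p f p"
    using post_rot_apply[OF mem] by simp
qed (use p X c pre_rot_slope post_rot_slope in \<open>simp_all add: card_slope_maps\<close>)

lemma slope_maps_disjoint:
  assumes "p > 0" "c < p" "d < p" "c \<noteq> d" shows "slope_maps p c \<inter> slope_maps p d = {}"
proof -
  have "a = b" if f: "f \<in> slope_maps p a" "f \<in> slope_maps p b" and ab: "a \<le> b" "b < p" for f a b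
  proof -
    have 1: "1 \<in> {1..p}" using assms(1) by simp
    have "f (rot p 1) \<in> {1..p}"
      using f(1) maps_mem[of f p "rot p 1"] rot_mem[OF 1] by (simp add: slope_maps_def)
    moreover have "(rot p ^^ a) (f (rot p 1)) = (rot p ^^ b) (f (rot p 1))"
      using f 1 unfolding slope_maps_def by (metis (mono_tags, lifting) mem_Collect_eq)
    ultimately have "p dvd b - a"
      by (rule rot_pow_fixpoint[OF _ ab(1)])
    then show ?thesis using ab by (auto dest: dvd_imp_le)
  qed
  from this[of _ c d] this[of _ d c] show ?thesis
    using assms by (metis IntE all_not_in_conv nat_le_linear)
qed

lemma slope_maps_subset: "slope_maps p c \<subseteq> maps p"
  by (auto simp: slope_maps_def)

lemma card_maps: "card (maps p) = p ^ p"
  by (simp add: maps_def card_funcsetE)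

section \<open>The functions that are not affine\<close>

definition free_maps :: "nat \<Rightarrow> (nat \<Rightarrow> nat) set"
  where "free_maps p = maps p - (\<Union>c<p. slope_maps p c)"

lemma maps_decomposition: "maps p = free_maps p \<union> (\<Union>c<p. slope_maps p c)"
  by (auto simp: free_maps_def slope_maps_def)

lemma card_free_maps: "p > 0 \<Longrightarrow> card (free_maps p) = p ^ p - p * p"
proof -
  assume p: "p > 0"
  have "card (\<Union>c<p. slope_maps p c) = (\<Sum>c<p. card (slope_maps p c))"
    by (rule card_UN_disjoint) (use p slope_maps_disjoint finite_slope_maps in auto)
  then have "card (\<Union>c<p. slope_maps p c) = p * p"
    by (simp add: card_slope_maps[OF p])
  then show ?thesis
    unfolding free_maps_def
    by (subst card_Diff_subset) (auto simp: finite_slope_maps card_maps intro: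
        subsetD[OF slope_maps_subset])
qed

text \<open>The affine functions of a given slope are stable under both rotations and, since these
  have finite order, under their inverses; so the complement is stable as well.\<close>

lemma free_maps_closed:
  assumes "f \<in> free_maps p" shows "pre_rot p f \<in> free_maps p" "post_rot p f \<in> free_maps p"
proof -
  have f: "f \<in> maps p" using assms by (simp add: free_maps_def)
  have "f \<in> slope_maps p c" if "pre_rot p f \<in> slope_maps p c" "c < p" for c
  proof -
    have "(pre_rot p ^^ k) (pre_rot p f) \<in> slope_maps p c" for k
      by (induction k) (simp_all add: that pre_rot_slope)
    from this[of "p - 1"] show ?thesis
      using pre_rot_period[OF f] that by (cases p) (simp_all add: funpow_swap1)
  qed
  then show "pre_rot p f \<in> free_maps p"
    using assms pre_rot_maps by (auto simp: free_maps_def)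
  have "f \<in> slope_maps p c" if "post_rot p f \<in> slope_maps p c" "c < p" for c
  proof -
    have "(post_rot p ^^ k) (post_rot p f) \<in> slope_maps p c" for k
      by (induction k) (simp_all add: that post_rot_slope)
    from this[of "p - 1"] show ?thesis
      using post_rot_period[OF f] that by (cases p) (simp_all add: funpow_swap1)
  qed
  then show "post_rot p f \<in> free_maps p"
    using assms post_rot_maps by (auto simp: free_maps_def)
qed

text \<open>If (a, b) fixes f, then f(j + a) = f(j) + b. For nonzero a, primality of p allows
  dividing by a, which shows that f is affine; for a = 0 the b-th rotation has a fixed point, so b =
  0.\<close>

lemma free_maps_free:
  assumes p: "prime p" and f: "f \<in> free_maps p" and ab: "a < p" "b < p"
    and eq: "(pre_rot p ^^ a) ((post_rot p ^^ b) f) = f"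
  shows "a = 0 \<and> b = 0"
proof -
  have p0: "p > 1" by (rule prime_gt_1_nat[OF p])
  have fm: "f \<in> maps p" using f by (simp add: free_maps_def)
  have shift: "(rot p ^^ b) (f j) = f ((rot p ^^ a) j)" if j: "j \<in> {1..p}" for j
  proof -
    have "(pre_rot p ^^ a) ((post_rot p ^^ b) f) ((rot p ^^ a) j) = (post_rot p ^^ b) f j"
      using pre_rot_pow[of "(post_rot p ^^ b) f" p a] post_rot_pow[OF fm, of b] j by blast
    then show ?thesis
      using post_rot_pow[OF fm, of b] j eq by simp
  qed
  have 1: "1 \<in> {1..p}" using p0 by simp
  have a0: "a = 0"
  proof (rule ccontr)
    assume "a \<noteq> 0"
    with ab(1) have "coprime a p"
      using p by (metis coprime_commute dvd_imp_le linorder_not_less not_gr_zero prime_imp_coprime)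
    then obtain k where k: "[a * k = 1] (mod p)"
      using cong_solve_coprime_nat by auto
    have iter: "(rot p ^^ (b * l)) (f j) = f ((rot p ^^ (a * l)) j)" if "j \<in> {1..p}" for j l
    proof (induction l)
      case (Suc l)
      have "(rot p ^^ (b * Suc l)) (f j) = (rot p ^^ b) (f ((rot p ^^ (a * l)) j))"
        using Suc by (simp add: funpow_add)
      also have "\<dots> = f ((rot p ^^ a) ((rot p ^^ (a * l)) j))"
        using rot_pow_mem[OF that] by (rule shift)
      finally show ?case by (simp add: funpow_add)
    qed simp
    have "rot p ^^ (a * k) = rot p"
      using rot_pow_mod[where p = p and k = "a * k"] k p0 by (simp add: cong_def)
    then have step: "(rot p ^^ (b * k)) (f j) = f (rot p j)" if "j \<in> {1..p}" for j
      using iter[OF that, of k] by simp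
    \<comment> \<open>The slope parameter is the negative of the increment b k, because membership
      in \<open>slope_maps p c\<close> means f(j + 1) + c = f(j). The outer remainder keeps c below
      p.\<close>
    define c where "c = (p - b * k mod p) mod p"
    have "(c + b * k) mod p = (p - b * k mod p + b * k mod p) mod p"
      unfolding c_def by (simp only: mod_simps)
    also have "\<dots> = 0" using p0 by simp
    finally have "rot p ^^ (c + b * k) = id"
      by (intro rot_pow_eq_id) (simp add: dvd_eq_mod_eq_0)
    then have "(rot p ^^ c) (f (rot p j)) = f j" if "j \<in> {1..p}" for j
      unfolding step[OF that, symmetric] by (simp add: funpow_add fun_eq_iff)
    then have "f \<in> slope_maps p c" using fm by (simp add: slope_maps_def)
    moreover have "c < p" using p0 by (simp add: c_def)
    ultimately show False using f by (auto simp: free_maps_def)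
  qed
  have "(rot p ^^ 0) (f 1) = (rot p ^^ b) (f 1)"
    using shift[OF 1] a0 by simp
  then have "p dvd b - 0"
    by (intro rot_pow_fixpoint[OF maps_mem[OF fm 1]]) auto
  then show ?thesis
    using a0 ab by (auto dest: dvd_imp_le)
qed

lemma realizes_free:
  assumes p: "prime p" "of_nat p = (0::'k::comm_ring_1)"
  shows "realizes p (free_maps p) (pre_rot p) (post_rot p)
    (\<lambda>m n. circ_prod (circ_prod (point_class (p ^ (p - 2) - 1)) (cyc_class p m)) (cyc_class p n) ::
        'k sym_homology)"
proof -
  have p1: "p > 1" by (rule prime_gt_1_nat[OF p(1)])
  have fin: "finite (free_maps p)"
    using finite_maps by (simp add: free_maps_def)
  have maps: "f \<in> maps p" if "f \<in> free_maps p" for f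
    using that by (simp add: free_maps_def)
  obtain N \<gamma> where N: "card (free_maps p) = N * p * p"
    and \<gamma>: "bij_betw \<gamma> ({1..N} \<times> {1..p} \<times> {1..p}) (free_maps p)"
    "\<And>r i j. r \<in> {1..N} \<Longrightarrow> i \<in> {1..p} \<Longrightarrow> j \<in> {1..p} \<Longrightarrow> pre_rot p (\<gamma> (r, i, j)) = \<gamma> (r, rot p i, j)"
    "\<And>r i j. r \<in> {1..N} \<Longrightarrow> i \<in> {1..p} \<Longrightarrow> j \<in> {1..p} \<Longrightarrow> post_rot p (\<gamma> (r, i, j)) = \<gamma> (r, i, rot p j)"
    by (rule free_orbits[OF fin, of p "pre_rot p" "post_rot p"])
      (use p1 free_maps_closed pre_post_rot pre_rot_period post_rot_period maps
          free_maps_free[OF p(1)] in auto)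
  \<comment> \<open>The number of free orbits is found by counting: p^p functions, of which p * p
    are affine, in orbits of size p * p.\<close>
  have "N * (p * p) = p ^ p - p * p"
    using N card_free_maps[of p] p1 by simp
  also have "\<dots> = (p ^ (p - 2) - 1) * (p * p)"
  proof -
    have "p ^ p = p ^ (p - 2) * (p * p)"
      using p1 by (metis One_nat_def Suc_leI le_add_diff_inverse2 numeral_2_eq_2 power2_eq_square
          power_add)
    then show ?thesis by (simp add: diff_mult_distrib)
  qed
  finally have "N = p ^ (p - 2) - 1" using p1 by simp
  with realizes_circ[OF p1 p(2) \<gamma>] show ?thesis by simp
qed

section \<open>Series\<close>

text \<open>For odd p one family of classes carries all four identities; the parities a and b of the
  two degrees select among them.\<close>

definition parity_series ::
  "nat \<Rightarrow> nat \<Rightarrow> (nat \<Rightarrow> nat \<Rightarrow> 'k sym_homology) \<Rightarrow> 'k::comm_ring_1 hseries"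
  where "parity_series a b X = Abs_fps (\<lambda>n. Abs_fps (\<lambda>m. X (2 * m + a) (2 * n + b)))"

lemma parity_series_nth: "fps_nth (fps_nth (parity_series a b X) n) m = X (2 * m + a) (2 * n + b)"
  by (simp add: parity_series_def)

lemma fps_prod_ext_nth:
  "fps_nth (fps_nth (fps_prod_ext (fps_prod_ext f) F G) n) m =
    (\<Sum>j\<le>n. \<Sum>i\<le>m. f (fps_nth (fps_nth F j) i) (fps_nth (fps_nth G (n - j)) (m - i)))"
  by (simp add: fps_prod_ext_def fps_sum_nth)

lemma hseries_eqI:
  "(\<And>m n. fps_nth (fps_nth F n) m = fps_nth (fps_nth G n) m) \<Longrightarrow> F = G"
  by (intro fps_ext) simp

lemma sum_atMost_even:
  fixes f :: "nat \<Rightarrow> 'a::comm_monoid_add"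
  assumes "\<And>i. odd i \<Longrightarrow> i \<le> 2 * m \<Longrightarrow> f i = 0" shows "(\<Sum>i\<le>2 * m. f i) = (\<Sum>i\<le>m. f (2 * i))"
proof -
  have "(\<Sum>i\<le>2 * m. f i) = (\<Sum>i\<le>m. f (2 * i)) + (\<Sum>i<m. f (Suc (2 * i)))"
    by (induction m) (simp_all add: ac_simps)
  moreover have "(\<Sum>i<m. f (Suc (2 * i))) = 0"
    by (rule sum.neutral) (simp add: assms)
  ultimately show ?thesis by simp
qed

lemma sum_atMost_odd:
  fixes f :: "nat \<Rightarrow> 'a::comm_monoid_add"
  shows "(\<Sum>i\<le>Suc (2 * m). f i) = (\<Sum>i\<le>m. f (2 * i)) + (\<Sum>i\<le>m. f (Suc (2 * i)))"
  by (induction m) (simp_all add: ac_simps)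

lemma kappa_even [simp]: "even i \<Longrightarrow> kappa p i j = 1" "even j \<Longrightarrow> kappa p i j = 1"
  by (simp_all add: kappa_def)

text \<open>The sum 0 + ... + (p - 1) is p times the integer (p - 1)/2.\<close>

lemma kappa_odd:
  assumes "odd p" "of_nat p = (0::'k::comm_ring_1)" "odd i" "odd j" shows "kappa p i j = (0::'k)"
proof -
  obtain k where k: "p = 2 * k + 1" using assms(1) by (elim oddE)
  have "(\<Sum>b<2 * k + 1. b) = (2 * k + 1) * k"
    by (induction k) (simp_all add: algebra_simps)
  then have "of_nat (\<Sum>b<p. b) = (of_nat p * of_nat k :: 'k)"
    unfolding k by (simp only: of_nat_mult)
  then show ?thesis
    using assms by (simp only: kappa_def) simp
qed

text \<open>An even degree splits into two even or two odd ones, and the latter have coefficient 0.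
  An odd degree goes to exactly one factor. The only sign arises when the first variable is odd in
  \<open>Y\<close> and the second is odd in \<open>X\<close>.\<close>

lemma conv_odd_prime:
  fixes X Y :: "nat \<Rightarrow> nat \<Rightarrow> 'k::comm_ring_1 sym_homology"
  assumes p: "odd p" "of_nat p = (0::'k)"
  shows "parity_series 0 0 (conv p X Y) = parity_series 0 0 X \<cdot>\<^sub>H parity_series 0 0 Y"
    "parity_series 0 1 (conv p X Y) =
      parity_series 0 1 X \<cdot>\<^sub>H parity_series 0 0 Y + parity_series 0 0 X \<cdot>\<^sub>H parity_series 0 1 Y"
    "parity_series 1 0 (conv p X Y) =
      parity_series 1 0 X \<cdot>\<^sub>H parity_series 0 0 Y + parity_series 0 0 X \<cdot>\<^sub>H parity_series 1 0 Y"
    "parity_series 1 1 (conv p X Y) =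
      parity_series 1 1 X \<cdot>\<^sub>H parity_series 0 0 Y + parity_series 0 0 X \<cdot>\<^sub>H parity_series 1 1 Y
      + parity_series 1 0 X \<cdot>\<^sub>H parity_series 0 1 Y - parity_series 0 1 X \<cdot>\<^sub>H parity_series 1 0 Y"
proof -
  define f where "f m n i j = homology_scale (kappa p i (m - i) * kappa p j (n - j))
    (alt ((m - i) * j) (dot_prod (X i j) (Y (m - i) (n - j))))" for m n i j
  have conv: "conv p X Y m n = (\<Sum>j\<le>n. \<Sum>i\<le>m. f m n i j)" for m n
    by (simp add: conv_def f_def)
  have zero: "f (2 * m) n i j = 0" if "odd i" "i \<le> 2 * m" for m n i j
    using that kappa_odd[OF p that(1), of "2 * m - i"] by (simp add: f_def)
  have zero': "f m (2 * n) i j = 0" if "odd j" "j \<le> 2 * n" for m n i j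
    using that kappa_odd[OF p that(1), of "2 * n - j"] by (simp add: f_def)
  have d: "2 * m + a - 2 * i = 2 * (m - i) + a" if "i \<le> m" for m i a :: nat
    using that by simp
  have ee: "f (2 * m + a) (2 * n + b) (2 * i) (2 * j) = dot_prod (X (2 * i) (2 * j))
      (Y (2 * (m - i) + a) (2 * (n - j) + b))"
    if "i \<le> m" "j \<le> n" for m n i j a b
    using d[OF that(1), of a] d[OF that(2), of b] by (simp add: f_def alt_def)
  have oe: "f (2 * m + 1) (2 * n + b) (Suc (2 * i)) (2 * j) = dot_prod (X (2 * i + 1) (2 * j))
      (Y (2 * (m - i)) (2 * (n - j) + b))"
    if "i \<le> m" "j \<le> n" for m n i j b
    using d[OF that(1), of 0] d[OF that(2), of b] by (simp add: f_def alt_def)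
  have eo: "f (2 * m + a) (2 * n + 1) (2 * i) (Suc (2 * j)) = alt a
      (dot_prod (X (2 * i) (2 * j + 1)) (Y (2 * (m - i) + a) (2 * (n - j))))"
    if "i \<le> m" "j \<le> n" for m n i j a
    using d[OF that(1), of a] d[OF that(2), of 0] by (simp add: f_def alt_def)
  have oo: "f (2 * m + 1) (2 * n + 1) (Suc (2 * i)) (Suc (2 * j)) = dot_prod
      (X (2 * i + 1) (2 * j + 1)) (Y (2 * (m - i)) (2 * (n - j)))"
    if "i \<le> m" "j \<le> n" for m n i j
    using d[OF that(1), of 0] d[OF that(2), of 0] by (simp add: f_def alt_def)
  have dot: "fps_nth (fps_nth (parity_series a b X \<cdot>\<^sub>H parity_series c d Y) n) m =
      (\<Sum>j\<le>n. \<Sum>i\<le>m. dot_prod (X (2 * i + a) (2 * j + b)) (Y (2 * (m - i) + c) (2 * (n - j) + d)))"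
          for a b c d m n
    by (simp add: dot_series_def fps_prod_ext_nth parity_series_nth)
  have even_even: "conv p X Y (2 * m) (2 * n) = (\<Sum>j\<le>n. \<Sum>i\<le>m. f (2 * m) (2 * n) (2 * i) (2 * j))" for m n
    unfolding conv by (simp add: sum_atMost_even zero zero')
  have even_odd: "conv p X Y (2 * m) (2 * n + 1) = (\<Sum>j\<le>n. \<Sum>i\<le>m. f (2 * m) (2 * n + 1) (2 * i) (2 * j))
      + (\<Sum>j\<le>n. \<Sum>i\<le>m. f (2 * m) (2 * n + 1) (2 * i) (Suc (2 * j)))" for m n
    unfolding conv by (simp add: sum_atMost_even sum_atMost_odd zero del: sum.atMost_Suc)
  have odd_even: "conv p X Y (2 * m + 1) (2 * n) = (\<Sum>j\<le>n. \<Sum>i\<le>m. f (2 * m + 1) (2 * n) (2 * i) (2 * j))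
      + (\<Sum>j\<le>n. \<Sum>i\<le>m. f (2 * m + 1) (2 * n) (Suc (2 * i)) (2 * j))" for m n
    unfolding conv by (simp add: sum_atMost_even sum_atMost_odd zero' sum.distrib del: sum.atMost_Suc)
  have odd_odd: "conv p X Y (2 * m + 1) (2 * n + 1) =
      (\<Sum>j\<le>n. \<Sum>i\<le>m. f (2 * m + 1) (2 * n + 1) (2 * i) (2 * j))
      + (\<Sum>j\<le>n. \<Sum>i\<le>m. f (2 * m + 1) (2 * n + 1) (Suc (2 * i)) (2 * j))
      + (\<Sum>j\<le>n. \<Sum>i\<le>m. f (2 * m + 1) (2 * n + 1) (2 * i) (Suc (2 * j)))
      + (\<Sum>j\<le>n. \<Sum>i\<le>m. f (2 * m + 1) (2 * n + 1) (Suc (2 * i)) (Suc (2 * j)))" for m n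
    unfolding conv by (simp add: sum_atMost_odd sum.distrib add_ac del: sum.atMost_Suc)
  show "parity_series 0 0 (conv p X Y) = parity_series 0 0 X \<cdot>\<^sub>H parity_series 0 0 Y"
    using ee[where a = 0 and b = 0] by (intro hseries_eqI) (simp add: parity_series_nth dot even_even)
  show "parity_series 0 1 (conv p X Y) =
      parity_series 0 1 X \<cdot>\<^sub>H parity_series 0 0 Y + parity_series 0 0 X \<cdot>\<^sub>H parity_series 0 1 Y"
    using ee[where a = 0 and b = 1] eo[where a = 0] even_odd
    by (intro hseries_eqI) (simp add: parity_series_nth dot add.commute)
  show "parity_series 1 0 (conv p X Y) =
      parity_series 1 0 X \<cdot>\<^sub>H parity_series 0 0 Y + parity_series 0 0 X \<cdot>\<^sub>H parity_series 1 0 Y"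
    using ee[where a = 1 and b = 0] oe[where b = 0] odd_even
    by (intro hseries_eqI) (simp add: parity_series_nth dot add.commute)
  show "parity_series 1 1 (conv p X Y) =
      parity_series 1 1 X \<cdot>\<^sub>H parity_series 0 0 Y + parity_series 0 0 X \<cdot>\<^sub>H parity_series 1 1 Y
      + parity_series 1 0 X \<cdot>\<^sub>H parity_series 0 1 Y - parity_series 0 1 X \<cdot>\<^sub>H parity_series 1 0 Y"
    using ee[where a = 1 and b = 1] eo[where a = 1] oe[where b = 1] oo odd_odd
    by (intro hseries_eqI) (simp add: parity_series_nth dot sum_negf algebra_simps)
qed

lemma homology_scale_of_nat: "homology_scale (of_nat n) x = (\<Sum>i<n. x)"
  by (induction n) (simp_all add: homology_scale_distribs add.commute)

lemma scale_series_of_nat: "scale_series (of_nat n) F = (\<Sum>i<n. F)"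
  by (rule hseries_eqI) (simp add: scale_series_def homology_scale_of_nat fps_sum_nth)

lemma scale_series_diff: "scale_series (a - b) F = scale_series a F - scale_series b F"
  by (rule hseries_eqI) (simp add: scale_series_def homology_scale_distribs)

text \<open>Additivity suffices here, since these scalars are repeated sums and differences of
  such.\<close>

lemma additive_scale_series:
  assumes "additive f"
  shows "f (scale_series (of_nat n) F) = scale_series (of_nat n) (f F)"
    "f (scale_series (of_nat m - of_nat n) F) = scale_series (of_nat m - of_nat n) (f F)"
  by (simp_all add: scale_series_diff scale_series_of_nat additive.sum[OF assms]
      additive.diff[OF assms])

lemma additive_fps_prod_ext:
  fixes f :: "'a::ab_group_add \<Rightarrow> 'b::ab_group_add \<Rightarrow> 'c::ab_group_add"
  assumes "\<And>y. additive (\<lambda>x. f x y)" "\<And>x. additive (f x)"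
  shows "additive (\<lambda>F. fps_prod_ext f F G)" "additive (fps_prod_ext f F)"
  by (auto simp: additive_def fps_prod_ext_def fps_eq_iff additive.add[OF assms(1)]
      additive.add[OF assms(2)] sum.distrib)

lemma additive_dot_series: "additive (\<lambda>F. F \<cdot>\<^sub>H G)" "additive (\<lambda>G. F \<cdot>\<^sub>H G)"
  unfolding dot_series_def dot_prod_def
  by (intro additive_fps_prod_ext dot.additive_induced_prod)+

text \<open>A series in s alone times a series in t alone: each coefficient consists of a single
  product, so a product of series becomes a family of products of classes.\<close>

lemma fps_prod_ext_separate:
  assumes f: "\<And>y. additive (\<lambda>x. f x y)" "\<And>x. additive (f x)"
    and F: "\<And>m n. fps_nth (fps_nth F n) m = (if n = 0 then A m else 0)"
    and G: "\<And>m n. fps_nth (fps_nth G n) m = (if m = 0 then B n else 0)"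
  shows "fps_nth (fps_nth (fps_prod_ext (fps_prod_ext f) F G) n) m = f (A m) (B n)"
proof -
  note z = additive.zero[OF f(1)] additive.zero[OF f(2)]
  have "fps_nth (fps_nth (fps_prod_ext (fps_prod_ext f) F G) n) m =
      (\<Sum>j\<le>n. \<Sum>i\<le>m. if j = 0 then (if i = m then f (A i) (B (n - j)) else 0) else 0)"
    unfolding fps_prod_ext_nth by (intro sum.cong refl) (auto simp: F G z)
  also have "\<dots> = (\<Sum>j\<le>n. if j = 0 then f (A m) (B (n - j)) else 0)"
    by (intro sum.cong refl) simp
  finally show ?thesis by simp
qed

lemma var_s_pow_nth: "fps_nth (fps_nth ((var_s :: 'k::comm_ring_1 fps fps) ^ n) j) i =
    (if j = 0 \<and> i = n then 1 else 0)"
  by (simp add: var_s_def fps_const_power)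

lemma var_t_pow_nth: "fps_nth (fps_nth ((var_t :: 'k::comm_ring_1 fps fps) ^ n) j) i =
    (if j = n \<and> i = 0 then 1 else 0)"
  by (simp add: var_t_def)

text \<open>The binomial theorem yields the same weights as the chain map for (a, b) |-> c a + b in
  \<open>power_bisequence\<close>; this is why the lines appear as substitutions.\<close>

lemma linear_form_pow_nth:
  "fps_nth (fps_nth ((of_nat c * var_s + var_t :: 'k::comm_ring_1 fps fps) ^ n) j) i =
    (if n = i + j then of_nat (c ^ i * ((i + j) choose i)) else 0)"
proof -
  have s: "of_nat c * var_s = fps_const (fps_const (of_nat c) * fps_X :: 'k fps)"
    by (simp add: var_s_def fps_of_nat flip: fps_const_mult)
  have pow: "(fps_const (of_nat c) * fps_X :: 'k fps) ^ k = fps_const (of_nat (c ^ k)) * fps_X ^ k"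
      for k
    by (simp add: power_mult_distrib fps_const_power)
  have "(of_nat c * var_s + var_t :: 'k fps fps) ^ n =
      (\<Sum>k\<le>n. of_nat (n choose k) * (fps_const (fps_const (of_nat (c ^ k)) * fps_X ^ k) * fps_X ^
          (n - k)))"
    unfolding binomial_ring s by (simp only: fps_const_power pow var_t_def mult.assoc)
  also have "\<dots> = (\<Sum>k\<le>n. fps_const (fps_const (of_nat (n choose k))) *
      (fps_const (fps_const (of_nat (c ^ k)) * fps_X ^ k) * fps_X ^ (n - k)))"
    by (simp only: fps_of_nat)
  finally have "fps_nth (fps_nth ((of_nat c * var_s + var_t :: 'k fps fps) ^ n) j) i =
      (\<Sum>k\<le>n. of_nat (n choose k) * (of_nat (c ^ k) * (if i = k then 1 else 0) *
          (if j = n - k then 1 else 0)))"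
    by (simp only: fps_sum_nth fps_mult_left_const_nth fps_mult_right_const_nth fps_X_power_nth)
      (intro sum.cong refl, simp add: fps_X_power_nth)
  also have "\<dots> = (\<Sum>k\<le>n. if k = i then if j = n - k then of_nat (c ^ k * (n choose k)) else 0 else 0)"
    by (intro sum.cong refl) (auto simp: mult.commute)
  also have "\<dots> = (if n = i + j then of_nat (c ^ i * ((i + j) choose i)) else 0)"
    by (simp only: sum.delta finite_atMost) auto
  finally show ?thesis .
qed

lemma series_subst_nth:
  "fps_nth (fps_nth (series_subst F var_s) n) m = (if n = 0 then fps_nth F m else 0)"
  "fps_nth (fps_nth (series_subst F var_t) n) m = (if m = 0 then fps_nth F n else 0)"
  "fps_nth (fps_nth (series_subst F (of_nat c * var_s + var_t)) n) m =
    homology_scale (of_nat (c ^ m * ((m + n) choose m))) (fps_nth F (m + n))"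
proof -
  show "fps_nth (fps_nth (series_subst F var_s) n) m = (if n = 0 then fps_nth F m else 0)"
  proof -
    have "fps_nth (fps_nth (series_subst F var_s) n) m =
        (\<Sum>k\<le>m + n. if k = m then if n = 0 then fps_nth F k else 0 else 0)"
      unfolding series_subst_def var_s_pow_nth fps_nth_Abs_fps by (intro sum.cong refl) auto
    then show ?thesis by simp
  qed
  show "fps_nth (fps_nth (series_subst F var_t) n) m = (if m = 0 then fps_nth F n else 0)"
  proof -
    have "fps_nth (fps_nth (series_subst F var_t) n) m =
        (\<Sum>k\<le>m + n. if k = n then if m = 0 then fps_nth F k else 0 else 0)"
      unfolding series_subst_def var_t_pow_nth fps_nth_Abs_fps by (intro sum.cong refl) auto
    then show ?thesis by simp
  qed
  show "fps_nth (fps_nth (series_subst F (of_nat c * var_s + var_t)) n) m =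
    homology_scale (of_nat (c ^ m * ((m + n) choose m))) (fps_nth F (m + n))"
  proof -
    have "fps_nth (fps_nth (series_subst F (of_nat c * var_s + var_t)) n) m =
        (\<Sum>k\<le>m + n. if k = m + n then homology_scale (of_nat (c ^ m * ((m + n) choose m)))
            (fps_nth F k) else 0)"
      unfolding series_subst_def linear_form_pow_nth fps_nth_Abs_fps by (intro sum.cong refl) auto
    then show ?thesis by simp
  qed
qed

text \<open>A primitive root shows that only the degrees congruent to \<open>0\<close> and \<open>-1\<close> modulo
  \<open>2 (p - 1)\<close> contribute.\<close>

lemma cyc_class_zero:
  assumes p: "p = CARD('p::prime_card)" and n: "\<not> (p - 1) dvd ((n + 1) div 2)"
  shows "cyc_class p n = (0 :: 'p mod_ring sym_homology)"
proof -
  have prime: "prime p" using p prime_card[where 'a = 'p] by simp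
  have p1: "p > 1" by (rule prime_gt_1_nat[OF prime])
  have char: "of_nat p = (0 :: 'p mod_ring)"
    unfolding p by (rule of_nat_card_eq_0)
  obtain u where u: "residue_primroot p u"
    using prime_primitive_root_exists[OF _ prime] p1 by auto
  then have coprime: "coprime u p" and ord: "ord p u = p - 1"
    using prime by (auto simp: residue_primroot_def totient_prime coprime_commute)
  let ?k = "(n + 1) div 2"
  have "\<not> [u ^ ?k = 1] (mod p)"
    using n ord ord_divides[of u ?k p] by simp
  then have ne: "(of_nat (u ^ ?k) :: 'p mod_ring) - 1 \<noteq> 0"
  proof -
    have "u \<noteq> 0" using coprime p1 by (intro notI) simp
    then have "u ^ ?k \<noteq> 0" by simp
    then have "of_nat (u ^ ?k - 1) = (of_nat (u ^ ?k) - 1 :: 'p mod_ring)"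
      by (subst of_nat_diff) auto
    moreover have "\<not> p dvd u ^ ?k - 1"
      using \<open>\<not> [u ^ ?k = 1] (mod p)\<close> \<open>u ^ ?k \<noteq> 0\<close> cong_altdef_nat[of 1 "u ^ ?k" p] by (auto simp: cong_sym_eq)
    ultimately show ?thesis
      using of_nat_0_mod_ring_dvd[where 'a = 'p, of "u ^ ?k - 1"] p by metis
  qed
  have "homology_scale (of_nat (u ^ ?k) - 1) (cyc_class p n :: 'p mod_ring sym_homology) = 0"
    using cyc_class_unit[OF p1 char coprime, of n] by (simp add: homology_scale_distribs)
  then have "homology_scale (inverse (of_nat (u ^ ?k) - 1) * (of_nat (u ^ ?k) - 1))
      (cyc_class p n :: 'p mod_ring sym_homology) = 0"
    by (simp flip: homology_scale_simps(4))
  with ne show ?thesis by simp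
qed

text \<open>When p - 1 divides m + \<epsilon>, the degrees agree by definition. For all other m the
  series has coefficient 0 by construction, and the class vanishes by
  \<open>cyc_class_zero\<close>.\<close>

lemma Et_series_nth:
  assumes p: "p = CARD('p::prime_card)" "odd p" and \<epsilon>: "\<epsilon> \<le> 1"
  shows "fps_nth (Et_series p \<epsilon> :: 'p mod_ring sym_homology fps) m = cyc_class p (2 * m + \<epsilon>)"
proof -
  have "prime p" using p prime_card[where 'a = 'p] by simp
  then have p1: "p > 1" by (rule prime_gt_1_nat)
  have half: "(2 * m + \<epsilon> + 1) div 2 = m + \<epsilon>" using \<epsilon> by (cases \<epsilon>) auto
  show ?thesis
  proof (cases "(p - 1) dvd (m + \<epsilon>)")
    case True
    then obtain q where q: "m + \<epsilon> = (p - 1) * q" by (elim dvdE)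
    then have "\<epsilon> \<le> q" using \<epsilon> by (cases q) auto
    moreover have "2 * (p - 1) * q - \<epsilon> = 2 * m + \<epsilon>"
      using q by (simp add: mult.assoc)
    ultimately show ?thesis
      using q p1 p(2) by (auto simp: Et_series_def fps_stretch_def E_series_def E_class_def)
  next
    case False
    then show ?thesis
      using cyc_class_zero[OF p(1), of "2 * m + \<epsilon>"] half
      by (simp add: Et_series_def fps_stretch_def)
  qed
qed

lemma parity_series_separate:
  assumes "\<And>y. additive (\<lambda>x. f x y)" "\<And>x. additive (f x)"
    and "\<And>m. fps_nth F m = A (2 * m + a)" "\<And>n. fps_nth G n = B (2 * n + b)"
  shows "fps_prod_ext (fps_prod_ext f) (series_subst F var_s) (series_subst G var_t) =
    parity_series a b (\<lambda>m n. f (A m) (B n))"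
  by (rule hseries_eqI)
    (subst fps_prod_ext_separate[OF assms(1,2), where A = "\<lambda>m. A (2 * m + a)" and B =
        "\<lambda>n. B (2 * n + b)"],
      simp_all add: series_subst_nth assms(3,4) parity_series_nth)

text \<open>In odd first degree 2i + 1 the exponent of c is i + 1, one more than the substitution
  provides. This excess is the origin of the factors k in the identities.\<close>

lemma parity_series_power_classes:
  fixes c :: nat
  assumes p: "p = CARD('p::prime_card)" "odd p"
  defines "X \<equiv> power_classes p c :: nat \<Rightarrow> nat \<Rightarrow> 'p mod_ring sym_homology"
    and "L \<equiv> of_nat c * var_s + var_t :: 'p mod_ring fps fps"
  shows "parity_series 0 0 X = series_subst (Et_series p 0) L"
    "parity_series 0 1 X = series_subst (Et_series p 1) L"
    "parity_series 1 0 X = scale_series (of_nat c) (series_subst (Et_series p 1) L)"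
    "parity_series 1 1 X = 0"
  by (rule hseries_eqI; simp add: X_def L_def parity_series_nth series_subst_nth Et_series_nth[OF p]
      power_classes_def scale_series_def mult.assoc; simp add: algebra_simps)+

text \<open>Generalizes \<open>dot_prod_upto\<close> from all slopes below p to any list of slopes,
  for the induction in \<open>realizes_lines\<close>.\<close>

definition line_prod :: "nat \<Rightarrow> (nat \<Rightarrow> nat) \<Rightarrow> nat list \<Rightarrow> 'k::comm_ring_1 hseries"
  where "line_prod p \<epsilon> cs = foldr (\<lambda>c G. series_subst (Et_series p (\<epsilon> c))
      (of_nat c * var_s + var_t) \<cdot>\<^sub>H G) cs
    (const_series (point_class 0))"

abbreviation unit_at :: "nat \<Rightarrow> nat \<Rightarrow> nat"
  where "unit_at k \<equiv> (\<lambda>c. if c = k then 1 else 0)"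

lemma line_prod_Cons:
  "line_prod p \<epsilon> (c # cs) = series_subst (Et_series p (\<epsilon> c)) (of_nat c * var_s + var_t) \<cdot>\<^sub>H
      line_prod p \<epsilon> cs"
  by (simp add: line_prod_def)

lemma line_prod_cong: "(\<And>c. c \<in> set cs \<Longrightarrow> \<epsilon> c = \<epsilon>' c) \<Longrightarrow> line_prod p \<epsilon> cs = line_prod p \<epsilon>' cs"
  by (induction cs) (simp_all add: line_prod_def)

text \<open>Induction on the list, joining one set of affine functions at a time by
  \<open>realizes_union\<close>. Since the list is increasing, the new slope is smaller than all
  others, which gives both the order of the factors and the condition l < k.\<close>

lemma realizes_lines:
  assumes p: "p = CARD('p::prime_card)" "odd p"
    and cs: "sorted cs" "distinct cs" "set cs \<subseteq> {..<p}"
  obtains X :: "nat \<Rightarrow> nat \<Rightarrow> 'p::prime_card mod_ring sym_homology"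
  where "realizes p (\<Union>c\<in>set cs. slope_maps p c) (pre_rot p) (post_rot p) X"
    "parity_series 0 0 X = line_prod p (\<lambda>_. 0) cs"
    "parity_series 0 1 X = (\<Sum>k\<in>set cs. line_prod p (unit_at k) cs)"
    "parity_series 1 0 X = (\<Sum>k\<in>set cs. scale_series (of_nat k) (line_prod p (unit_at k) cs))"
    "parity_series 1 1 X = - (\<Sum>k\<in>set cs. \<Sum>l | l \<in> set cs \<and> l < k.
       scale_series (of_nat k - of_nat l) (line_prod p (\<lambda>c. unit_at k c + unit_at l c) cs))"
  using cs
proof (induction cs arbitrary: thesis)
  case Nil
  have char: "of_nat p = (0 :: 'p mod_ring)" unfolding p by (rule of_nat_card_eq_0)
  show ?case
  proof (rule Nil(1))
    show "realizes p (\<Union>c\<in>set []. slope_maps p c) (pre_rot p) (post_rot p)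
        (\<lambda>m n. if m = 0 \<and> n = 0 then point_class 0 else (0 :: 'p mod_ring sym_homology))"
      using realizes_empty[OF char] by simp
  qed (rule hseries_eqI, simp add: parity_series_nth line_prod_def const_series_def)+
next
  case (Cons c cs)
  have prime: "prime p" using p prime_card[where 'a = 'p] by simp
  have p1: "p > 1" by (rule prime_gt_1_nat[OF prime])
  have char: "of_nat p = (0 :: 'p mod_ring)" unfolding p by (rule of_nat_card_eq_0)
  have c: "c \<notin> set cs" "\<And>k. k \<in> set cs \<Longrightarrow> c < k"
    using Cons.prems(2,3) by (auto simp: order.strict_iff_order)
  obtain Y :: "nat \<Rightarrow> nat \<Rightarrow> 'p mod_ring sym_homology"
    where Y: "realizes p (\<Union>c\<in>set cs. slope_maps p c) (pre_rot p) (post_rot p) Y"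
    "parity_series 0 0 Y = line_prod p (\<lambda>_. 0) cs"
    "parity_series 0 1 Y = (\<Sum>k\<in>set cs. line_prod p (unit_at k) cs)"
    "parity_series 1 0 Y = (\<Sum>k\<in>set cs. scale_series (of_nat k) (line_prod p (unit_at k) cs))"
    "parity_series 1 1 Y = - (\<Sum>k\<in>set cs. \<Sum>l | l \<in> set cs \<and> l < k.
       scale_series (of_nat k - of_nat l) (line_prod p (\<lambda>c. unit_at k c + unit_at l c) cs))"
    using Cons.IH Cons.prems(2-4) by auto
  let ?P = "power_classes p c :: nat \<Rightarrow> nat \<Rightarrow> 'p mod_ring sym_homology"
  obtain b where "bisequence (sym_group p) p (rot p ^^ c) (rot p) b"
    "\<And>m n. sym_class p (coinv (b m n)) = ?P m n"
    using power_classes_bisequence[OF p1 char, of c] by blast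
  then have "realizes p (slope_maps p c) (pre_rot p) (post_rot p) ?P"
    by (intro realizes_slope[OF p1 char]) auto
  moreover have "slope_maps p c \<inter> (\<Union>c\<in>set cs. slope_maps p c) = {}"
    using slope_maps_disjoint[of p c] c(1) Cons.prems(4) p1 by auto
  ultimately have "realizes p (slope_maps p c \<union> (\<Union>c\<in>set cs. slope_maps p c)) (pre_rot p)
      (post_rot p) (conv p ?P Y)"
    by (rule realizes_union[OF char _ Y(1)])
  then have Z: "realizes p (\<Union>c\<in>set (c # cs). slope_maps p c) (pre_rot p) (post_rot p) (conv p ?P Y)"
    by simp
  define F where "F \<epsilon> = (series_subst (Et_series p \<epsilon>) (of_nat c * var_s + var_t) :: 'p mod_ring
      hseries)" for \<epsilon>
  have P: "parity_series 0 0 ?P = F 0" "parity_series 0 1 ?P = F 1"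
    "parity_series 1 0 ?P = scale_series (of_nat c) (F 1)" "parity_series 1 1 ?P = 0"
    using parity_series_power_classes[OF p, of c] by (simp_all add: F_def)
  note add = additive_dot_series
  note add_simps = additive.zero[OF add(1)] additive.zero[OF add(2)] additive.add[OF add(2)]
    additive.minus[OF add(2)] additive.sum[OF add(2)] additive_scale_series[OF add(1)]
        additive_scale_series[OF add(2)]
  have G0: "line_prod p (unit_at c) cs = line_prod p (\<lambda>_. 0) cs"
    using c(1) by (intro line_prod_cong) auto
  have Gk: "line_prod p (\<lambda>d. unit_at k d + unit_at c d) cs = line_prod p (unit_at k) cs" for k
    using c(1) by (intro line_prod_cong) auto
  have ne: "k \<noteq> c" "c \<noteq> k" if "k \<in> set cs" for k using c(1) that by auto
  have L: "line_prod p \<epsilon> (c # cs) = F (\<epsilon> c) \<cdot>\<^sub>H line_prod p \<epsilon> cs" for \<epsilon>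
    by (simp add: line_prod_Cons F_def)
  note conv = conv_odd_prime[OF p(2) char, of ?P Y, unfolded P Y add_simps]
  show ?case
  proof (rule Cons.prems(1)[OF Z])
    show "parity_series 0 0 (conv p ?P Y) = line_prod p (\<lambda>_. 0) (c # cs)"
      unfolding conv by (simp add: L)
    show "parity_series 0 1 (conv p ?P Y) = (\<Sum>k\<in>set (c # cs). line_prod p (unit_at k) (c # cs))"
      using c(1) unfolding conv by (simp add: L G0 ne)
    show "parity_series 1 0 (conv p ?P Y) = (\<Sum>k\<in>set (c # cs). scale_series (of_nat k)
        (line_prod p (unit_at k) (c # cs)))"
      using c(1) unfolding conv by (simp add: L G0 ne)
    have l: "{l. l \<in> set (c # cs) \<and> l < k} = insert c {l. l \<in> set cs \<and> l < k}" if "k \<in> set cs" for k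
      using c(2)[OF that] by auto
    have l': "{l. l \<in> set (c # cs) \<and> l < c} = {}"
      using c(2) by force
    \<comment> \<open>The pairs (k, c) with the new slope c get the coefficient c from the product
      of the (1,0) and (0,1) components and -k from the product of the (0,1) and (1,0) components;
      this is -(k - c).\<close>
    have "(\<Sum>k\<in>set (c # cs). \<Sum>l | l \<in> set (c # cs) \<and> l < k.
       scale_series (of_nat k - of_nat l) (line_prod p (\<lambda>c. unit_at k c + unit_at l c) (c # cs)))
      = (\<Sum>k\<in>set cs. scale_series (of_nat k - of_nat c) (F 1 \<cdot>\<^sub>H line_prod p (unit_at k) cs)
         + (\<Sum>l | l \<in> set cs \<and> l < k. scale_series (of_nat k - of_nat l)
             (F 0 \<cdot>\<^sub>H line_prod p (\<lambda>c. unit_at k c + unit_at l c) cs)))"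
      unfolding set_simps(2) sum.insert[OF finite_set c(1)] l'[unfolded set_simps(2)] sum.empty
          add_0_left
    proof (rule sum.cong[OF refl])
      fix k assume k: "k \<in> set cs"
      show "(\<Sum>l | l \<in> insert c (set cs) \<and> l < k.
          scale_series (of_nat k - of_nat l) (line_prod p (\<lambda>c. unit_at k c + unit_at l c) (c # cs))) =
        scale_series (of_nat k - of_nat c) (F 1 \<cdot>\<^sub>H line_prod p (unit_at k) cs)
         + (\<Sum>l | l \<in> set cs \<and> l < k. scale_series (of_nat k - of_nat l)
             (F 0 \<cdot>\<^sub>H line_prod p (\<lambda>c. unit_at k c + unit_at l c) cs))"
        unfolding l[OF k, unfolded set_simps(2)]
        using c(1) by (subst sum.insert) (simp_all add: L Gk ne[OF k] ne cong: sum.cong_simp)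
    qed
    then show "parity_series 1 1 (conv p ?P Y) = - (\<Sum>k\<in>set (c # cs). \<Sum>l | l \<in> set (c # cs) \<and> l < k.
       scale_series (of_nat k - of_nat l) (line_prod p (\<lambda>c. unit_at k c + unit_at l c) (c # cs)))"
      unfolding conv by (simp add: scale_series_diff sum.distrib sum_subtractf)
  qed
qed

section \<open>The identity for p = 2\<close>

lemma char_two:
  assumes "(2::'k::comm_ring_1) = 0" shows "- x = (x :: 'k sym_homology)"
proof -
  have "x + x = homology_scale (1 + 1) x"
    by (simp only: homology_scale_distribs homology_scale_simps)
  also have "\<dots> = 0"
    using assms by simp
  finally show ?thesis
    by (simp add: minus_unique)
qed

definition double_series :: "(nat \<Rightarrow> nat \<Rightarrow> 'k sym_homology) \<Rightarrow> 'k::comm_ring_1 hseries"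
  where "double_series X = Abs_fps (\<lambda>n. Abs_fps (\<lambda>m. X m n))"

lemma double_series_nth: "fps_nth (fps_nth (double_series X) n) m = X m n"
  by (simp add: double_series_def)

text \<open>Here 0 + 1 = 1, so all coefficients of the diagonal are 1, and signs disappear in
  characteristic 2.\<close>

lemma conv_two:
  fixes X Y :: "nat \<Rightarrow> nat \<Rightarrow> 'k::comm_ring_1 sym_homology"
  assumes "(2::'k) = 0"
  shows "double_series (conv 2 X Y) = double_series X \<cdot>\<^sub>H double_series Y"
proof -
  have "kappa 2 i j = (1::'k)" for i j
    by (simp add: kappa_def lessThan_Suc numeral_2_eq_2)
  moreover have "alt n x = x" for n and x :: "'k sym_homology"
    by (simp add: alt_def char_two[OF assms])
  ultimately show ?thesis
    by (intro hseries_eqI) (simp add: double_series_nth conv_def dot_series_def fps_prod_ext_nth)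
qed

lemma E_series_nth_two: "fps_nth (E_series 2 0) n = cyc_class 2 n"
  by (simp add: E_series_def E_class_def)

lemma two_identity:
  assumes p: "CARD('p::prime_card) = 2"
  defines "E \<equiv> E_series 2 0 :: 'p mod_ring sym_homology fps"
  shows "series_subst E var_s \<sharp>\<^sub>H series_subst E var_t =
    series_subst E (var_s + var_t) \<cdot>\<^sub>H series_subst E var_t"
proof -
  interpret G: group "sym_group 2" by (rule sym_group_is_group)
  have char: "of_nat 2 = (0 :: 'p mod_ring)" using of_nat_card_eq_0[where 'a = 'p] p by simp
  then have two: "(2 :: 'p mod_ring) = 0" by simp
  have p1: "(2::nat) > 1" by simp
  \<comment> \<open>For slope 0 the power of 0 leaves only the terms with m = 0; their series is
    E(t).\<close>
  let ?P = "power_classes 2 0 :: nat \<Rightarrow> nat \<Rightarrow> 'p mod_ring sym_homology"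
  let ?Q = "\<lambda>m n. homology_scale (of_nat ((m + n) choose m)) (cyc_class 2 (m + n)) :: 'p mod_ring
      sym_homology"
  obtain b where "bisequence (sym_group 2) 2 (rot 2 ^^ 0) (rot 2) b"
    "\<And>m n. sym_class 2 (coinv (b m n)) = ?P m n"
    using power_classes_bisequence[OF p1 char, of 0] by blast
  then have P: "realizes 2 (slope_maps 2 0) (pre_rot 2) (post_rot 2) ?P"
    by (intro realizes_slope[OF p1 char]) auto
  have "bisequence (sym_group 2) 2 (rot 2 ^^ 1) (rot 2)
      (\<lambda>m n. chain_scale (of_nat ((m + n) choose m)) (cyc_seq 2 (m + n) :: _ \<Rightarrow>\<^sub>0 'p mod_ring))"
    using G.binomial_bisequence[OF two cyc_seq_sequence[OF p1 char]] by simp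
  then have Q: "realizes 2 (slope_maps 2 1) (pre_rot 2) (post_rot 2) ?Q"
    by (rule realizes_slope[OF p1 char]) (simp add: cyc_class_eq sym_class_scale
        cyc_seq_cycles[OF p1 char])
  have "finite (free_maps 2)" by (simp add: free_maps_def finite_maps)
  then have "free_maps 2 = {}"
    using card_free_maps[of 2] by simp
  \<comment> \<open>All four functions are affine. Slope 1 is put first so that its factor E(s + t)
    stands on the left.\<close>
  then have maps: "maps 2 = slope_maps 2 1 \<union> slope_maps 2 0"
    using maps_decomposition[of 2] by (simp add: lessThan_Suc numeral_2_eq_2)
  have "realizes 2 (maps 2) (pre_rot 2) (post_rot 2) (conv 2 ?Q ?P)"
    unfolding maps by (rule realizes_union[OF char Q P]) (rule slope_maps_disjoint; simp)
  moreover have "realizes 2 (maps 2) (pre_rot 2) (post_rot 2)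
      (\<lambda>m n. sharp_prod (cyc_class 2 m) (cyc_class 2 n) :: 'p mod_ring sym_homology)"
    using realizes_sharp[OF p1 char] by (simp add: maps_def pre_rot_def[abs_def] post_rot_def[abs_def])
  ultimately have "conv 2 ?Q ?P = (\<lambda>m n. sharp_prod (cyc_class 2 m) (cyc_class 2 n))"
    by (rule realizes_unique[OF char])
  then have "double_series (\<lambda>m n. sharp_prod (cyc_class 2 m) (cyc_class 2 n)) = double_series ?Q
      \<cdot>\<^sub>H double_series ?P"
    using conv_two[OF two, of ?Q ?P] by simp
  moreover have "double_series (\<lambda>m n. sharp_prod (cyc_class 2 m) (cyc_class 2 n)) =
      series_subst E var_s \<sharp>\<^sub>H series_subst E var_t"
    unfolding sharp_series_def
    by (rule hseries_eqI)
      (simp add: double_series_nth fps_prod_ext_separate[where A = "cyc_class 2" and B = "cyc_class 2"]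
        series_subst_nth E_def E_series_nth_two sharp_prod_def sharp.additive_induced_prod)
  moreover have "double_series ?Q = series_subst E (var_s + var_t)"
    using series_subst_nth(3)[of E 1] by (intro hseries_eqI)
        (simp add: double_series_nth E_def E_series_nth_two)
  moreover have "double_series ?P = series_subst E var_t"
    by (rule hseries_eqI)
      (auto simp: double_series_nth power_classes_def series_subst_nth E_def E_series_nth_two
          power_0_left
        elim!: evenE)
  ultimately show ?thesis by simp
qed

text \<open>The sharp products and the convolution of the free part with the lines are both realized
  on the set of all functions. Uniqueness equates the two families in every bidegree; the four
  identities are its parity components, expanded by \<open>conv_odd_prime\<close>.\<close>

lemma odd_identities:
  assumes p: "p = CARD('p::prime_card)" "odd p"
  defines "E \<equiv> \<lambda>\<epsilon>. Et_series p \<epsilon> :: 'p mod_ring sym_homology fps"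
  defines "S \<equiv> \<lambda>a b. series_subst (E a) var_s \<sharp>\<^sub>H series_subst (E b) var_t"
    and "C \<equiv> \<lambda>a b. const_series (point_class (p ^ (p - 2) - 1)) \<circ>\<^sub>H series_subst (E a) var_s \<circ>\<^sub>H
        series_subst (E b) var_t"
    and "L \<equiv> \<lambda>\<epsilon>. line_prod p \<epsilon> [0..<p]"
  shows "S 0 0 = C 0 0 \<cdot>\<^sub>H L (\<lambda>_. 0)"
    "S 0 1 = C 0 1 \<cdot>\<^sub>H L (\<lambda>_. 0) + C 0 0 \<cdot>\<^sub>H (\<Sum>k<p. L (unit_at k))"
    "S 1 0 = C 1 0 \<cdot>\<^sub>H L (\<lambda>_. 0) + C 0 0 \<cdot>\<^sub>H (\<Sum>k<p. scale_series (of_nat k) (L (unit_at k)))"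
    "S 1 1 = C 1 1 \<cdot>\<^sub>H L (\<lambda>_. 0)
      + C 0 0 \<cdot>\<^sub>H - (\<Sum>k<p. \<Sum>l<k. scale_series (of_nat k - of_nat l) (L (\<lambda>c. unit_at k c + unit_at l c)))
      + C 1 0 \<cdot>\<^sub>H (\<Sum>k<p. L (unit_at k)) - C 0 1 \<cdot>\<^sub>H (\<Sum>k<p. scale_series (of_nat k) (L (unit_at k)))"
proof -
  have prime: "prime p" using p prime_card[where 'a = 'p] by simp
  have p1: "p > 1" by (rule prime_gt_1_nat[OF prime])
  have char: "of_nat p = (0 :: 'p mod_ring)" unfolding p by (rule of_nat_card_eq_0)
  let ?N = "p ^ (p - 2) - 1"
  let ?W = "\<lambda>m n. circ_prod (circ_prod (point_class ?N) (cyc_class p m)) (cyc_class p n) :: 'p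
      mod_ring sym_homology"
  let ?V = "\<lambda>m n. sharp_prod (cyc_class p m) (cyc_class p n) :: 'p mod_ring sym_homology"
  obtain X :: "nat \<Rightarrow> nat \<Rightarrow> 'p mod_ring sym_homology"
    where X: "realizes p (\<Union>c\<in>set [0..<p]. slope_maps p c) (pre_rot p) (post_rot p) X"
    "parity_series 0 0 X = L (\<lambda>_. 0)"
    "parity_series 0 1 X = (\<Sum>k\<in>set [0..<p]. L (unit_at k))"
    "parity_series 1 0 X = (\<Sum>k\<in>set [0..<p]. scale_series (of_nat k) (L (unit_at k)))"
    "parity_series 1 1 X = - (\<Sum>k\<in>set [0..<p]. \<Sum>l | l \<in> set [0..<p] \<and> l < k.
       scale_series (of_nat k - of_nat l) (L (\<lambda>c. unit_at k c + unit_at l c)))"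
    unfolding L_def by (rule realizes_lines[OF p, of "[0..<p]"]) auto
  have "realizes p (free_maps p \<union> (\<Union>c\<in>set [0..<p]. slope_maps p c)) (pre_rot p) (post_rot p)
      (conv p ?W X)"
    by (rule realizes_union[OF char realizes_free[OF prime char] X(1)]) (auto simp: free_maps_def)
  then have "realizes p (maps p) (pre_rot p) (post_rot p) (conv p ?W X)"
    unfolding atLeast_upt[symmetric] maps_decomposition[symmetric] .
  moreover have "realizes p (maps p) (pre_rot p) (post_rot p) ?V"
    using realizes_sharp[OF p1 char] by (simp add: maps_def pre_rot_def[abs_def] post_rot_def[abs_def])
  ultimately have eq: "conv p ?W X = ?V"
    by (rule realizes_unique[OF char])
  have S: "S a b = parity_series a b ?V" if "a \<le> 1" "b \<le> 1" for a b
    unfolding S_def sharp_series_def sharp_prod_def E_def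
    by (rule parity_series_separate[OF sharp.additive_induced_prod Et_series_nth[OF p that(1)]
        Et_series_nth[OF p that(2)]])
  have C: "C a b = parity_series a b ?W" if "a \<le> 1" "b \<le> 1" for a b
  proof (rule hseries_eqI)
    fix m n
    define K where "K = const_series (point_class ?N) \<circ>\<^sub>H series_subst (E a) var_s"
    have *: "fps_nth (fps_nth K j) i =
        (if j = 0 then circ_prod (point_class ?N) (cyc_class p (2 * i + a)) else 0)" for i j
    proof -
      note z = additive.zero[OF circ.additive_induced_prod(1)]
          additive.zero[OF circ.additive_induced_prod(2)]
      have "fps_nth (fps_nth K j) i =
          (\<Sum>j'\<le>j. \<Sum>i'\<le>i. if i' = 0 then if j' = 0 then if j = 0 then
            circ_prod (point_class ?N) (cyc_class p (2 * i + a)) else 0 else 0 else 0)"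
        unfolding K_def circ_series_def fps_prod_ext_nth
        by (intro sum.cong refl)
          (auto simp: const_series_def series_subst_nth E_def Et_series_nth[OF p that(1)]
              circ_prod_def z)
      then show ?thesis by simp
    qed
    show "fps_nth (fps_nth (C a b) n) m = fps_nth (fps_nth (parity_series a b ?W) n) m"
      unfolding C_def K_def[symmetric] unfolding circ_series_def
      by (subst fps_prod_ext_separate[where A = "\<lambda>i. circ_prod (point_class ?N)
          (cyc_class p (2 * i + a))"
            and B = "\<lambda>j. cyc_class p (2 * j + b)"])
        (simp_all add: * series_subst_nth E_def Et_series_nth[OF p that(2)] parity_series_nth
            circ_prod_def
          circ.additive_induced_prod)
  qed
  have lt: "{l. l < p \<and> l < k} = {..<k}" if "k < p" for k
    using that by auto
  note conv = conv_odd_prime[OF p(2) char, of ?W X, unfolded eq X]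
  show "S 0 0 = C 0 0 \<cdot>\<^sub>H L (\<lambda>_. 0)"
    using conv(1) by (simp add: S C)
  show "S 0 1 = C 0 1 \<cdot>\<^sub>H L (\<lambda>_. 0) + C 0 0 \<cdot>\<^sub>H (\<Sum>k<p. L (unit_at k))"
    using conv(2) by (simp add: S C atLeast0LessThan)
  show "S 1 0 = C 1 0 \<cdot>\<^sub>H L (\<lambda>_. 0) + C 0 0 \<cdot>\<^sub>H (\<Sum>k<p. scale_series (of_nat k) (L (unit_at k)))"
    using conv(3) by (simp add: S C atLeast0LessThan)
  show "S 1 1 = C 1 1 \<cdot>\<^sub>H L (\<lambda>_. 0)
      + C 0 0 \<cdot>\<^sub>H - (\<Sum>k<p. \<Sum>l<k. scale_series (of_nat k - of_nat l) (L (\<lambda>c. unit_at k c + unit_at l c)))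
      + C 1 0 \<cdot>\<^sub>H (\<Sum>k<p. L (unit_at k)) - C 0 1 \<cdot>\<^sub>H (\<Sum>k<p. scale_series (of_nat k) (L (unit_at k)))"
    using conv(4) by (simp add: S C atLeast0LessThan lt)
qed

theorem theorem90:
  fixes p :: nat
    and s t :: "'p::prime_card mod_ring fps fps"
    and E0 :: "'p mod_ring fps fps \<Rightarrow> 'p mod_ring hseries"
    and Et :: "nat \<Rightarrow> 'p mod_ring fps fps \<Rightarrow> 'p mod_ring hseries"
    and N :: "'p mod_ring hseries"
    and \<delta> :: "nat \<Rightarrow> nat \<Rightarrow> nat"
  assumes p: "p = CARD('p)"
  defines "s \<equiv> var_s" and "t \<equiv> var_t"
    and "E0 \<equiv> series_subst (E_series p 0)"
    and "Et \<equiv> (\<lambda>\<epsilon>. series_subst (Et_series p \<epsilon>))"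
    and "N \<equiv> const_series (point_class (p ^ (p - 2) - 1))"
    and "\<delta> \<equiv> (\<lambda>i j. if i = j then 1 else 0)"
  shows
    "(p = 2 \<longrightarrow> E0 s \<sharp>\<^sub>H E0 t = E0 (s + t) \<cdot>\<^sub>H E0 t)
   \<and> (odd p \<longrightarrow>
       Et 0 s \<sharp>\<^sub>H Et 0 t =
         (N \<circ>\<^sub>H Et 0 s \<circ>\<^sub>H Et 0 t) \<cdot>\<^sub>H dot_prod_upto p (\<lambda>c. Et 0 (of_nat c * s + t))
     \<and> Et 0 s \<sharp>\<^sub>H Et 1 t =
         (N \<circ>\<^sub>H Et 0 s \<circ>\<^sub>H Et 1 t) \<cdot>\<^sub>H dot_prod_upto p (\<lambda>c. Et 0 (of_nat c * s + t))
         + (N \<circ>\<^sub>H Et 0 s \<circ>\<^sub>H Et 0 t) \<cdot>\<^sub>H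
             (\<Sum>k<p. dot_prod_upto p (\<lambda>c. Et (\<delta> c k) (of_nat c * s + t)))
     \<and> Et 1 s \<sharp>\<^sub>H Et 0 t =
         (N \<circ>\<^sub>H Et 1 s \<circ>\<^sub>H Et 0 t) \<cdot>\<^sub>H dot_prod_upto p (\<lambda>c. Et 0 (of_nat c * s + t))
         + (N \<circ>\<^sub>H Et 0 s \<circ>\<^sub>H Et 0 t) \<cdot>\<^sub>H
             (\<Sum>k<p. scale_series (of_nat k)
               (dot_prod_upto p (\<lambda>c. Et (\<delta> c k) (of_nat c * s + t))))
     \<and> Et 1 s \<sharp>\<^sub>H Et 1 t =
         (N \<circ>\<^sub>H Et 1 s \<circ>\<^sub>H Et 1 t) \<cdot>\<^sub>H dot_prod_upto p (\<lambda>c. Et 0 (of_nat c * s + t))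
         - (N \<circ>\<^sub>H Et 0 s \<circ>\<^sub>H Et 1 t) \<cdot>\<^sub>H
             (\<Sum>k<p. scale_series (of_nat k)
               (dot_prod_upto p (\<lambda>c. Et (\<delta> c k) (of_nat c * s + t))))
         + (N \<circ>\<^sub>H Et 1 s \<circ>\<^sub>H Et 0 t) \<cdot>\<^sub>H
             (\<Sum>k<p. dot_prod_upto p (\<lambda>c. Et (\<delta> c k) (of_nat c * s + t)))
         - (N \<circ>\<^sub>H Et 0 s \<circ>\<^sub>H Et 0 t) \<cdot>\<^sub>H
             (\<Sum>k<p. \<Sum>l<k. scale_series (of_nat k - of_nat l)
               (dot_prod_upto p (\<lambda>c. Et (\<delta> c k + \<delta> c l) (of_nat c * s + t)))))"
proof (intro conjI impI, goal_cases)
  case 1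
  then show ?case
    using two_identity[where 'p = 'p] p by (simp add: E0_def s_def t_def)
next
  case 2
  from odd_identities(1)[OF p this] show ?case
    by (simp add: line_prod_def dot_prod_upto_def Et_def s_def t_def N_def)
next
  case 3
  from odd_identities(2)[OF p this] show ?case
    by (simp add: line_prod_def dot_prod_upto_def Et_def s_def t_def N_def \<delta>_def)
next
  case 4
  from odd_identities(3)[OF p this] show ?case
    by (simp add: line_prod_def dot_prod_upto_def Et_def s_def t_def N_def \<delta>_def)
next
  case 5
  from odd_identities(4)[OF p this] show ?case
    by (simp add: line_prod_def dot_prod_upto_def Et_def s_def t_def N_def \<delta>_def
        additive.minus[OF additive_dot_series(2)])
qed

end
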